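(* Let $\alpha\in[1,2]$, let $u_0\in H^{1+\alpha}_p(I)$ be smooth, and let $t_c$ be the critical (gradient catastrophe) time of the inviscid Burgers equation $v_t+6vv_x=0$, $v(x,0)=u_0(x)$. Let $T_c$ be any positive time with $T_c<t_c$. For $\varepsilon>0$ let $u(x,t;\varepsilon)\in C([0,T_c];H^{1+\alpha}_p(I))\cap C^1([0,T_c];L^2_p(I))$ be the unique solution of the fractional KdV equation \[ u_t+6uu_x-\varepsilon^2\mathcal{D}^\alpha u_x=0,\qquad u(x,0)=u_0(x). \] Then the map $\varepsilon\mapsto u(\cdot,\cdot;\varepsilon)$ is continuous from $\mathbb{R}^+$ to $C([0,T_c];H^{1+\alpha}_p(I))\cap C^1([0,T_c];L^2_p(I))$. Moreover, \[ \lim_{\varepsilon\to0}\|u(t;\varepsilon)-v^b(t)\|_{1+\alpha}=0 \] uniformly in $t\in[0,T_c]$, where $v^b$ solves $v^b_t+6v^bv^b_x=0$, $v^b(x,0)=u_0(x)$.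
   Context: $I=[-\pi,\pi]$; functions are $2\pi$-periodic. For $f\in L^2(I)$, $\hat f(k)=\frac{1}{2\pi}\int_I f(x)e^{-ikx}dx$. $H^r_p(I)$ is the space of $2\pi$-periodic functions with finite norm $\|f\|_r=\left(\sum_{k\in\mathbb{Z}}(1+|k|^2)^r|\hat f(k)|^2\right)^{1/2}$, $L^2_p=H^0_p$. $\mathcal{D}^\alpha f=\sum_k|k|^\alpha\hat f(k)e^{ikx}$. The critical time $t_c$ is the time at which the smooth solution of $v_t+6vv_x=0$, $v(\cdot,0)=u_0$, first develops an infinite gradient, namely $t_c=1/\max_x[-6u_0'(x)]$; for $t<t_c$ this equation has a smooth solution. *)

theory Defs
  imports "HOL-Analysis.Analysis"
begin

definition periodic2pi :: "(real \<Rightarrow> real) \<Rightarrow> bool" where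
  "periodic2pi f \<longleftrightarrow> (\<forall>x. f (x + 2 * pi) = f x)"

definition fourier :: "(real \<Rightarrow> real) \<Rightarrow> int \<Rightarrow> complex" where
  "fourier f k = complex_of_real (1 / (2 * pi)) *
     (LINT x:{-pi..pi}|lborel. complex_of_real (f x) * cis (- (of_int k * x)))"

definition in_H :: "real \<Rightarrow> (real \<Rightarrow> real) \<Rightarrow> bool" where
  "in_H r f \<longleftrightarrow> periodic2pi f \<and> f \<in> borel_measurable lborel \<and>
     set_integrable lborel {-pi..pi} (\<lambda>x. (f x)\<^sup>2) \<and>
     (\<lambda>k::int. (1 + (of_int k)\<^sup>2) powr r * (cmod (fourier f k))\<^sup>2) summable_on UNIV"

definition H_norm :: "real \<Rightarrow> (real \<Rightarrow> real) \<Rightarrow> real" where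
  "H_norm r f = sqrt (\<Sum>\<^sub>\<infinity>k::int. (1 + (of_int k)\<^sup>2) powr r * (cmod (fourier f k))\<^sup>2)"

definition weak_deriv :: "(real \<Rightarrow> real) \<Rightarrow> (real \<Rightarrow> real) \<Rightarrow> bool" where
  "weak_deriv f g \<longleftrightarrow> in_H 0 g \<and> (\<forall>k. fourier g k = \<i> * of_int k * fourier f k)"

definition frac_D :: "real \<Rightarrow> (real \<Rightarrow> real) \<Rightarrow> (real \<Rightarrow> real) \<Rightarrow> bool" where
  "frac_D \<alpha> f g \<longleftrightarrow> in_H 0 g \<and>
     (\<forall>k. fourier g k = complex_of_real (\<bar>real_of_int k\<bar> powr \<alpha>) * fourier f k)"

definition smooth :: "(real \<Rightarrow> real) \<Rightarrow> bool" where
  "smooth f \<longleftrightarrow> (\<forall>n x. ((deriv ^^ n) f) differentiable (at x))"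

definition critical_time :: "(real \<Rightarrow> real) \<Rightarrow> ereal" where
  "critical_time u0 = (let M = Sup (range (\<lambda>x. - 6 * deriv u0 x))
                       in if M > 0 then ereal (1 / M) else \<infinity>)"

definition fkdv_sol :: "real \<Rightarrow> real \<Rightarrow> real \<Rightarrow> (real \<Rightarrow> real)
    \<Rightarrow> (real \<Rightarrow> real \<Rightarrow> real) \<Rightarrow> (real \<Rightarrow> real \<Rightarrow> real) \<Rightarrow> bool" where
  "fkdv_sol \<alpha> \<epsilon> T u0 u du \<longleftrightarrow>
     (\<forall>t\<in>{0..T}. in_H (1 + \<alpha>) (u t)) \<and>
     (\<forall>t\<in>{0..T}. ((\<lambda>s. H_norm (1 + \<alpha>) (\<lambda>x. u s x - u t x)) \<longlongrightarrow> 0) (at t within {0..T})) \<and>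
     (\<forall>t\<in>{0..T}. in_H 0 (du t)) \<and>
     (\<forall>t\<in>{0..T}. ((\<lambda>s. H_norm 0 (\<lambda>x. du s x - du t x)) \<longlongrightarrow> 0) (at t within {0..T})) \<and>
     (\<forall>t\<in>{0..T}. ((\<lambda>s. H_norm 0 (\<lambda>x. (u s x - u t x) / (s - t) - du t x)) \<longlongrightarrow> 0)
                     (at t within {0..T})) \<and>
     (\<forall>t\<in>{0..T}. \<exists>ux Dux. weak_deriv (u t) ux \<and> frac_D \<alpha> ux Dux \<and>
        (AE x in lborel. x \<in> {-pi..pi} \<longrightarrow> du t x + 6 * u t x * ux x - \<epsilon>\<^sup>2 * Dux x = 0)) \<and>
     (AE x in lborel. x \<in> {-pi..pi} \<longrightarrow> u 0 x = u0 x)"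

definition burgers_sol :: "real \<Rightarrow> (real \<Rightarrow> real) \<Rightarrow> (real \<Rightarrow> real \<Rightarrow> real) \<Rightarrow> bool" where
  "burgers_sol T u0 v \<longleftrightarrow> (\<exists>vt vx.
     (\<forall>t. periodic2pi (v t)) \<and>
     (\<forall>t\<in>{0..T}. \<forall>x. ((\<lambda>s. v s x) has_real_derivative vt t x) (at t within {0..T}) \<and>
                       (v t has_real_derivative vx t x) (at x) \<and>
                       vt t x + 6 * v t x * vx t x = 0) \<and>
     continuous_on ({0..T} \<times> UNIV) (\<lambda>(t, x). vt t x) \<and>
     continuous_on ({0..T} \<times> UNIV) (\<lambda>(t, x). vx t x) \<and>
     (\<forall>x. v 0 x = u0 x))"

end

theory Submission
  imports Defs
begin

text \<open>
  Everything happens on the level of Fourier coefficients, where the fractional KdV equation becomes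
  \<open>c k' = - 3 i k (c * c) k + i \<epsilon>\<^sup>2 k |k|\<^sup>\<alpha> c k\<close>; the dispersive term is skew and drops out of every
  weighted \<open>l\<^sup>2\<close> energy, so all estimates are uniform in \<open>\<epsilon> \<ge> 0\<close>. For an even weight \<open>\<omega>\<close> the derivative
  of \<open>\<Sum>k. \<omega> k |c k|\<^sup>2\<close> is a sum over \<open>a + b + m = 0\<close> which, after symmetrisation, contains the
  factor \<open>a \<omega> a + b \<omega> b + m \<omega> m\<close>. If \<open>\<omega>\<close> is monotone with polynomially bounded ratios, this factor
  is controlled by the smallest frequency times \<open>\<omega>\<close> at the other two, and one obtains a closed
  Gronwall inequality in terms of the Wiener norm \<open>\<Sum>k. (1 + |k|) |c k|\<close>. Bounded weights
  \<open>min (1 + |k|, N)\<^sup>p\<close> make the computation legitimate for solutions that are only in \<open>H\<^sup>1\<^sup>+\<^sup>\<alpha>\<close>.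

  Applied to a single solution with smooth initial value the estimate gives rapid decay of its
  coefficients on all of \<open>[0, Tc]\<close>. Applied to the difference of an arbitrary solution and such a
  rapidly decaying one, together with a continuity argument for the Wiener norm, it gives the
  convergence, both for \<open>\<epsilon> \<rightarrow> \<epsilon>0 > 0\<close> and for \<open>\<epsilon> \<rightarrow> 0\<close>. In the latter case the limit is the Burgers
  solution, whose Wiener norm is bounded up to \<open>Tc\<close> because three derivatives can be computed
  explicitly along characteristics.
\<close>

section \<open>Weights on the frequencies\<close>

text \<open>The equations hold coefficient by coefficient, so the infinite energy sum cannot be
  differentiated directly. Finite partial sums are differentiated instead, while the trilinear
  cancellations need the full sum; the discrepancy is bounded by a Wiener tail that compactness of
  the time interval makes small uniformly in time. The resulting bound does not contain the height
  of the truncated weight, so it passes to the full weight. The difference estimate treats its two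
  functions asymmetrically. The linear term puts 2P + 1 powers of J on the reference solution, and
  the mismatch of the dispersion coefficients puts the whole dispersive symbol on it; hence the
  reference must decay rapidly, while the other solution need only lie in the Wiener class. For
  Burgers, characteristics have to supply decay of third order only: J times J^-3 is summable, so
  the solution enters the Wiener class, and the energy estimate itself then raises the decay to
  every order.\<close>

definition J :: "int \<Rightarrow> real" where "J k = 1 + \<bar>real_of_int k\<bar>"

lemma J_ge_1: "1 \<le> J k" by (simp add: J_def)
lemma J_pos: "0 < J k" by (simp add: J_def)
lemma J_minus: "J (- k) = J k" by (simp add: J_def)
lemma abs_le_J: "\<bar>real_of_int k\<bar> \<le> J k" by (simp add: J_def)

lemma J_add_le_mult: "J (a + b) \<le> J a * J b"
proof -
  have "J (a + b) \<le> 1 + \<bar>real_of_int a\<bar> + \<bar>real_of_int b\<bar>" unfolding J_def by simp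
  also have "\<dots> \<le> J a * J b" unfolding J_def by (simp add: algebra_simps)
  finally show ?thesis .
qed

abbreviation wiener :: "(int \<Rightarrow> complex) \<Rightarrow> bool" where
  "wiener x \<equiv> (\<lambda>k. J k * cmod (x k)) summable_on UNIV"

abbreviation wnorm :: "(int \<Rightarrow> complex) \<Rightarrow> real" where
  "wnorm x \<equiv> \<Sum>\<^sub>\<infinity>k. J k * cmod (x k)"

abbreviation wdist :: "(int \<Rightarrow> complex) \<Rightarrow> (int \<Rightarrow> complex) \<Rightarrow> real" where
  "wdist x y \<equiv> \<Sum>\<^sub>\<infinity>k. J k * cmod (x k - y k)"

text \<open>The case \<open>L = 1\<close> is monotonicity in |k|, which forces evenness; larger
  \<open>L\<close> say that \<omega> grows at most like the power \<open>P\<close>. The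
  multiplicative form lets truncated powers qualify with a \<open>P\<close> that does not depend on
  the truncation.\<close>

definition weight :: "nat \<Rightarrow> (int \<Rightarrow> real) \<Rightarrow> bool" where
  "weight P \<omega> \<longleftrightarrow> (\<forall>k. 0 < \<omega> k) \<and>
     (\<forall>L m n. 1 \<le> L \<longrightarrow> J m \<le> L * J n \<longrightarrow> \<omega> m \<le> L ^ P * \<omega> n)"

lemma weight_pos: "weight P \<omega> \<Longrightarrow> 0 < \<omega> k"
  by (simp add: weight_def)

lemma weight_le: "\<lbrakk>weight P \<omega>; 1 \<le> L; J m \<le> L * J n\<rbrakk> \<Longrightarrow> \<omega> m \<le> L ^ P * \<omega> n"
  by (simp add: weight_def)

lemma weight_mono: "\<lbrakk>weight P \<omega>; J m \<le> J n\<rbrakk> \<Longrightarrow> \<omega> m \<le> \<omega> n"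
  using weight_le[of P \<omega> 1 m n] by simp

lemma weight_minus: "weight P \<omega> \<Longrightarrow> \<omega> (- k) = \<omega> k"
  using weight_mono[of P \<omega> k "- k"] weight_mono[of P \<omega> "- k" k] by (simp add: J_minus)

text \<open>A mean value bound for the n-th power on the interval from 1 to \<mu>, with the crude
  slope \<open>n * \<mu> ^ n\<close>.\<close>

lemma power_minus_1_le:
  fixes \<mu> :: real assumes "1 \<le> \<mu>" shows "\<mu> ^ n - 1 \<le> real n * \<mu> ^ n * (\<mu> - 1)"
proof (induction n)
  case (Suc n)
  have "\<mu> ^ Suc n - 1 = \<mu> * (\<mu> ^ n - 1) + (\<mu> - 1)" by (simp add: algebra_simps)
  also have "\<dots> \<le> \<mu> * (real n * \<mu> ^ n * (\<mu> - 1)) + \<mu> ^ Suc n * (\<mu> - 1)"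
    using Suc assms one_le_power[OF assms, of "Suc n"] mult_right_mono[of 1 "\<mu> ^ Suc n" "\<mu> - 1"]
    by (intro add_mono mult_left_mono) auto
  also have "\<dots> = real (Suc n) * \<mu> ^ Suc n * (\<mu> - 1)" by (simp add: algebra_simps)
  finally show ?case .
qed simp

text \<open>Discrete form of the fact that the derivative of k \<omega>(k) is of the size of
  \<omega>: split off (m - n) \<omega>(m) and bound n (\<omega>(m) - \<omega>(n)) through the ratio
  \<mu> = J m / J n, using J n (\<mu> - 1) = J m - J n \<le> |m - n|. The geometric mean on the
  right is what a product of two energy densities can absorb.\<close>

lemma weight_diff_aux:
  assumes w: "weight P \<omega>" and l: "1 \<le> L" and mn: "J m \<le> L * J n" and nm: "J n \<le> J m"
  shows "\<bar>of_int m * \<omega> m - of_int n * \<omega> n\<bar>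
      \<le> (1 + real P) * L ^ (2 * P) * \<bar>of_int (m - n)\<bar> * (sqrt (\<omega> m) * sqrt (\<omega> n))"
proof -
  define \<mu> where "\<mu> = J m / J n"
  define x where "x = \<bar>real_of_int (m - n)\<bar>"
  have x0: "0 \<le> x" by (simp add: x_def)
  have \<mu>1: "1 \<le> \<mu>" using nm J_pos[of n] by (simp add: \<mu>_def)
  have \<mu>l: "\<mu> \<le> L" using mn J_pos[of n] by (simp add: \<mu>_def pos_divide_le_eq)
  have lam: "1 \<le> L ^ P" using l by simp
  have pos: "0 < \<omega> m" "0 < \<omega> n" using w by (auto simp: weight_pos)
  have mono: "\<omega> n \<le> \<omega> m" using weight_mono[OF w nm] .
  have "\<omega> m \<le> \<mu> ^ P * \<omega> n"
    using weight_le[OF w \<mu>1, of m n] J_pos[of n] by (simp add: \<mu>_def)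
  hence "\<omega> m - \<omega> n \<le> (\<mu> ^ P - 1) * \<omega> n" by (simp add: algebra_simps)
  also have "\<dots> \<le> (real P * \<mu> ^ P * (\<mu> - 1)) * \<omega> n"
    using power_minus_1_le[OF \<mu>1] pos by (intro mult_right_mono) auto
  also have "\<dots> \<le> (real P * L ^ P * (\<mu> - 1)) * \<omega> n"
    using \<mu>1 \<mu>l pos by (intro mult_right_mono mult_left_mono power_mono) auto
  finally have "J n * (\<omega> m - \<omega> n) \<le> J n * ((real P * L ^ P * (\<mu> - 1)) * \<omega> n)"
    using J_pos[of n] by (intro mult_left_mono) auto
  also have "\<dots> = real P * L ^ P * (J m - J n) * \<omega> n"
    using J_pos[of n] by (simp add: \<mu>_def field_simps)
  also have "\<dots> \<le> real P * L ^ P * x * \<omega> m"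
    using pos mono nm lam by (intro mult_mono mult_left_mono) (auto simp: J_def x_def)
  finally have 1: "J n * (\<omega> m - \<omega> n) \<le> real P * L ^ P * x * \<omega> m" .
  have "of_int m * \<omega> m - of_int n * \<omega> n = of_int (m - n) * \<omega> m + of_int n * (\<omega> m - \<omega> n)"
    by (simp add: algebra_simps)
  hence "\<bar>of_int m * \<omega> m - of_int n * \<omega> n\<bar> \<le> \<bar>of_int (m - n) * \<omega> m\<bar> + \<bar>of_int n * (\<omega> m - \<omega> n)\<bar>"
    by linarith
  also have "\<dots> = x * \<omega> m + \<bar>of_int n\<bar> * (\<omega> m - \<omega> n)"
    using pos mono by (simp add: abs_mult x_def)
  also have "\<dots> \<le> L ^ P * x * \<omega> m + J n * (\<omega> m - \<omega> n)"
    using mono pos x0 lam mult_right_mono[OF lam, of "x * \<omega> m"] mult_right_mono[OF abs_le_J[of n], of "\<omega> m - \<omega> n"]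
    by (simp add: mult.assoc)
  also have "\<dots> \<le> (1 + real P) * (L ^ P * x) * \<omega> m"
    using 1 by (simp add: algebra_simps)
  finally have 2: "\<bar>of_int m * \<omega> m - of_int n * \<omega> n\<bar> \<le> (1 + real P) * (L ^ P * x) * \<omega> m" .
  \<comment> \<open>Replacing \<omega>(m) by the geometric mean costs a second factor
    \<open>L ^ P\<close>, whence the exponent \<open>2 * P\<close>.\<close>
  have "sqrt (\<omega> m) \<le> sqrt (L ^ P * \<omega> n)" using weight_le[OF w l mn] by simp
  also have "\<dots> = sqrt (L ^ P) * sqrt (\<omega> n)" by (simp add: real_sqrt_mult)
  also have "\<dots> \<le> L ^ P * sqrt (\<omega> n)"
    using lam pos by (intro mult_right_mono) (auto intro!: real_le_lsqrt simp: power2_eq_square)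
  finally have "sqrt (\<omega> m) * sqrt (\<omega> m) \<le> sqrt (\<omega> m) * (L ^ P * sqrt (\<omega> n))"
    using pos by (intro mult_left_mono) auto
  hence 3: "\<omega> m \<le> L ^ P * (sqrt (\<omega> m) * sqrt (\<omega> n))"
    using pos by (simp add: algebra_simps)
  have "(1 + real P) * (L ^ P * x) * \<omega> m
      \<le> (1 + real P) * (L ^ P * x) * (L ^ P * (sqrt (\<omega> m) * sqrt (\<omega> n)))"
    using 3 x0 lam by (intro mult_left_mono) auto
  also have "\<dots> = (1 + real P) * L ^ (2 * P) * x * (sqrt (\<omega> m) * sqrt (\<omega> n))"
    by (simp add: power_add mult_2)
  finally show ?thesis using order_trans[OF 2] unfolding x_def by blast
qed

lemma weight_diff:
  assumes w: "weight P \<omega>" and l: "1 \<le> L" and mn: "J m \<le> L * J n" and nm: "J n \<le> L * J m"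
  shows "\<bar>of_int m * \<omega> m - of_int n * \<omega> n\<bar>
      \<le> (1 + real P) * L ^ (2 * P) * \<bar>of_int (m - n)\<bar> * (sqrt (\<omega> m) * sqrt (\<omega> n))"
proof (cases "J n \<le> J m")
  case True thus ?thesis using weight_diff_aux[OF w l mn] by simp
next
  case False
  hence "\<bar>of_int n * \<omega> n - of_int m * \<omega> m\<bar>
      \<le> (1 + real P) * L ^ (2 * P) * \<bar>of_int (n - m)\<bar> * (sqrt (\<omega> n) * sqrt (\<omega> m))"
    using weight_diff_aux[OF w l nm] by simp
  thus ?thesis by (simp add: abs_minus_commute mult.commute[of "sqrt (\<omega> n)"])
qed

text \<open>Since \<open>m\<close> and \<open>- b\<close> differ by \<open>a\<close>, evenness turns
  the sum into a difference to which \<open>weight_diff\<close> applies with \<open>L = J a\<close>.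
  All losses land on the frequency \<open>a\<close>, which will belong to the rapidly decaying
  factor.\<close>

lemma weight_pair:
  assumes w: "weight P \<omega>" and z: "a + b + m = 0"
  shows "\<bar>of_int m * \<omega> m + of_int b * \<omega> b\<bar>
      \<le> (1 + real P) * J a ^ (2 * P + 1) * (sqrt (\<omega> m) * sqrt (\<omega> b))"
proof -
  have m: "m = - (a + b)" and b: "b = - (a + m)" using z by auto
  have "J m \<le> J a * J (- b)" using J_add_le_mult[of a b] m by (simp add: J_minus del: minus_add_distrib)
  moreover have "J (- b) \<le> J a * J m" using J_add_le_mult[of a m] b by (simp add: J_minus del: minus_add_distrib)
  ultimately have "\<bar>of_int m * \<omega> m - of_int (- b) * \<omega> (- b)\<bar>
      \<le> (1 + real P) * J a ^ (2 * P) * \<bar>of_int (m - (- b))\<bar> * (sqrt (\<omega> m) * sqrt (\<omega> (- b)))"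
    using weight_diff[OF w J_ge_1[of a], of m "- b"] by simp
  also have "\<dots> \<le> (1 + real P) * J a ^ (2 * P) * J a * (sqrt (\<omega> m) * sqrt (\<omega> (- b)))"
    using J_pos[of a] weight_pos[OF w] z
    by (intro mult_right_mono mult_left_mono) (auto simp: J_def less_imp_le)
  finally show ?thesis by (simp add: weight_minus[OF w] mult_ac)
qed

text \<open>When \<open>b\<close> is the smallest frequency, \<open>m\<close> and \<open>- a\<close>
  are comparable within a factor 2, so \<open>L = 2\<close> yields the constant 4^P and only the
  first power of J b is lost, which is exactly what the Wiener norm pays for.\<close>

lemma weight_triple_aux:
  assumes w: "weight P \<omega>" and z: "a + b + m = 0" and ba: "J b \<le> J a" and bm: "J b \<le> J m"
  shows "\<bar>of_int a * \<omega> a + of_int b * \<omega> b + of_int m * \<omega> m\<bar>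
      \<le> ((1 + real P) * 4 ^ P + 1) * (J b * (sqrt (\<omega> a) * sqrt (\<omega> m)))"
proof -
  have m: "m = - (a + b)" using z by auto
  have 1: "J m \<le> 2 * J (- a)" "J (- a) \<le> 2 * J m" 
  proof -
    have "\<bar>real_of_int m\<bar> \<le> \<bar>real_of_int a\<bar> + \<bar>real_of_int b\<bar>"
      "\<bar>real_of_int a\<bar> \<le> \<bar>real_of_int m\<bar> + \<bar>real_of_int b\<bar>"
      unfolding m by simp_all
    thus "J m \<le> 2 * J (- a)" "J (- a) \<le> 2 * J m" using ba bm unfolding J_def by simp_all
  qed
  have pos: "0 < \<omega> a" "0 < \<omega> b" "0 < \<omega> m" using w by (auto simp: weight_pos)
  have "\<bar>of_int m * \<omega> m - of_int (- a) * \<omega> (- a)\<bar>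
      \<le> (1 + real P) * 2 ^ (2 * P) * \<bar>of_int (m - (- a))\<bar> * (sqrt (\<omega> m) * sqrt (\<omega> (- a)))"
    using weight_diff[OF w _ 1] by simp
  also have "\<dots> \<le> (1 + real P) * 2 ^ (2 * P) * J b * (sqrt (\<omega> m) * sqrt (\<omega> (- a)))"
    using weight_pos[OF w] z
    by (intro mult_right_mono mult_left_mono) (auto simp: J_def less_imp_le)
  finally have 2: "\<bar>of_int m * \<omega> m + of_int a * \<omega> a\<bar>
      \<le> (1 + real P) * 4 ^ P * (J b * (sqrt (\<omega> a) * sqrt (\<omega> m)))"
    using power_mult[of "2::real" 2 P] by (simp add: weight_minus[OF w] mult_ac)
  have "sqrt (\<omega> b) * sqrt (\<omega> b) \<le> sqrt (\<omega> a) * sqrt (\<omega> m)"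
    using weight_mono[OF w ba] weight_mono[OF w bm] pos by (intro mult_mono) auto
  hence "\<omega> b \<le> sqrt (\<omega> a) * sqrt (\<omega> m)" using pos by simp
  hence "\<bar>of_int b\<bar> * \<omega> b \<le> J b * (sqrt (\<omega> a) * sqrt (\<omega> m))"
    using pos J_pos[of b] by (intro mult_mono) (auto simp: abs_le_J)
  hence 3: "\<bar>of_int b * \<omega> b\<bar> \<le> J b * (sqrt (\<omega> a) * sqrt (\<omega> m))" using pos by (simp add: abs_mult)
  have "\<bar>of_int a * \<omega> a + of_int b * \<omega> b + of_int m * \<omega> m\<bar>
      \<le> \<bar>of_int m * \<omega> m + of_int a * \<omega> a\<bar> + \<bar>of_int b * \<omega> b\<bar>"
    by linarith
  also note add_mono[OF 2 3]
  finally show ?thesis by (simp only: distrib_right mult_1_left)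
qed

text \<open>The frequency of smallest size selects one of the three terms; adding all three makes
  the bound symmetric, so that no case distinction enters the sums.\<close>

lemma weight_triple:
  assumes w: "weight P \<omega>" and z: "a + b + m = 0"
  shows "\<bar>of_int a * \<omega> a + of_int b * \<omega> b + of_int m * \<omega> m\<bar>
      \<le> ((1 + real P) * 4 ^ P + 1) * (J a * (sqrt (\<omega> b) * sqrt (\<omega> m))
          + J b * (sqrt (\<omega> a) * sqrt (\<omega> m)) + J m * (sqrt (\<omega> a) * sqrt (\<omega> b)))"
    (is "?L \<le> ?C * (?x + ?y + ?z)")
proof -
  have C: "0 \<le> ?C" by simp
  have nn: "0 \<le> ?x" "0 \<le> ?y" "0 \<le> ?z"
    using J_pos weight_pos[OF w] by (simp_all add: less_imp_le)
  have "?L \<le> ?C * ?x \<or> ?L \<le> ?C * ?y \<or> ?L \<le> ?C * ?z"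
  proof -
    consider "J b \<le> J a" "J b \<le> J m" | "J a \<le> J b" "J a \<le> J m" | "J m \<le> J a" "J m \<le> J b"
      by linarith
    then show ?thesis
    proof cases
      case 1 thus ?thesis using weight_triple_aux[OF w z] by blast
    next
      case 2 thus ?thesis using weight_triple_aux[OF w, of b a m] z by (simp add: add_ac)
    next
      case 3 thus ?thesis using weight_triple_aux[OF w, of a m b] z by (simp add: add_ac)
    qed
  qed
  moreover have "?C * ?x \<le> ?C * (?x + ?y + ?z)" "?C * ?y \<le> ?C * (?x + ?y + ?z)" "?C * ?z \<le> ?C * (?x + ?y + ?z)"
    using nn by (intro mult_left_mono C; linarith)+
  ultimately show ?thesis by (meson order_trans)
qed

section \<open>Convolution and double sums\<close>

definition conv :: "(int \<Rightarrow> complex) \<Rightarrow> (int \<Rightarrow> complex) \<Rightarrow> int \<Rightarrow> complex" where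
  "conv x y k = (\<Sum>\<^sub>\<infinity>a. x a * y (k - a))"

lemma summable_on_prod:
  fixes x y :: "int \<Rightarrow> real"
  assumes x: "x summable_on UNIV" "\<And>a. 0 \<le> x a" and y: "y summable_on UNIV" "\<And>a. 0 \<le> y a"
  shows "(\<lambda>(a, b). x a * y b) summable_on UNIV"
    and "(\<Sum>\<^sub>\<infinity>(a, b). x a * y b) = infsum x UNIV * infsum y UNIV"
proof -
  have "(\<lambda>(a, b). x a * y b) summable_on (Sigma UNIV (\<lambda>_. UNIV))"
  proof (rule summable_on_SigmaI)
    show "((\<lambda>b. case (a, b) of (a, b) \<Rightarrow> x a * y b) has_sum x a * infsum y UNIV) UNIV" for a
      using has_sum_cmult_right[OF has_sum_infsum[OF y(1)], of "x a"] by simp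
    show "(\<lambda>a. x a * infsum y UNIV) summable_on UNIV" by (rule summable_on_cmult_left[OF x(1)])
  qed (simp add: x y)
  thus 1: "(\<lambda>(a, b). x a * y b) summable_on UNIV" by simp
  have "(\<Sum>\<^sub>\<infinity>(a, b)\<in>UNIV\<times>UNIV. x a * y b) = (\<Sum>\<^sub>\<infinity>a. \<Sum>\<^sub>\<infinity>b. x a * y b)"
    using infsum_Sigma'_banach[of "\<lambda>a b. x a * y b" UNIV "\<lambda>_. UNIV"] 1 by simp
  also have "\<dots> = infsum x UNIV * infsum y UNIV" by (simp add: infsum_cmult_right' infsum_cmult_left')
  finally show "(\<Sum>\<^sub>\<infinity>(a, b). x a * y b) = infsum x UNIV * infsum y UNIV" by simp
qed

section \<open>Trilinear estimates\<close>

text \<open>The product of the two \<open>y\<close> factors is at most the mean of their squares,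
  and the involution (a, b) to (a, - a - b) shows that both squares give the same double sum, which
  factorises.\<close>

lemma summable_conv_square:
  fixes X y :: "int \<Rightarrow> real"
  assumes X: "X summable_on UNIV" "\<And>a. 0 \<le> X a"
    and y: "(\<lambda>b. (y b)\<^sup>2) summable_on UNIV" "\<And>b. 0 \<le> y b"
  shows "(\<lambda>(a, b). X a * (y b * y (- a - b))) summable_on UNIV"
    and "(\<Sum>\<^sub>\<infinity>(a, b). X a * (y b * y (- a - b))) \<le> infsum X UNIV * (\<Sum>\<^sub>\<infinity>b. (y b)\<^sup>2)"
proof -
  let ?f = "\<lambda>(a, b). X a * (y b)\<^sup>2" and ?g = "\<lambda>(a, b). X a * (y (- a - b))\<^sup>2"
  have f: "?f summable_on UNIV" and fs: "infsum ?f UNIV = infsum X UNIV * (\<Sum>\<^sub>\<infinity>b. (y b)\<^sup>2)"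
    using summable_on_prod[of X "\<lambda>b. (y b)\<^sup>2"] X y by auto
  have g: "?g summable_on UNIV \<longleftrightarrow> ?f summable_on UNIV"
    by (rule summable_on_reindex_bij_witness[where i = "\<lambda>(a, b). (a, - a - b)" and j = "\<lambda>(a, b). (a, - a - b)"]) auto
  have gs: "infsum ?g UNIV = infsum ?f UNIV"
    by (rule infsum_reindex_bij_witness[where i = "\<lambda>(a, b). (a, - a - b)" and j = "\<lambda>(a, b). (a, - a - b)"]) auto
  let ?h = "\<lambda>p. (1/2) * (?f p + ?g p)"
  have h: "?h summable_on UNIV" using f g by (intro summable_on_cmult_right summable_on_add) auto
  have hs: "infsum ?h UNIV = infsum ?f UNIV"
    using f g gs by (subst infsum_cmult_right') (simp add: infsum_add)
  have le: "(case p of (a, b) \<Rightarrow> X a * (y b * y (- a - b))) \<le> ?h p" for p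
  proof (cases p)
    case (Pair a b)
    have "y b * y (- a - b) \<le> (1/2) * ((y b)\<^sup>2 + (y (- a - b))\<^sup>2)"
      using sum_squares_bound[of "y b" "y (- a - b)"] by simp
    hence "X a * (y b * y (- a - b)) \<le> X a * ((1/2) * ((y b)\<^sup>2 + (y (- a - b))\<^sup>2))"
      by (intro mult_left_mono X)
    thus ?thesis by (simp add: Pair algebra_simps)
  qed
  show 1: "(\<lambda>(a, b). X a * (y b * y (- a - b))) summable_on UNIV"
    by (rule summable_on_comparison_test[OF h le]) (use X y in auto)
  show "(\<Sum>\<^sub>\<infinity>(a, b). X a * (y b * y (- a - b))) \<le> infsum X UNIV * (\<Sum>\<^sub>\<infinity>b. (y b)\<^sup>2)"
    using infsum_mono[OF 1 h le] hs fs by simp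
qed

lemma norm_infsum_le_infsum:
  fixes f :: "'i \<Rightarrow> complex"
  assumes "g summable_on A" "\<And>x. x \<in> A \<Longrightarrow> norm (f x) \<le> g x"
  shows "norm (infsum f A) \<le> infsum g A"
proof -
  have 1: "(\<lambda>x. norm (f x)) summable_on A" by (rule Infinite_Sum.abs_summable_on_comparison_test'[OF assms])
  have "norm (infsum f A) \<le> (\<Sum>\<^sub>\<infinity>x\<in>A. norm (f x))" by (rule norm_infsum_bound[OF 1])
  also have "\<dots> \<le> infsum g A" by (rule infsum_mono[OF 1 assms])
  finally show ?thesis .
qed

text \<open>One time slice of the energy estimate. The bound \<open>W\<close> makes the energy
  finite for coefficients that are merely in the Wiener class; it must not reappear in the trilinear
  bounds below. Condition \<open>herm\<close> says that the coefficients belong to a real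
  function.\<close>

locale trunc_weight =
  fixes P :: nat and \<omega> :: "int \<Rightarrow> real" and W :: real and w :: "int \<Rightarrow> complex"
  assumes weight: "weight P \<omega>" and bounded: "\<And>k. \<omega> k \<le> W"
    and herm: "\<And>k. w (- k) = cnj (w k)"
    and summ: "wiener w"
begin

definition B :: real where "B = wnorm w"
definition E :: real where "E = (\<Sum>\<^sub>\<infinity>k. \<omega> k * (cmod (w k))\<^sup>2)"

lemma B_ge: "J k * cmod (w k) \<le> B"
  unfolding B_def using finite_sum_le_infsum[OF summ, of "{k}"] J_pos by (simp add: less_imp_le)

lemma cmod_le_B: "cmod (w k) \<le> B"
proof -
  have "1 * cmod (w k) \<le> J k * cmod (w k)" by (intro mult_right_mono J_ge_1) simp
  thus ?thesis using B_ge[of k] by simp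
qed

lemma B_nonneg: "0 \<le> B" using cmod_le_B[of 0] norm_ge_zero order_trans by blast

lemma W_nonneg: "0 \<le> W" using bounded[of 0] weight_pos[OF weight, of 0] by simp

lemma E_summable: "(\<lambda>k. \<omega> k * (cmod (w k))\<^sup>2) summable_on UNIV"
proof (rule summable_on_comparison_test)
  show "(\<lambda>k. W * B * (J k * cmod (w k))) summable_on UNIV" by (intro summable_on_cmult_right summ)
  fix k
  have "\<omega> k * (cmod (w k))\<^sup>2 \<le> W * (B * (J k * cmod (w k)))"
  proof (intro mult_mono bounded)
    have "(cmod (w k))\<^sup>2 = cmod (w k) * (1 * cmod (w k))" by (simp add: power2_eq_square)
    also have "\<dots> \<le> B * (J k * cmod (w k))"
      by (intro mult_mono cmod_le_B J_ge_1) (use B_nonneg J_pos[of k] in auto)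
    finally show "(cmod (w k))\<^sup>2 \<le> B * (J k * cmod (w k))" .
  qed (use W_nonneg in auto)
  thus "\<omega> k * (cmod (w k))\<^sup>2 \<le> W * B * (J k * cmod (w k))" by simp
  show "0 \<le> \<omega> k * (cmod (w k))\<^sup>2" using weight_pos[OF weight] by (simp add: less_imp_le)
qed

lemma E_nonneg: "0 \<le> E"
  unfolding E_def using weight_pos[OF weight] by (intro infsum_nonneg) (simp add: less_imp_le)

definition tri :: "(int \<Rightarrow> complex) \<Rightarrow> int \<times> int \<Rightarrow> complex" where
  "tri x = (\<lambda>(a, b). x a * w b * w (- a - b))"

text \<open>Hermitian symmetry rewrites the energy production as a sum over triples of frequencies
  with sum zero, where the roles of the frequencies can be permuted. Boundedness of \<omega> and the
  Wiener norm make the double sum \<open>h\<close> absolutely summable, which justifies both the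
  iteration and the reindexing.\<close>

lemma
  assumes x: "(\<lambda>k. cmod (x k)) summable_on UNIV"
  defines "G \<equiv> \<lambda>(a, b). complex_of_real (of_int (- a - b) * \<omega> (- a - b)) * tri x (a, b)"
  shows tri_summable: "G summable_on UNIV"
    and tri_infsum: "(\<Sum>\<^sub>\<infinity>k. complex_of_real (of_int k * \<omega> k) * cnj (w k) * conv x w k) = - infsum G UNIV"
    and conv_summable: "(\<lambda>k. complex_of_real (of_int k * \<omega> k) * cnj (w k) * conv x w k) summable_on UNIV"
proof -
  define h where "h = (\<lambda>(k, a). complex_of_real (of_int k * \<omega> k) * cnj (w k) * (x a * w (k - a)))"
  have dom: "(\<lambda>(k, a). (W * (J k * cmod (w k))) * (cmod (x a) * B)) summable_on UNIV"
    by (rule summable_on_prod)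
       (use J_pos W_nonneg B_nonneg in \<open>auto simp: less_imp_le intro!: summable_on_cmult_right summable_on_cmult_left summ x\<close>)
  have "(\<lambda>p. norm (h p)) summable_on UNIV"
  proof (rule Infinite_Sum.abs_summable_on_comparison_test'[OF dom])
    fix p :: "int \<times> int" obtain k a where p: "p = (k, a)" by (cases p)
    have "norm (h p) = \<bar>of_int k\<bar> * \<omega> k * cmod (w k) * (cmod (x a) * cmod (w (k - a)))"
      using weight_pos[OF weight, of k] by (simp add: h_def p norm_mult abs_mult)
    also have "\<dots> \<le> J k * W * cmod (w k) * (cmod (x a) * B)"
      using weight_pos[OF weight, of k] J_pos[of k] W_nonneg
      by (intro mult_mono abs_le_J bounded cmod_le_B order_refl mult_nonneg_nonneg) auto
    finally show "norm (h p) \<le> (case p of (k, a) \<Rightarrow> (W * (J k * cmod (w k))) * (cmod (x a) * B))"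
      by (simp add: p mult_ac)
  qed
  hence h: "h summable_on UNIV" by (rule abs_summable_summable)
  \<comment> \<open>With k = a + b the factor \<open>cnj (w k)\<close> is \<open>w m\<close> for m =
    - a - b, and the multiplier k becomes - m; this produces the sign.\<close>
  have reG: "- G p = h (case p of (a, b) \<Rightarrow> (a + b, a))" for p
  proof (cases p)
    case (Pair a b)
    have "w (- a - b) = cnj (w (a + b))" using herm[of "a + b"] by simp
    moreover have "\<omega> (- a - b) = \<omega> (a + b)" using weight_minus[OF weight, of "a + b"] by simp
    ultimately show ?thesis by (simp add: Pair G_def h_def tri_def algebra_simps)
  qed
  have bij: "bij_betw (\<lambda>p. case p of (a, b) \<Rightarrow> (a + b, a)) (UNIV :: (int \<times> int) set) UNIV"
    by (rule bij_betwI[where g = "\<lambda>(k, a). (a, k - a)"]) auto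
  have "(\<lambda>p. - G p) summable_on UNIV"
    using summable_on_reindex_bij_betw[OF bij, of h] h by (simp add: reG)
  thus "G summable_on UNIV" using summable_on_uminus[of "\<lambda>p. - G p" UNIV] by simp
  have inner: "(\<Sum>\<^sub>\<infinity>a. h (k, a)) = complex_of_real (of_int k * \<omega> k) * cnj (w k) * conv x w k" for k
    unfolding h_def conv_def by (simp add: infsum_cmult_right')
  have "(\<Sum>\<^sub>\<infinity>k. \<Sum>\<^sub>\<infinity>a. h (k, a)) = infsum h UNIV"
    using infsum_Sigma_banach[of h UNIV "\<lambda>_. UNIV"] h by simp
  also have "\<dots> = (\<Sum>\<^sub>\<infinity>p. - G p)"
    using infsum_reindex_bij_betw[OF bij, of h] by (simp add: reG)
  finally show "(\<Sum>\<^sub>\<infinity>k. complex_of_real (of_int k * \<omega> k) * cnj (w k) * conv x w k) = - infsum G UNIV"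
    unfolding inner by (simp add: infsum_uminus)
  show "(\<lambda>k. complex_of_real (of_int k * \<omega> k) * cnj (w k) * conv x w k) summable_on UNIV"
    using summable_on_Sigma_banach[of "\<lambda>k a. h (k, a)" UNIV "\<lambda>_. UNIV"] h unfolding inner by simp
qed

lemma E_as_square: "(sqrt (\<omega> k) * cmod (w k))\<^sup>2 = \<omega> k * (cmod (w k))\<^sup>2"
  using weight_pos[OF weight, of k] by (simp add: power_mult_distrib)

text \<open>Swapping \<open>b\<close> with m = - a - b leaves \<open>tri d\<close> unchanged, so
  twice the sum carries the multiplier m \<omega>(m) + b \<omega>(b), to which
  \<open>weight_pair\<close> applies.\<close>

lemma linear_term_bound:
  assumes d: "(\<lambda>k. J k ^ (2 * P + 1) * cmod (d k)) summable_on UNIV"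
  shows "cmod (\<Sum>\<^sub>\<infinity>k. complex_of_real (of_int k * \<omega> k) * cnj (w k) * conv d w k)
      \<le> (1 + real P) * (\<Sum>\<^sub>\<infinity>k. J k ^ (2 * P + 1) * cmod (d k)) * E"
proof -
  have d1: "(\<lambda>k. cmod (d k)) summable_on UNIV"
  proof (rule summable_on_comparison_test[OF d])
    fix k show "cmod (d k) \<le> J k ^ (2 * P + 1) * cmod (d k)"
      using mult_right_mono[OF one_le_power[OF J_ge_1[of k]], of "cmod (d k)" "2 * P + 1"] by simp
  qed simp
  define G where "G = (\<lambda>(a, b). complex_of_real (of_int (- a - b) * \<omega> (- a - b)) * tri d (a, b))"
  define G' where "G' = (\<lambda>(a, b). complex_of_real (of_int b * \<omega> b) * tri d (a, b))"
  have G: "G summable_on UNIV" and S: "(\<Sum>\<^sub>\<infinity>k. complex_of_real (of_int k * \<omega> k) * cnj (w k) * conv d w k) = - infsum G UNIV"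
    unfolding G_def by (rule tri_summable[OF d1], rule tri_infsum[OF d1])
  have bij: "bij_betw (\<lambda>p. case p of (a, b) \<Rightarrow> (a, - a - b)) (UNIV :: (int \<times> int) set) UNIV"
    by (rule bij_betwI[where g = "\<lambda>(a, b). (a, - a - b)"]) auto
  have reG: "G' = (\<lambda>p. G (case p of (a, b) \<Rightarrow> (a, - a - b)))"
    by (simp add: fun_eq_iff G_def G'_def tri_def)
  have G': "G' summable_on UNIV" "infsum G' UNIV = infsum G UNIV"
    using summable_on_reindex_bij_betw[OF bij, of G] infsum_reindex_bij_betw[OF bij, of G] G
    by (simp_all add: reG)
  define X where "X = (\<lambda>a. J a ^ (2 * P + 1) * cmod (d a))"
  define y where "y = (\<lambda>b. sqrt (\<omega> b) * cmod (w b))"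
  have X0: "0 \<le> X a" for a using J_pos[of a] by (simp add: X_def)
  have y0: "0 \<le> y a" for a using weight_pos[OF weight, of a] by (simp add: y_def)
  have y2: "(y k)\<^sup>2 = \<omega> k * (cmod (w k))\<^sup>2" for k unfolding y_def by (rule E_as_square)
  have Xs: "X summable_on UNIV" using d by (simp add: X_def)
  have ys: "(\<lambda>b. (y b)\<^sup>2) summable_on UNIV" using E_summable by (simp add: y2)
  have H: "(\<lambda>(a, b). X a * (y b * y (- a - b))) summable_on UNIV"
    "(\<Sum>\<^sub>\<infinity>(a, b). X a * (y b * y (- a - b))) \<le> infsum X UNIV * E"
    using summable_conv_square[OF Xs X0 ys y0] by (simp_all add: y2 E_def)
  let ?H = "\<lambda>p. (1 + real P) * (case p of (a, b) \<Rightarrow> X a * (y b * y (- a - b)))"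
  have "norm (\<Sum>\<^sub>\<infinity>p. G p + G' p) \<le> infsum ?H UNIV"
  proof (rule norm_infsum_le_infsum)
    show "?H summable_on UNIV" by (intro summable_on_cmult_right H)
    fix p :: "int \<times> int" obtain a b where p: "p = (a, b)" by (cases p)
    define m where "m = - a - b"
    have "norm (G p + G' p) = \<bar>of_int m * \<omega> m + of_int b * \<omega> b\<bar> * (cmod (d a) * cmod (w b) * cmod (w m))"
      unfolding G_def G'_def p case_prod_conv m_def[symmetric] tri_def
      unfolding distrib_right[symmetric] of_real_add[symmetric] norm_mult norm_of_real ..
    also have "\<dots> \<le> ((1 + real P) * J a ^ (2 * P + 1) * (sqrt (\<omega> m) * sqrt (\<omega> b))) * (cmod (d a) * cmod (w b) * cmod (w m))"
      by (intro mult_right_mono weight_pair[OF weight]) (auto simp: m_def)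
    also have "\<dots> = ?H p" by (simp add: p X_def y_def m_def mult_ac)
    finally show "norm (G p + G' p) \<le> ?H p" .
  qed
  moreover have "(\<Sum>\<^sub>\<infinity>p. G p + G' p) = 2 * infsum G UNIV" using G G' by (simp add: infsum_add)
  moreover have "infsum ?H UNIV \<le> (1 + real P) * (infsum X UNIV * E)"
    using H by (subst infsum_cmult_right') (auto intro!: mult_left_mono)
  ultimately have "2 * cmod (infsum G UNIV) \<le> (1 + real P) * (infsum X UNIV * E)"
    by (simp add: norm_mult)
  \<comment> \<open>The factor 2 gained by symmetrisation is given away here.\<close>
  moreover have "0 \<le> cmod (infsum G UNIV)" by simp
  ultimately have "cmod (infsum G UNIV) \<le> (1 + real P) * (infsum X UNIV * E)" by linarith
  thus ?thesis unfolding S by (simp add: X_def)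
qed

text \<open>\<open>tri w\<close> is invariant under all permutations of the triple, so three times
  the sum carries the full symmetric multiplier of \<open>weight_triple\<close>. Its three terms
  have equal sums after relabelling, each at most B E, and the factors 3 cancel.\<close>

lemma quadratic_term_bound:
  "cmod (\<Sum>\<^sub>\<infinity>k. complex_of_real (of_int k * \<omega> k) * cnj (w k) * conv w w k)
      \<le> ((1 + real P) * 4 ^ P + 1) * B * E"
proof -
  let ?C = "(1 + real P) * 4 ^ P + 1"
  have w1: "(\<lambda>k. cmod (w k)) summable_on UNIV"
  proof (rule summable_on_comparison_test[OF summ])
    fix k show "cmod (w k) \<le> J k * cmod (w k)"
      using mult_right_mono[OF J_ge_1[of k], of "cmod (w k)"] by simp
  qed simp
  define G where "G = (\<lambda>(a, b). complex_of_real (of_int (- a - b) * \<omega> (- a - b)) * tri w (a, b))"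
  define G1 where "G1 = (\<lambda>(a, b). complex_of_real (of_int b * \<omega> b) * tri w (a, b))"
  define G2 where "G2 = (\<lambda>(a, b). complex_of_real (of_int a * \<omega> a) * tri w (a, b))"
  have G: "G summable_on UNIV" and S: "(\<Sum>\<^sub>\<infinity>k. complex_of_real (of_int k * \<omega> k) * cnj (w k) * conv w w k) = - infsum G UNIV"
    unfolding G_def by (rule tri_summable[OF w1], rule tri_infsum[OF w1])
  have bij1: "bij_betw (\<lambda>p. case p of (a, b) \<Rightarrow> (a, - a - b)) (UNIV :: (int \<times> int) set) UNIV"
    by (rule bij_betwI[where g = "\<lambda>(a, b). (a, - a - b)"]) auto
  have bij2: "bij_betw (\<lambda>p. case p of (a, b) \<Rightarrow> (- a - b, b)) (UNIV :: (int \<times> int) set) UNIV"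
    by (rule bij_betwI[where g = "\<lambda>(a, b). (- a - b, b)"]) auto
  have bij3: "bij_betw (\<lambda>p. case p of (a, b) \<Rightarrow> (b, a)) (UNIV :: (int \<times> int) set) UNIV"
    by (rule bij_betwI[where g = "\<lambda>(a, b). (b, a)"]) auto
  have bij4: "bij_betw (\<lambda>p. case p of (a, b) \<Rightarrow> (- a - b, a)) (UNIV :: (int \<times> int) set) UNIV"
    by (rule bij_betwI[where g = "\<lambda>(m, a). (a, - m - a)"]) auto
  have reG: "G1 = (\<lambda>p. G (case p of (a, b) \<Rightarrow> (a, - a - b)))" "G2 = (\<lambda>p. G (case p of (a, b) \<Rightarrow> (- a - b, b)))"
    by (simp_all add: fun_eq_iff G_def G1_def G2_def tri_def)
  have G1: "G1 summable_on UNIV" "infsum G1 UNIV = infsum G UNIV"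
    using summable_on_reindex_bij_betw[OF bij1, of G] infsum_reindex_bij_betw[OF bij1, of G] G
    by (simp_all add: reG)
  have G2: "G2 summable_on UNIV" "infsum G2 UNIV = infsum G UNIV"
    using summable_on_reindex_bij_betw[OF bij2, of G] infsum_reindex_bij_betw[OF bij2, of G] G
    by (simp_all add: reG)
  define X where "X = (\<lambda>a. J a * cmod (w a))"
  define y where "y = (\<lambda>b. sqrt (\<omega> b) * cmod (w b))"
  have X0: "0 \<le> X a" for a using J_pos[of a] by (simp add: X_def)
  have y0: "0 \<le> y a" for a using weight_pos[OF weight, of a] by (simp add: y_def)
  have y2: "(y k)\<^sup>2 = \<omega> k * (cmod (w k))\<^sup>2" for k unfolding y_def by (rule E_as_square)
  have Xs: "X summable_on UNIV" using summ by (simp add: X_def)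
  have ys: "(\<lambda>b. (y b)\<^sup>2) summable_on UNIV" using E_summable by (simp add: y2)
  define H where "H = (\<lambda>(a, b). X a * (y b * y (- a - b)))"
  define H1 where "H1 = (\<lambda>(a, b). X b * (y a * y (- a - b)))"
  define H2 where "H2 = (\<lambda>(a, b). X (- a - b) * (y a * y b))"
  have H: "H summable_on UNIV" "infsum H UNIV \<le> B * E"
    using summable_conv_square[OF Xs X0 ys y0] by (simp_all add: y2 E_def H_def B_def X_def)
  have reH: "H1 = (\<lambda>p. H (case p of (a, b) \<Rightarrow> (b, a)))" "H2 = (\<lambda>p. H (case p of (a, b) \<Rightarrow> (- a - b, a)))"
    by (simp_all add: fun_eq_iff H_def H1_def H2_def algebra_simps minus_diff_commute)
  have H1: "H1 summable_on UNIV" "infsum H1 UNIV = infsum H UNIV"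
    using summable_on_reindex_bij_betw[OF bij3, of H] infsum_reindex_bij_betw[OF bij3, of H] H
    by (simp_all add: reH)
  have H2: "H2 summable_on UNIV" "infsum H2 UNIV = infsum H UNIV"
    using summable_on_reindex_bij_betw[OF bij4, of H] infsum_reindex_bij_betw[OF bij4, of H] H
    by (simp_all add: reH)
  let ?H = "\<lambda>p. ?C * (H p + H1 p + H2 p)"
  have Hs: "(\<lambda>p. H p + H1 p + H2 p) summable_on UNIV" by (intro summable_on_add H H1 H2)
  have "norm (\<Sum>\<^sub>\<infinity>p. G2 p + G1 p + G p) \<le> infsum ?H UNIV"
  proof (rule norm_infsum_le_infsum)
    show "?H summable_on UNIV" by (intro summable_on_cmult_right Hs)
    fix p :: "int \<times> int" obtain a b where p: "p = (a, b)" by (cases p)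
    define m where "m = - a - b"
    have "norm (G2 p + G1 p + G p) = \<bar>of_int a * \<omega> a + of_int b * \<omega> b + of_int m * \<omega> m\<bar> * (cmod (w a) * cmod (w b) * cmod (w m))"
      unfolding G_def G1_def G2_def p case_prod_conv m_def[symmetric] tri_def
      unfolding distrib_right[symmetric] of_real_add[symmetric] norm_mult norm_of_real ..
    also have "\<dots> \<le> (?C * (J a * (sqrt (\<omega> b) * sqrt (\<omega> m))
          + J b * (sqrt (\<omega> a) * sqrt (\<omega> m)) + J m * (sqrt (\<omega> a) * sqrt (\<omega> b)))) * (cmod (w a) * cmod (w b) * cmod (w m))"
      by (intro mult_right_mono weight_triple[OF weight]) (auto simp: m_def)
    also have "\<dots> = ?H p"
      unfolding p H_def H1_def H2_def X_def y_def case_prod_conv m_def[symmetric] by algebra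
    finally show "norm (G2 p + G1 p + G p) \<le> ?H p" .
  qed
  moreover have "(\<Sum>\<^sub>\<infinity>p. G2 p + G1 p + G p) = 3 * infsum G UNIV"
    using G G1 G2 by (simp add: infsum_add summable_on_add)
  moreover have "infsum ?H UNIV = ?C * (3 * infsum H UNIV)"
    using H H1 H2 by (subst infsum_cmult_right') (simp add: infsum_add summable_on_add)
  ultimately have "3 * cmod (infsum G UNIV) \<le> 3 * (?C * infsum H UNIV)"
    by (simp add: norm_mult algebra_simps)
  also have "\<dots> \<le> 3 * (?C * (B * E))" using H by (intro mult_left_mono) auto
  finally show ?thesis unfolding S by (simp add: mult.assoc)
qed

end

section \<open>The energy estimate\<close>

lemma infsum_Compl_finite:
  fixes f :: "int \<Rightarrow> 'a :: banach"
  assumes "f summable_on UNIV" "finite K"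
  shows "infsum f UNIV = sum f K + infsum f (- K)" "f summable_on (- K)"
proof -
  show 1: "f summable_on (- K)" using summable_on_cofin_subset[OF assms] by (simp add: Compl_eq_Diff_UNIV)
  have "infsum f (K \<union> - K) = infsum f K + infsum f (- K)"
    by (rule infsum_Un_disjoint) (use assms 1 in auto)
  thus "infsum f UNIV = sum f K + infsum f (- K)" using assms by simp
qed

lemma small_tail:
  fixes f :: "int \<Rightarrow> real"
  assumes f: "f summable_on UNIV" and e: "0 < e"
  obtains K where "finite K" "infsum f (- K) < e"
proof -
  have "(sum f \<longlongrightarrow> infsum f UNIV) (finite_subsets_at_top UNIV)"
    using f by (rule infsum_tendsto)
  hence "eventually (\<lambda>K. dist (sum f K) (infsum f UNIV) < e) (finite_subsets_at_top UNIV)"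
    using e by (rule tendstoD)
  then obtain K where K: "finite K" "dist (sum f K) (infsum f UNIV) < e"
    unfolding eventually_finite_subsets_at_top by auto
  thus ?thesis using infsum_Compl_finite(1)[OF f K(1)] by (intro that[of K]) (auto simp: dist_real_def)
qed

text \<open>A finite set that works at time t, with e/2 to spare, works for all nearby times by
  continuity in the Wiener norm; a finite subcover of \<open>S\<close> then gives one set for all
  times.\<close>

lemma uniform_tail:
  fixes w :: "real \<Rightarrow> int \<Rightarrow> complex"
  assumes summ: "\<And>t. t \<in> S \<Longrightarrow> wiener (w t)"
    and cont: "\<And>t. t \<in> S \<Longrightarrow> ((\<lambda>s. wdist (w s) (w t)) \<longlongrightarrow> 0) (at t within S)"
    and S: "compact S" and e: "0 < e"
  obtains K where "finite K" "\<And>t. t \<in> S \<Longrightarrow> (\<Sum>\<^sub>\<infinity>k\<in>- K. J k * cmod (w t k)) \<le> e"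
proof -
  have nn: "0 \<le> J k * cmod z" for k z using J_pos[of k] by simp
  have sd: "wiener (\<lambda>k. w s k - w t k)" if "s \<in> S" "t \<in> S" for s t
  proof (rule summable_on_comparison_test[OF summable_on_add[OF summ[OF that(1)] summ[OF that(2)]]])
    fix k show "J k * cmod (w s k - w t k) \<le> J k * cmod (w s k) + J k * cmod (w t k)"
      using mult_left_mono[OF norm_triangle_ineq4[of "w s k" "w t k"], of "J k"] J_pos[of k]
      by (simp add: distrib_left)
  qed (rule nn)
  have loc: "\<exists>U K. open U \<and> t \<in> U \<and> finite K \<and> (\<forall>s\<in>S \<inter> U. (\<Sum>\<^sub>\<infinity>k\<in>- K. J k * cmod (w s k)) \<le> e)" if t: "t \<in> S" for t
  proof -
    obtain K where K: "finite K" "(\<Sum>\<^sub>\<infinity>k\<in>- K. J k * cmod (w t k)) < e / 2"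
      using small_tail[OF summ[OF t], of "e / 2"] e by auto
    have "eventually (\<lambda>s. wdist (w s) (w t) < e / 2) (at t within S)"
      using order_tendstoD(2)[OF cont[OF t], of "e / 2"] e by simp
    then obtain U where U: "open U" "t \<in> U"
      "\<And>s. s \<in> U \<Longrightarrow> s \<noteq> t \<Longrightarrow> s \<in> S \<Longrightarrow> wdist (w s) (w t) < e / 2"
      unfolding eventually_at_topological by blast
    have "(\<Sum>\<^sub>\<infinity>k\<in>- K. J k * cmod (w s k)) \<le> e" if s: "s \<in> S \<inter> U" for s
    proof -
      have d: "wdist (w s) (w t) < e / 2"
        using U(3)[of s] s e by (cases "s = t") auto
      note s1 = infsum_Compl_finite(2)[OF sd[of s t] K(1)] and s2 = infsum_Compl_finite(2)[OF summ[of t] K(1)]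
        and s3 = infsum_Compl_finite(2)[OF summ[of s] K(1)]
      have "(\<Sum>\<^sub>\<infinity>k\<in>- K. J k * cmod (w s k)) \<le> (\<Sum>\<^sub>\<infinity>k\<in>- K. J k * cmod (w s k - w t k) + J k * cmod (w t k))"
      proof (rule infsum_mono)
        fix k show "J k * cmod (w s k) \<le> J k * cmod (w s k - w t k) + J k * cmod (w t k)"
          using mult_left_mono[OF norm_triangle_sub[of "w s k" "w t k"], of "J k"] J_pos[of k]
          by (simp add: distrib_left)
      qed (use s t s1 s2 s3 in \<open>auto intro: summable_on_add\<close>)
      also have "\<dots> = (\<Sum>\<^sub>\<infinity>k\<in>- K. J k * cmod (w s k - w t k)) + (\<Sum>\<^sub>\<infinity>k\<in>- K. J k * cmod (w t k))"
        by (rule infsum_add) (use s t s1 s2 in auto)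
      also have "(\<Sum>\<^sub>\<infinity>k\<in>- K. J k * cmod (w s k - w t k)) \<le> wdist (w s) (w t)"
        by (rule infsum_mono2) (use s t s1 sd nn in auto)
      finally show ?thesis using d K(2) by linarith
    qed
    thus ?thesis using U K(1) by blast
  qed
  define Q where "Q = (\<lambda>t U K. open U \<and> t \<in> U \<and> finite K \<and> (\<forall>s\<in>S \<inter> U. (\<Sum>\<^sub>\<infinity>k\<in>- K. J k * cmod (w s k)) \<le> e))"
  have "\<forall>t\<in>S. \<exists>p. Q t (fst p) (snd p)" using loc by (simp add: Q_def)
  then obtain p where p: "\<And>t. t \<in> S \<Longrightarrow> Q t (fst (p t)) (snd (p t))" using bchoice by metis
  define U K where "U = (\<lambda>t. fst (p t))" and "K = (\<lambda>t. snd (p t))"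
  have UK: "Q t (U t) (K t)" if "t \<in> S" for t using p[OF that] by (simp add: U_def K_def)
  have "S \<subseteq> (\<Union>t\<in>S. U t)" using UK by (force simp: Q_def)
  then obtain F where F: "F \<subseteq> S" "finite F" "S \<subseteq> (\<Union>t\<in>F. U t)"
    by (rule compactE_image[OF S, of S U, rotated]) (use UK in \<open>auto simp: Q_def\<close>)
  let ?K = "\<Union>t\<in>F. K t"
  have fin: "finite ?K" using F UK by (auto simp: Q_def)
  show ?thesis
  proof (rule that[OF fin])
    fix s assume s: "s \<in> S"
    then obtain t where t: "t \<in> F" "s \<in> U t" using F by auto
    have tS: "t \<in> S" using t F by auto
    have "(\<Sum>\<^sub>\<infinity>k\<in>- ?K. J k * cmod (w s k)) \<le> (\<Sum>\<^sub>\<infinity>k\<in>- K t. J k * cmod (w s k))"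
    proof (rule infsum_mono2)
      show "(\<lambda>k. J k * cmod (w s k)) summable_on - ?K" using infsum_Compl_finite(2)[OF summ[OF s] fin] .
      show "(\<lambda>k. J k * cmod (w s k)) summable_on - K t"
        using infsum_Compl_finite(2)[OF summ[OF s], of "K t"] UK[OF tS] unfolding Q_def by auto
    qed (use t nn in auto)
    also have "\<dots> \<le> e" using UK[OF tS] s t unfolding Q_def by auto
    finally show "(\<Sum>\<^sub>\<infinity>k\<in>- ?K. J k * cmod (w s k)) \<le> e" .
  qed
qed

text \<open>The function exp(-c t) f(t) - t g has nonpositive derivative, because exp(-c t) is at
  most 1 and g is nonnegative.\<close>

lemma gronwall_linear:
  fixes f f' :: "real \<Rightarrow> real"
  assumes f: "\<And>t. t \<in> {0..T} \<Longrightarrow> (f has_real_derivative f' t) (at t within {0..T})"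
    and le: "\<And>t. t \<in> {0..T} \<Longrightarrow> f' t \<le> c * f t + g"
    and c: "0 \<le> c" and g: "0 \<le> g" and f0: "0 \<le> f 0" and t: "t \<in> {0..T}"
  shows "f t \<le> exp (c * T) * (f 0 + T * g)"
proof -
  define h where "h = (\<lambda>t. exp (- c * t) * f t - t * g)"
  have T: "0 \<le> T" using t by auto
  have h: "(h has_real_derivative (exp (- c * s) * (- c)) * f s + exp (- c * s) * f' s - g) (at s within {0..T})"
    if s: "s \<in> {0..T}" for s
    unfolding h_def using f[OF s] by (auto intro!: derivative_eq_intros)
  have "h t \<le> h 0"
  proof (cases "t = 0")
    case False
    have tT: "0 < t" "t \<le> T" using t False by auto
    show ?thesis
    proof (rule DERIV_nonpos_imp_decreasing_open[of 0 t h])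
      show "0 \<le> t" using tT by simp
      have "continuous_on {0..T} h" using h by (rule DERIV_continuous_on)
      thus "continuous_on {0..t} h" by (rule continuous_on_subset) (use tT in auto)
      fix s assume s: "0 < s" "s < t"
      have "(h has_real_derivative (exp (- c * s) * (- c)) * f s + exp (- c * s) * f' s - g) (at s)"
        using h[of s] s tT at_within_interior[of s "{0..T}"] by simp
      moreover have "(exp (- c * s) * (- c)) * f s + exp (- c * s) * f' s - g \<le> 0"
      proof -
        have "exp (- c * s) * (f' s - c * f s) \<le> exp (- c * s) * g"
          using le[of s] s tT by (intro mult_left_mono) auto
        also have "\<dots> \<le> 1 * g" using c g s by (intro mult_right_mono) auto
        finally show ?thesis by (simp add: algebra_simps)
      qed
      ultimately show "\<exists>y. DERIV h s :> y \<and> y \<le> 0" by blast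
    qed
  qed simp
  hence 1: "exp (- c * t) * f t \<le> f 0 + t * g" by (simp add: h_def)
  have "f t = exp (c * t) * (exp (- c * t) * f t)" by (simp add: exp_minus field_simps)
  also have "\<dots> \<le> exp (c * t) * (f 0 + t * g)" using 1 by (intro mult_left_mono) auto
  also have "\<dots> \<le> exp (c * T) * (f 0 + T * g)"
    using mult_left_mono[of t T c] mult_right_mono[of t T g] c g f0 t by (intro mult_mono) auto
  finally show ?thesis .
qed

lemma has_real_derivative_cmod_square:
  fixes c :: "real \<Rightarrow> complex"
  assumes "(c has_vector_derivative c') (at t within S)"
  shows "((\<lambda>s. (cmod (c s))\<^sup>2) has_real_derivative 2 * Re (cnj (c t) * c')) (at t within S)"
proof -
  have "((\<lambda>s. Re (c s)) has_real_derivative Re c') (at t within S)"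
    "((\<lambda>s. Im (c s)) has_real_derivative Im c') (at t within S)"
    using assms bounded_linear.has_vector_derivative[OF bounded_linear_Re] bounded_linear.has_vector_derivative[OF bounded_linear_Im]
    by (auto simp: has_real_derivative_iff_has_vector_derivative)
  thus ?thesis using assms unfolding cmod_power2 by (auto intro!: derivative_eq_intros simp: algebra_simps)
qed

lemma norm_conv_le:
  assumes x: "(\<lambda>k. cmod (x k)) summable_on UNIV" "(\<Sum>\<^sub>\<infinity>k. cmod (x k)) \<le> A" and y: "\<And>k. cmod (y k) \<le> B"
  shows "cmod (conv x y k) \<le> A * B"
proof -
  have B: "0 \<le> B" using y[of 0] norm_ge_zero order_trans by blast
  have s: "(\<lambda>a. cmod (x a) * B) summable_on UNIV" by (rule summable_on_cmult_left[OF x(1)])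
  have "cmod (conv x y k) \<le> (\<Sum>\<^sub>\<infinity>a. cmod (x a) * B)" unfolding conv_def
  proof (rule norm_infsum_le[OF has_sum_infsum has_sum_infsum[OF s]])
    have "(\<lambda>a. norm (x a * y (k - a))) summable_on UNIV"
      by (rule Infinite_Sum.abs_summable_on_comparison_test'[OF s]) (auto simp: norm_mult intro!: mult_left_mono y)
    thus "(\<lambda>a. x a * y (k - a)) summable_on UNIV" by (rule abs_summable_summable)
  qed (auto simp: norm_mult intro!: mult_left_mono y)
  also have "\<dots> = (\<Sum>\<^sub>\<infinity>a. cmod (x a)) * B" by (rule infsum_cmult_left')
  also have "\<dots> \<le> A * B" by (rule mult_right_mono[OF x(2) B])
  finally show ?thesis .
qed

lemma norm_add_double_le: "cmod (x + 2 * y) \<le> cmod x + 2 * cmod y"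
  using norm_triangle_ineq[of x "2 * y"] by (simp add: norm_mult)

text \<open>Here \<open>w\<close> is the difference of two solutions, \<open>d\<close> the
  reference, and \<eta> the difference of their dispersion coefficients. The factor 6 is twice the 3
  of the nonlinearity, and the cross term 2 \<open>conv d w\<close> doubles it to 12. The right-hand
  side is free of \<open>W\<close>, which allows the truncation to be lifted later; the left-hand
  side runs over a finite \<open>K\<close> because summability for the full weight is still to be
  derived.\<close>

lemma weighted_energy_estimate:
  fixes w d :: "real \<Rightarrow> int \<Rightarrow> complex" and \<theta> :: "int \<Rightarrow> real"
  assumes weight: "weight P \<omega>" and bdd: "\<And>k. \<omega> k \<le> W"
    and herm: "\<And>t k. t \<in> {0..T} \<Longrightarrow> w t (- k) = cnj (w t k)"
    and summ: "\<And>t. t \<in> {0..T} \<Longrightarrow> wiener (w t)"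
    and B: "\<And>t. t \<in> {0..T} \<Longrightarrow> wnorm (w t) \<le> B"
    and cont: "\<And>t. t \<in> {0..T} \<Longrightarrow> ((\<lambda>s. wdist (w s) (w t)) \<longlongrightarrow> 0) (at t within {0..T})"
    and d: "\<And>t. t \<in> {0..T} \<Longrightarrow> (\<lambda>k. J k ^ (2 * P + 1) * cmod (d t k)) summable_on UNIV"
    and A: "\<And>t. t \<in> {0..T} \<Longrightarrow> (\<Sum>\<^sub>\<infinity>k. J k ^ (2 * P + 1) * cmod (d t k)) \<le> A"
    and dD: "\<And>t. t \<in> {0..T} \<Longrightarrow> (\<lambda>k. \<omega> k * (\<theta> k * cmod (d t k))\<^sup>2) summable_on UNIV"
    and D: "\<And>t. t \<in> {0..T} \<Longrightarrow> (\<Sum>\<^sub>\<infinity>k. \<omega> k * (\<theta> k * cmod (d t k))\<^sup>2) \<le> D"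
    and ode: "\<And>t k. t \<in> {0..T} \<Longrightarrow> ((\<lambda>s. w s k) has_vector_derivative
        (- 3 * \<i> * of_int k * (conv (w t) (w t) k + 2 * conv (d t) (w t) k)
          + \<i> * of_real (\<beta> * \<theta> k) * w t k + \<i> * of_real (\<eta> * \<theta> k) * d t k)) (at t within {0..T})"
    and t: "t \<in> {0..T}" and K: "finite K"
  shows "(\<Sum>k\<in>K. \<omega> k * (cmod (w t k))\<^sup>2)
      \<le> exp ((6 * ((1 + real P) * 4 ^ P + 1) * B + 12 * (1 + real P) * A + \<bar>\<eta>\<bar>) * T)
          * ((\<Sum>\<^sub>\<infinity>k. \<omega> k * (cmod (w 0 k))\<^sup>2) + T * (\<bar>\<eta>\<bar> * D))"
proof -
  define C1 where "C1 = (1 + real P) * 4 ^ P + 1"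
  define C2 where "C2 = 1 + real P"
  define L where "L = 6 * C1 * B + 12 * C2 * A + \<bar>\<eta>\<bar>"
  have T: "0 \<le> T" using t by auto
  have tw: "trunc_weight P \<omega> W (w s)" if "s \<in> {0..T}" for s
    using weight bdd herm summ that by (unfold_locales) auto
  have \<omega>0: "0 < \<omega> k" for k using weight_pos[OF weight] .
  have W: "0 < W" using \<omega>0[of 0] bdd[of 0] by linarith
  have C: "0 \<le> C1" "0 \<le> C2" by (simp_all add: C1_def C2_def)
  have wB: "J k * cmod (w s k) \<le> B" "cmod (w s k) \<le> B" if "s \<in> {0..T}" for s k
  proof -
    interpret trunc_weight P \<omega> W "w s" by (rule tw[OF that])
    show "J k * cmod (w s k) \<le> B" "cmod (w s k) \<le> B"
      using B_ge[of k] cmod_le_B[of k] B[OF that] unfolding B_def by linarith+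
  qed
  have Bn: "0 \<le> B" using wB(2)[OF t, of 0] norm_ge_zero order_trans by blast
  have An: "0 \<le> A" by (rule order_trans[OF infsum_nonneg A[OF t]]) (simp add: J_pos less_imp_le)
  have Dn: "0 \<le> D" by (rule order_trans[OF infsum_nonneg D[OF t]]) (simp add: \<omega>0 less_imp_le)
  have L: "0 \<le> L" using Bn An C by (simp add: L_def)
  \<comment> \<open>Price of working with the finite set \<open>M\<close>, per unit of Wiener tail:
    the first summand replaces the full energy by its part on \<open>M\<close>, the second discards
    the tail of the trilinear sum. \<open>W\<close> enters here and is removed when \<tau> tends to
    0.\<close>
  define Q where "Q = 6 * (C1 * B + 2 * C2 * A) * (W * B) + 6 * (W * (B * B + 2 * (A * B)))"
  have Qn: "0 \<le> Q" using Bn An C W by (simp add: Q_def)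
  define E0 where "E0 = (\<Sum>\<^sub>\<infinity>k. \<omega> k * (cmod (w 0 k))\<^sup>2)"
  have main: "(\<Sum>k\<in>K. \<omega> k * (cmod (w t k))\<^sup>2) \<le> exp (L * T) * (E0 + T * (\<bar>\<eta>\<bar> * D + Q * \<tau>))"
    if \<tau>: "0 < \<tau>" for \<tau>
  proof -
    obtain K0 where K0: "finite K0" "\<And>s. s \<in> {0..T} \<Longrightarrow> (\<Sum>\<^sub>\<infinity>k\<in>- K0. J k * cmod (w s k)) \<le> \<tau>"
      by (rule uniform_tail[OF summ cont compact_Icc \<tau>]) blast+
    define M where "M = K \<union> K0"
    have M: "finite M" using K K0 by (simp add: M_def)
    have tail: "(\<Sum>\<^sub>\<infinity>k\<in>- M. J k * cmod (w s k)) \<le> \<tau>" if s: "s \<in> {0..T}" for s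
    proof -
      have "(\<Sum>\<^sub>\<infinity>k\<in>- M. J k * cmod (w s k)) \<le> (\<Sum>\<^sub>\<infinity>k\<in>- K0. J k * cmod (w s k))"
        by (rule infsum_mono2[OF infsum_Compl_finite(2)[OF summ[OF s] M] infsum_Compl_finite(2)[OF summ[OF s] K0(1)]])
           (auto simp: M_def J_pos less_imp_le)
      thus ?thesis using K0(2)[OF s] by linarith
    qed
    define f where "f = (\<lambda>s. \<Sum>k\<in>M. \<omega> k * (cmod (w s k))\<^sup>2)"
    define rhs where "rhs = (\<lambda>s k. - 3 * \<i> * of_int k * (conv (w s) (w s) k + 2 * conv (d s) (w s) k)
          + \<i> * of_real (\<beta> * \<theta> k) * w s k + \<i> * of_real (\<eta> * \<theta> k) * d s k)"
    define f' where "f' = (\<lambda>s. \<Sum>k\<in>M. \<omega> k * (2 * Re (cnj (w s k) * rhs s k)))"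
    have df: "(f has_real_derivative f' s) (at s within {0..T})" if s: "s \<in> {0..T}" for s
      unfolding f_def f'_def rhs_def
      by (intro DERIV_sum DERIV_cmult has_real_derivative_cmod_square ode s)
    have f'le: "f' s \<le> L * f s + (\<bar>\<eta>\<bar> * D + Q * \<tau>)" if s: "s \<in> {0..T}" for s
    proof -
      interpret trunc_weight P \<omega> W "w s" by (rule tw[OF s])
      have ds: "(\<lambda>k. cmod (d s k)) summable_on UNIV" and dA: "(\<Sum>\<^sub>\<infinity>k. cmod (d s k)) \<le> A"
      proof -
        have le: "cmod (d s k) \<le> J k ^ (2 * P + 1) * cmod (d s k)" for k
          using mult_right_mono[OF one_le_power[OF J_ge_1[of k]], of "cmod (d s k)" "2 * P + 1"] by simp
        show 1: "(\<lambda>k. cmod (d s k)) summable_on UNIV"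
          by (rule summable_on_comparison_test[OF d[OF s] le]) auto
        show "(\<Sum>\<^sub>\<infinity>k. cmod (d s k)) \<le> A"
          using infsum_mono[OF 1 d[OF s] le] A[OF s] by linarith
      qed
      have ws: "(\<lambda>k. cmod (w s k)) summable_on UNIV" and wA: "(\<Sum>\<^sub>\<infinity>k. cmod (w s k)) \<le> B"
      proof -
        have le: "cmod (w s k) \<le> J k * cmod (w s k)" for k
          using mult_right_mono[OF J_ge_1[of k], of "cmod (w s k)"] by simp
        show 1: "(\<lambda>k. cmod (w s k)) summable_on UNIV"
          by (rule summable_on_comparison_test[OF summ le]) auto
        show "(\<Sum>\<^sub>\<infinity>k. cmod (w s k)) \<le> B"
          using infsum_mono[OF 1 summ le] assms(5)[OF s] by linarith
      qed
      \<comment> \<open>\<open>z\<close> is kept as a series over all k, because only its full sum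
        has the symmetry behind the trilinear bounds.\<close>
      define z where "z = (\<lambda>k. complex_of_real (of_int k * \<omega> k) * cnj (w s k) * (conv (w s) (w s) k + 2 * conv (d s) (w s) k))"
      have zz: "z = (\<lambda>k. complex_of_real (of_int k * \<omega> k) * cnj (w s k) * conv (w s) (w s) k
          + 2 * (complex_of_real (of_int k * \<omega> k) * cnj (w s k) * conv (d s) (w s) k))"
        by (simp add: z_def fun_eq_iff algebra_simps)
      have zs: "z summable_on UNIV" unfolding zz
        by (intro summable_on_add summable_on_cmult_right conv_summable ws ds)
      have EB: "trunc_weight.B (w s) \<le> B" using assms(5)[OF s] by (simp add: B_def)
      define E' where "E' = trunc_weight.E \<omega> (w s)"
      have zE: "cmod (infsum z UNIV) \<le> (C1 * B + 2 * C2 * A) * E'"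
      proof -
        define S1 S2 where "S1 = (\<Sum>\<^sub>\<infinity>k. complex_of_real (of_int k * \<omega> k) * cnj (w s k) * conv (w s) (w s) k)"
          and "S2 = (\<Sum>\<^sub>\<infinity>k. complex_of_real (of_int k * \<omega> k) * cnj (w s k) * conv (d s) (w s) k)"
        have "infsum z UNIV = S1 + 2 * S2"
          unfolding zz S1_def S2_def
          by (simp only: infsum_add[OF conv_summable[OF ws] summable_on_cmult_right[OF conv_summable[OF ds]]] infsum_cmult_right')
        hence "cmod (infsum z UNIV) \<le> cmod S1 + 2 * cmod S2"
          by (simp only: norm_add_double_le)
        also have "\<dots> \<le> C1 * trunc_weight.B (w s) * E' + 2 * (C2 * (\<Sum>\<^sub>\<infinity>k. J k ^ (2 * P + 1) * cmod (d s k)) * E')"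
          unfolding C1_def C2_def E'_def S1_def S2_def
          by (rule add_mono[OF quadratic_term_bound mult_left_mono[OF linear_term_bound[OF d[OF s]]]]) simp
        also have "\<dots> \<le> C1 * B * E' + 2 * (C2 * A * E')"
          by (intro add_mono mult_left_mono mult_right_mono EB A s C) (simp_all add: E'_def E_nonneg)
        finally show ?thesis by (simp add: algebra_simps)
      qed
      have s1: "(\<lambda>k. J k * cmod (w s k)) summable_on - M" by (rule infsum_Compl_finite(2)[OF summ M])
      have E'le: "E' \<le> f s + W * B * \<tau>"
      proof -
        have "E' = f s + (\<Sum>\<^sub>\<infinity>k\<in>- M. \<omega> k * (cmod (w s k))\<^sup>2)"
          unfolding E'_def E_def f_def by (rule infsum_Compl_finite(1)[OF E_summable M])
        also have "(\<Sum>\<^sub>\<infinity>k\<in>- M. \<omega> k * (cmod (w s k))\<^sup>2) \<le> (\<Sum>\<^sub>\<infinity>k\<in>- M. W * B * (J k * cmod (w s k)))"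
        proof (rule infsum_mono[OF infsum_Compl_finite(2)[OF E_summable M] summable_on_cmult_right[OF s1]])
          fix k
          have "\<omega> k * (cmod (w s k))\<^sup>2 \<le> W * (B * (J k * cmod (w s k)))"
          proof (intro mult_mono bounded)
            have "(cmod (w s k))\<^sup>2 = cmod (w s k) * (1 * cmod (w s k))" by (simp add: power2_eq_square)
            also have "\<dots> \<le> B * (J k * cmod (w s k))"
              by (intro mult_mono wB(2)[OF s] J_ge_1) (use Bn J_pos[of k] in auto)
            finally show "(cmod (w s k))\<^sup>2 \<le> B * (J k * cmod (w s k))" .
          qed (use W in auto)
          thus "\<omega> k * (cmod (w s k))\<^sup>2 \<le> W * B * (J k * cmod (w s k))" by simp
        qed
        also have "\<dots> \<le> W * B * \<tau>" unfolding infsum_cmult_right'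
          by (rule mult_left_mono[OF tail[OF s]]) (use W Bn in auto)
        finally show ?thesis by simp
      qed
      have ztail: "cmod (infsum z (- M)) \<le> W * (B * B + 2 * (A * B)) * \<tau>"
      proof -
        have "cmod (infsum z (- M)) \<le> (\<Sum>\<^sub>\<infinity>k\<in>- M. W * (B * B + 2 * (A * B)) * (J k * cmod (w s k)))"
        proof (rule norm_infsum_le_infsum[OF summable_on_cmult_right[OF s1]])
          fix k
          have "cmod (conv (w s) (w s) k + 2 * conv (d s) (w s) k) \<le> cmod (conv (w s) (w s) k) + 2 * cmod (conv (d s) (w s) k)"
            by (rule norm_add_double_le)
          also have "\<dots> \<le> B * B + 2 * (A * B)"
            by (intro add_mono mult_left_mono norm_conv_le ws wA ds dA wB(2)[OF s]) simp
          finally have c: "cmod (conv (w s) (w s) k + 2 * conv (d s) (w s) k) \<le> B * B + 2 * (A * B)" .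
          have "cmod (z k) = \<bar>of_int k\<bar> * \<omega> k * cmod (w s k) * cmod (conv (w s) (w s) k + 2 * conv (d s) (w s) k)"
            using \<omega>0[of k] by (simp add: z_def norm_mult abs_mult)
          also have "\<dots> \<le> J k * W * cmod (w s k) * (B * B + 2 * (A * B))"
            using \<omega>0[of k] J_pos[of k] W by (intro mult_mono abs_le_J bounded c order_refl mult_nonneg_nonneg) auto
          finally show "cmod (z k) \<le> W * (B * B + 2 * (A * B)) * (J k * cmod (w s k))" by (simp add: mult_ac)
        qed
        also have "\<dots> \<le> W * (B * B + 2 * (A * B)) * \<tau>" unfolding infsum_cmult_right'
          by (rule mult_left_mono[OF tail[OF s]]) (use W Bn An in auto)
        finally show ?thesis .
      qed
      \<comment> \<open>After multiplication by \<open>cnj (w s k)\<close> the \<beta> term is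
        purely imaginary and leaves the real part; the \<eta> term is split by 2 x y \<le> x^2 + y^2
        into energy and forcing.\<close>
      have summand_le: "\<omega> k * (2 * Re (cnj (w s k) * rhs s k))
          \<le> Re (- 6 * \<i> * z k) + \<bar>\<eta>\<bar> * (\<omega> k * (cmod (w s k))\<^sup>2 + \<omega> k * (\<theta> k * cmod (d s k))\<^sup>2)" for k
      proof -
        define X Z where "X = cnj (w s k) * (- 3 * \<i> * of_int k * (conv (w s) (w s) k + 2 * conv (d s) (w s) k))"
          and "Z = \<i> * of_real (\<eta> * \<theta> k) * (cnj (w s k) * d s k)"
        have "cnj (w s k) * rhs s k = X + \<i> * of_real (\<beta> * \<theta> k * (cmod (w s k))\<^sup>2) + Z"
          unfolding of_real_mult complex_norm_square rhs_def X_def Z_def by (simp add: algebra_simps)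
        hence "\<omega> k * (2 * Re (cnj (w s k) * rhs s k)) = Re (of_real (2 * \<omega> k) * X) + 2 * \<omega> k * Re Z"
          by (simp add: algebra_simps)
        also have "of_real (2 * \<omega> k) * X = - 6 * \<i> * z k"
          by (simp add: z_def X_def)
        also have "2 * \<omega> k * Re Z \<le> 2 * \<omega> k * (\<bar>\<eta>\<bar> * \<bar>\<theta> k\<bar> * (cmod (w s k) * cmod (d s k)))"
        proof (rule mult_left_mono)
          have "Re Z \<le> cmod Z"
            by (rule complex_Re_le_cmod)
          also have "\<dots> = \<bar>\<eta>\<bar> * \<bar>\<theta> k\<bar> * (cmod (w s k) * cmod (d s k))"
            by (simp add: Z_def norm_mult abs_mult)
          finally show "Re Z \<le> \<bar>\<eta>\<bar> * \<bar>\<theta> k\<bar> * (cmod (w s k) * cmod (d s k))" .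
        qed (simp add: \<omega>0 less_imp_le)
        also have "\<dots> = \<bar>\<eta>\<bar> * (\<omega> k * (2 * cmod (w s k) * (\<bar>\<theta> k\<bar> * cmod (d s k))))" by simp
        also have "\<dots> \<le> \<bar>\<eta>\<bar> * (\<omega> k * ((cmod (w s k))\<^sup>2 + (\<bar>\<theta> k\<bar> * cmod (d s k))\<^sup>2))"
          by (intro mult_left_mono sum_squares_bound) (simp_all add: \<omega>0 less_imp_le)
        finally show ?thesis by (simp add: distrib_left power_mult_distrib)
      qed
      have "f' s \<le> (\<Sum>k\<in>M. Re (- 6 * \<i> * z k) + \<bar>\<eta>\<bar> * (\<omega> k * (cmod (w s k))\<^sup>2 + \<omega> k * (\<theta> k * cmod (d s k))\<^sup>2))"
        unfolding f'_def by (rule sum_mono[OF summand_le])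
      also have "\<dots> = Re (- 6 * \<i> * sum z M) + \<bar>\<eta>\<bar> * (f s + (\<Sum>k\<in>M. \<omega> k * (\<theta> k * cmod (d s k))\<^sup>2))"
        by (simp add: sum.distrib sum_distrib_left[symmetric] f_def del: mult_minus_left minus_mult_left)
      also have "\<dots> \<le> 6 * cmod (sum z M) + \<bar>\<eta>\<bar> * (f s + D)"
      proof (intro add_mono mult_left_mono)
        have "Re (- 6 * \<i> * sum z M) \<le> cmod (- 6 * \<i> * sum z M)" by (rule complex_Re_le_cmod)
        thus "Re (- 6 * \<i> * sum z M) \<le> 6 * cmod (sum z M)" by (simp add: norm_mult)
        have "(\<Sum>k\<in>M. \<omega> k * (\<theta> k * cmod (d s k))\<^sup>2) \<le> (\<Sum>\<^sub>\<infinity>k. \<omega> k * (\<theta> k * cmod (d s k))\<^sup>2)"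
          by (rule finite_sum_le_infsum[OF dD[OF s] M]) (simp_all add: \<omega>0 less_imp_le)
        thus "(\<Sum>k\<in>M. \<omega> k * (\<theta> k * cmod (d s k))\<^sup>2) \<le> D" using D[OF s] by linarith
      qed auto
      also have "sum z M = infsum z UNIV - infsum z (- M)" using infsum_Compl_finite(1)[OF zs M] by simp
      also have "6 * cmod (infsum z UNIV - infsum z (- M)) \<le> 6 * ((C1 * B + 2 * C2 * A) * (f s + W * B * \<tau>) + W * (B * B + 2 * (A * B)) * \<tau>)"
      proof (rule mult_left_mono)
        have "cmod (infsum z UNIV) \<le> (C1 * B + 2 * C2 * A) * (f s + W * B * \<tau>)"
          using zE mult_left_mono[OF E'le, of "C1 * B + 2 * C2 * A"] C Bn An by (meson add_nonneg_nonneg mult_nonneg_nonneg order_trans zero_le_numeral)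
        thus "cmod (infsum z UNIV - infsum z (- M)) \<le> (C1 * B + 2 * C2 * A) * (f s + W * B * \<tau>) + W * (B * B + 2 * (A * B)) * \<tau>"
          using norm_triangle_ineq4[of "infsum z UNIV" "infsum z (- M)"] ztail by linarith
      qed simp
      finally show ?thesis unfolding L_def Q_def by (simp add: algebra_simps)
    qed
    have f0: "0 \<le> f 0" unfolding f_def by (intro sum_nonneg) (simp add: \<omega>0 less_imp_le)
    have "f t \<le> exp (L * T) * (f 0 + T * (\<bar>\<eta>\<bar> * D + Q * \<tau>))"
      by (rule gronwall_linear[OF df f'le L _ f0 t]) (use Dn Qn \<tau> in auto)
    also have "\<dots> \<le> exp (L * T) * (E0 + T * (\<bar>\<eta>\<bar> * D + Q * \<tau>))"
    proof (intro mult_left_mono add_right_mono)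
      interpret trunc_weight P \<omega> W "w 0" by (rule tw) (use T in auto)
      show "f 0 \<le> E0" unfolding f_def E0_def
        by (rule finite_sum_le_infsum[OF E_summable M]) (simp_all add: \<omega>0 less_imp_le)
    qed simp
    finally have 1: "f t \<le> exp (L * T) * (E0 + T * (\<bar>\<eta>\<bar> * D + Q * \<tau>))" .
    have "(\<Sum>k\<in>K. \<omega> k * (cmod (w t k))\<^sup>2) \<le> f t" unfolding f_def
      by (rule sum_mono2[OF M]) (auto simp: M_def \<omega>0 less_imp_le)
    thus ?thesis using 1 by linarith
  qed
  \<comment> \<open>The left-hand side does not depend on the tail size \<tau>, so \<tau> may tend
    to 0 from the right.\<close>
  have "((\<lambda>\<tau>. exp (L * T) * (E0 + T * (\<bar>\<eta>\<bar> * D + Q * \<tau>))) \<longlongrightarrow> exp (L * T) * (E0 + T * (\<bar>\<eta>\<bar> * D + Q * 0))) (at_right 0)"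
    by (intro tendsto_intros)
  hence "(\<Sum>k\<in>K. \<omega> k * (cmod (w t k))\<^sup>2) \<le> exp (L * T) * (E0 + T * (\<bar>\<eta>\<bar> * D + Q * 0))"
    by (rule tendsto_lowerbound) (auto intro!: eventually_at_rightI[of 0 1] main)
  thus ?thesis by (simp add: L_def C1_def C2_def E0_def)
qed

section \<open>Solutions on the Fourier side\<close>

lemma summable_inverse_J_square: "(\<lambda>k. 1 / (J k)\<^sup>2) summable_on UNIV"
proof -
  have "summable (\<lambda>n::nat. inverse (real (Suc n) ^ 2))"
    using inverse_power_summable[of 2, where ?'a = real] by (intro summable_Suc_iff[THEN iffD2]) simp
  hence "summable (\<lambda>n::nat. norm (1 / (1 + real n)\<^sup>2))" by (simp add: inverse_eq_divide)
  hence nat: "(\<lambda>n::nat. 1 / (1 + real n)\<^sup>2) summable_on UNIV" by (rule norm_summable_imp_summable_on)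
  have "(\<lambda>k. 1 / (J k)\<^sup>2) summable_on range int"
    by (subst summable_on_reindex) (use nat in \<open>auto simp: inj_on_def o_def J_def\<close>)
  moreover have "(\<lambda>k. 1 / (J k)\<^sup>2) summable_on range (\<lambda>n. - int n)"
    by (subst summable_on_reindex) (use nat in \<open>auto simp: inj_on_def o_def J_def\<close>)
  ultimately have "(\<lambda>k. 1 / (J k)\<^sup>2) summable_on (range int \<union> range (\<lambda>n. - int n))"
    by (rule summable_on_union)
  moreover have "range int \<union> range (\<lambda>n. - int n) = UNIV"
  proof -
    have "k \<in> range int \<union> range (\<lambda>n. - int n)" for k by (cases k rule: int_cases2) auto
    thus ?thesis by blast
  qed
  ultimately show ?thesis by simp
qed

definition Z2 :: real where "Z2 = (\<Sum>\<^sub>\<infinity>k. 1 / (J k)\<^sup>2)"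

lemma Z2_nonneg: "0 \<le> Z2" unfolding Z2_def by (intro infsum_nonneg) simp

lemma summable_J_decay:
  fixes f :: "int \<Rightarrow> real"
  assumes f: "\<And>k. 0 \<le> f k" "\<And>k. f k * (J k)\<^sup>2 \<le> M"
  shows "f summable_on UNIV" "infsum f UNIV \<le> M * Z2"
proof -
  have le: "f k \<le> M * (1 / (J k)\<^sup>2)" for k using f(2)[of k] J_pos[of k] by (simp add: field_simps)
  have s: "(\<lambda>k. M * (1 / (J k)\<^sup>2)) summable_on UNIV"
    by (intro summable_on_cmult_right summable_inverse_J_square)
  show 1: "f summable_on UNIV" by (rule summable_on_comparison_test[OF s le f(1)])
  show "infsum f UNIV \<le> M * Z2" using infsum_mono[OF 1 s le] by (simp only: infsum_cmult_right' Z2_def)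
qed

section \<open>Truncated power weights\<close>

definition cutoff :: "real \<Rightarrow> real \<Rightarrow> int \<Rightarrow> real" where
  "cutoff N p k = min (J k) N powr p"

text \<open>For L \<ge> 1 one has min(L x, N) \<le> L min(x, N), so truncation does not worsen the
  ratio bound, and \<open>P\<close> is uniform in \<open>N\<close>.\<close>

lemma weight_cutoff:
  assumes N: "1 \<le> N" and p: "0 \<le> p" "p \<le> real P"
  shows "weight P (cutoff N p)"
  unfolding weight_def
proof (intro conjI allI impI)
  show "0 < cutoff N p k" for k using J_pos[of k] N by (simp add: cutoff_def)
  fix L :: real and m n :: int
  assume L: "1 \<le> L" and mn: "J m \<le> L * J n"
  have N': "N \<le> L * N" using L N by simp
  have "min (J m) N \<le> L * min (J n) N" using mn N' by (auto simp: min_def)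
  hence "cutoff N p m \<le> (L * min (J n) N) powr p"
    unfolding cutoff_def using J_pos[of m] N p by (intro powr_mono2) auto
  also have "\<dots> = L powr p * cutoff N p n"
    unfolding cutoff_def by (rule powr_mult)
  also have "\<dots> \<le> L ^ P * cutoff N p n"
    using powr_mono[OF p(2) L] L by (intro mult_right_mono) (auto simp: powr_realpow cutoff_def)
  finally show "cutoff N p m \<le> L ^ P * cutoff N p n" .
qed

lemma cutoff_le: "1 \<le> N \<Longrightarrow> 0 \<le> p \<Longrightarrow> cutoff N p k \<le> N powr p"
  unfolding cutoff_def using J_pos[of k] by (intro powr_mono2) auto

lemma cutoff_le_J: "1 \<le> N \<Longrightarrow> 0 \<le> p \<Longrightarrow> cutoff N p k \<le> J k powr p"
  unfolding cutoff_def using J_pos[of k] by (intro powr_mono2) auto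

lemma cutoff_nonneg: "0 \<le> cutoff N p k" by (simp add: cutoff_def)

lemma cutoff_eq: "J k \<le> N \<Longrightarrow> cutoff N p k = J k powr p" by (simp add: cutoff_def min_def)

text \<open>The nonlinearity 6 u u_x is 3 (u^2)_x, hence the factor 3 i k in front of the
  convolution. Separating the coefficient \<beta> from the symbol \<theta> puts Burgers, with
  \<beta> = 0, and all the dispersive equations into one family.\<close>

definition rhs :: "real \<Rightarrow> (int \<Rightarrow> real) \<Rightarrow> (int \<Rightarrow> complex) \<Rightarrow> int \<Rightarrow> complex" where
  "rhs \<beta> \<theta> c k = - 3 * \<i> * of_int k * conv c c k + \<i> * of_real (\<beta> * \<theta> k) * c k"

text \<open>The common notion of solution for both equations: real-valued, continuous in time in the
  Wiener norm, and satisfying the evolution equation separately for each coefficient.\<close>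

definition fsol :: "real \<Rightarrow> (int \<Rightarrow> real) \<Rightarrow> real \<Rightarrow> (real \<Rightarrow> int \<Rightarrow> complex) \<Rightarrow> bool" where
  "fsol \<beta> \<theta> T c \<longleftrightarrow> (\<forall>t\<in>{0..T}.
     (\<forall>k. c t (- k) = cnj (c t k)) \<and>
     wiener (c t) \<and>
     ((\<lambda>s. wdist (c s) (c t)) \<longlongrightarrow> 0) (at t within {0..T}) \<and>
     (\<forall>k. ((\<lambda>s. c s k) has_vector_derivative rhs \<beta> \<theta> (c t) k) (at t within {0..T})))"

lemma fsolD:
  assumes "fsol \<beta> \<theta> T c" "t \<in> {0..T}"
  shows "c t (- k) = cnj (c t k)" "wiener (c t)"
    "((\<lambda>s. wdist (c s) (c t)) \<longlongrightarrow> 0) (at t within {0..T})"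
    "((\<lambda>s. c s k) has_vector_derivative rhs \<beta> \<theta> (c t) k) (at t within {0..T})"
  using assms unfolding fsol_def by auto

section \<open>The Wiener norm along a solution\<close>

lemma summable_J_diff:
  assumes "wiener x" "wiener y"
  shows "wiener (\<lambda>k. x k - y k)"
    and "wdist x y \<le> wnorm x + wnorm y"
proof -
  have le: "J k * cmod (x k - y k) \<le> J k * cmod (x k) + J k * cmod (y k)" for k
    using mult_left_mono[OF norm_triangle_ineq4[of "x k" "y k"], of "J k"] J_pos[of k]
    by (simp add: distrib_left)
  show 1: "wiener (\<lambda>k. x k - y k)"
    by (rule summable_on_comparison_test[OF summable_on_add[OF assms] le]) (simp add: J_pos less_imp_le)
  show "wdist x y \<le> wnorm x + wnorm y"
    using infsum_mono[OF 1 summable_on_add[OF assms] le] by (simp only: infsum_add[OF assms])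
qed

lemma summable_of_J:
  assumes x: "wiener x"
  shows "(\<lambda>k. cmod (x k)) summable_on UNIV" "cmod (x k) \<le> wnorm x"
proof -
  have le: "cmod (x k) \<le> J k * cmod (x k)" for k
    using mult_right_mono[OF J_ge_1[of k], of "cmod (x k)"] by simp
  show "(\<lambda>k. cmod (x k)) summable_on UNIV" by (rule summable_on_comparison_test[OF x le]) simp
  have "J k * cmod (x k) \<le> wnorm x"
    using finite_sum_le_infsum[OF x, of "{k}"] J_pos by (simp add: less_imp_le)
  thus "cmod (x k) \<le> wnorm x" using le[of k] by linarith
qed

lemma continuous_on_wiener_norm:
  fixes w :: "real \<Rightarrow> int \<Rightarrow> complex"
  assumes summ: "\<And>t. t \<in> S \<Longrightarrow> wiener (w t)"
    and cont: "\<And>t. t \<in> S \<Longrightarrow> ((\<lambda>s. wdist (w s) (w t)) \<longlongrightarrow> 0) (at t within S)"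
  shows "continuous_on S (\<lambda>t. wnorm (w t))"
  unfolding continuous_on_def
proof
  fix t assume t: "t \<in> S"
  let ?b = "\<lambda>t. \<Sum>\<^sub>\<infinity>k. J k * cmod (w t k)"
  show "(?b \<longlongrightarrow> ?b t) (at t within S)"
  proof (rule Lim_transform)
    show "((\<lambda>s. ?b s - ?b t) \<longlongrightarrow> 0) (at t within S)"
    proof (rule Lim_null_comparison[OF _ cont[OF t]])
      have le: "norm (?b s - ?b t) \<le> wdist (w s) (w t)" if s: "s \<in> S" for s
      proof -
        have "?b s \<le> wdist (w s) (w t) + ?b t"
        proof -
          have "wnorm (\<lambda>k. (w s k - w t k) - (- w t k)) \<le> wdist (w s) (w t) + wnorm (\<lambda>k. - w t k)"
            by (rule summable_J_diff(2)) (use summable_J_diff(1)[OF summ[OF s] summ[OF t]] summ[OF t] in auto)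
          thus ?thesis by simp
        qed
        moreover have "?b t \<le> ?b s + wdist (w s) (w t)"
        proof -
          have "wnorm (\<lambda>k. w s k - (w s k - w t k)) \<le> ?b s + wdist (w s) (w t)"
            by (rule summable_J_diff(2)) (use summable_J_diff(1)[OF summ[OF s] summ[OF t]] summ[OF s] in auto)
          thus ?thesis by simp
        qed
        ultimately show ?thesis by (simp add: abs_le_iff)
      qed
      show "\<forall>\<^sub>F s in at t within S. norm (?b s - ?b t) \<le> wdist (w s) (w t)"
        unfolding eventually_at_filter by (intro always_eventually) (auto simp del: real_norm_def intro!: le)
    qed
    show "((\<lambda>s. ?b t) \<longlongrightarrow> ?b t) (at t within S)" by simp
  qed
qed

lemma fsol_bounded:
  assumes "fsol \<beta> \<theta> T c"
  obtains B where "\<And>t. t \<in> {0..T} \<Longrightarrow> wnorm (c t) \<le> B"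
proof -
  have "continuous_on {0..T} (\<lambda>t. wnorm (c t))"
    by (rule continuous_on_wiener_norm) (use fsolD[OF assms] in auto)
  hence "compact ((\<lambda>t. wnorm (c t)) ` {0..T})" by (rule compact_continuous_image) simp
  hence "bounded ((\<lambda>t. wnorm (c t)) ` {0..T})" by (rule compact_imp_bounded)
  then obtain B where "\<forall>x\<in>(\<lambda>t. wnorm (c t)) ` {0..T}. norm x \<le> B"
    unfolding bounded_iff by blast
  thus ?thesis by (intro that[of B]) (force simp: abs_le_iff)
qed

lemma conv_zero [simp]: "conv (\<lambda>_. 0) y k = 0" by (simp add: conv_def)

text \<open>Persistence of regularity: the energy estimate with vanishing reference solution.\<close>

lemma fsol_decay:
  assumes sol: "fsol \<beta> \<theta> T c" and c0: "\<And>q::nat. \<exists>M. \<forall>k. cmod (c 0 k) * J k ^ q \<le> M"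
  shows "\<exists>M. \<forall>t\<in>{0..T}. \<forall>k. cmod (c t k) * J k ^ q \<le> M"
proof -
  obtain B where B: "\<And>t. t \<in> {0..T} \<Longrightarrow> wnorm (c t) \<le> B" using fsol_bounded[OF sol] by blast
  \<comment> \<open>One power more than \<open>q\<close> leaves J^-2 after squaring, which is
    summable.\<close>
  obtain M where M: "\<And>k. cmod (c 0 k) * J k ^ (q + 1) \<le> M" using c0 by blast
  have sum0: "(\<lambda>k. J k ^ (2 * q) * (cmod (c 0 k))\<^sup>2) summable_on UNIV"
    "(\<Sum>\<^sub>\<infinity>k. J k ^ (2 * q) * (cmod (c 0 k))\<^sup>2) \<le> M\<^sup>2 * Z2"
  proof -
    have "J k ^ (2 * q) * (cmod (c 0 k))\<^sup>2 * (J k)\<^sup>2 \<le> M\<^sup>2" for k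
    proof -
      have "J k ^ (2 * q) * (cmod (c 0 k))\<^sup>2 * (J k)\<^sup>2 = (cmod (c 0 k) * J k ^ (q + 1))\<^sup>2"
        unfolding mult.commute[of 2 q] power_mult power_mult_distrib power_add by (simp add: mult_ac)
      also have "\<dots> \<le> M\<^sup>2" by (intro power_mono M) (simp add: J_pos less_imp_le)
      finally show ?thesis .
    qed
    from summable_J_decay[OF _ this] show "(\<lambda>k. J k ^ (2 * q) * (cmod (c 0 k))\<^sup>2) summable_on UNIV"
      "(\<Sum>\<^sub>\<infinity>k. J k ^ (2 * q) * (cmod (c 0 k))\<^sup>2) \<le> M\<^sup>2 * Z2" by (simp_all add: J_pos less_imp_le)
  qed
  define R where "R = exp (6 * ((1 + real (2 * q)) * 4 ^ (2 * q) + 1) * B * T) * (M\<^sup>2 * Z2)"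
  have "cmod (c t k) * J k ^ q \<le> sqrt R" if t: "t \<in> {0..T}" for t k
  proof -
    \<comment> \<open>The truncation height is chosen as J k, so at the frequency k itself the
      weight is the full power J k ^ (2 q). The bound \<open>R\<close> does not depend on k, so
      testing the single frequency k is enough.\<close>
    let ?\<omega> = "cutoff (J k) (real (2 * q))"
    have N: "1 \<le> J k" by (rule J_ge_1)
    have \<omega>le: "?\<omega> j \<le> J j ^ (2 * q)" for j
      using cutoff_le_J[OF N, of "real (2 * q)" j] powr_realpow[OF J_pos, of j "2 * q"] by (simp only: of_nat_0_le_iff)
    have ode: "((\<lambda>s. c s j) has_vector_derivative
        (- 3 * \<i> * of_int j * (conv (c s) (c s) j + 2 * conv (\<lambda>_. 0) (c s) j)
          + \<i> * of_real (\<beta> * \<theta> j) * c s j + \<i> * of_real (0 * \<theta> j) * 0)) (at s within {0..T})" if "s \<in> {0..T}" for s j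
      using fsolD(4)[OF sol that, of j] by (simp add: rhs_def)
    have "(\<Sum>j\<in>{k}. ?\<omega> j * (cmod (c t j))\<^sup>2)
      \<le> exp ((6 * ((1 + real (2 * q)) * 4 ^ (2 * q) + 1) * B + 12 * (1 + real (2 * q)) * 0 + \<bar>0\<bar>) * T)
          * ((\<Sum>\<^sub>\<infinity>j. ?\<omega> j * (cmod (c 0 j))\<^sup>2) + T * (\<bar>0\<bar> * 0))"
      by (rule weighted_energy_estimate[where d = "\<lambda>_ _. 0" and \<beta> = \<beta> and \<theta> = \<theta> and \<eta> = 0,
            OF weight_cutoff[OF N, of "real (2 * q)" "2 * q"] cutoff_le[OF N] fsolD(1)[OF sol] fsolD(2)[OF sol] B fsolD(3)[OF sol] _ _ _ _ ode t])
         auto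
    also have "\<dots> = exp (6 * ((1 + real (2 * q)) * 4 ^ (2 * q) + 1) * B * T) * (\<Sum>\<^sub>\<infinity>j. ?\<omega> j * (cmod (c 0 j))\<^sup>2)" by simp
    also have "\<dots> \<le> R" unfolding R_def
    proof (rule mult_left_mono)
      have le: "?\<omega> j * (cmod (c 0 j))\<^sup>2 \<le> J j ^ (2 * q) * (cmod (c 0 j))\<^sup>2" for j
        by (intro mult_right_mono \<omega>le) simp
      have "(\<lambda>j. ?\<omega> j * (cmod (c 0 j))\<^sup>2) summable_on UNIV"
        by (rule summable_on_comparison_test[OF sum0(1) le]) (simp add: cutoff_nonneg)
      thus "(\<Sum>\<^sub>\<infinity>j. ?\<omega> j * (cmod (c 0 j))\<^sup>2) \<le> M\<^sup>2 * Z2"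
        using infsum_mono[OF _ sum0(1) le] sum0(2) by linarith
    qed simp
    finally have "?\<omega> k * (cmod (c t k))\<^sup>2 \<le> R" by simp
    moreover have "?\<omega> k = (J k ^ q)\<^sup>2"
      using powr_realpow[OF J_pos, of k "2 * q"] by (simp only: cutoff_eq[OF order_refl] power_mult[symmetric] mult.commute[of q 2])
    ultimately have "(cmod (c t k) * J k ^ q)\<^sup>2 \<le> R" by (simp add: power_mult_distrib mult.commute)
    thus ?thesis by (rule real_le_rsqrt)
  qed
  thus ?thesis by blast
qed

section \<open>Convolution on the Wiener class\<close>

lemma conv_term_summable:
  assumes "wiener x" "wiener y"
  shows "(\<lambda>a. x a * y (k - a)) summable_on UNIV"
proof -
  have "(\<lambda>a. norm (x a * y (k - a))) summable_on UNIV"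
  proof (rule Infinite_Sum.abs_summable_on_comparison_test'[OF summable_on_cmult_left[OF summable_of_J(1)[OF assms(1)]]])
    show "norm (x a * y (k - a)) \<le> cmod (x a) * wnorm y" for a
      unfolding norm_mult by (intro mult_left_mono summable_of_J(2)[OF assms(2)]) simp
  qed
  thus ?thesis by (rule abs_summable_summable)
qed

lemma conv_commute: "conv x y k = conv y x k"
  unfolding conv_def
  by (rule infsum_reindex_bij_witness[where i = "\<lambda>a. k - a" and j = "\<lambda>a. k - a"]) (auto simp: mult.commute)

lemma conv_square_diff:
  assumes x: "wiener x" and y: "wiener y"
  shows "conv x x k - conv y y k = conv (\<lambda>k. x k - y k) (\<lambda>k. x k - y k) k + 2 * conv y (\<lambda>k. x k - y k) k"
proof -
  define w where "w = (\<lambda>k. x k - y k)"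
  have w: "wiener w" unfolding w_def by (rule summable_J_diff(1)[OF x y])
  note s = conv_term_summable[OF w w, of k] conv_term_summable[OF w y, of k] conv_term_summable[OF y w, of k] conv_term_summable[OF y y, of k]
  have "conv x x k = (\<Sum>\<^sub>\<infinity>a. (w a * w (k - a) + w a * y (k - a)) + (y a * w (k - a) + y a * y (k - a)))"
    unfolding conv_def w_def by (rule infsum_cong) (simp add: algebra_simps)
  also have "\<dots> = (conv w w k + conv w y k) + (conv y w k + conv y y k)"
    unfolding conv_def by (simp only: infsum_add summable_on_add s)
  finally show ?thesis using conv_commute[of w y k] by (simp add: w_def)
qed

lemma summable_square:
  fixes y :: "int \<Rightarrow> real"
  assumes y: "y summable_on UNIV" "\<And>k. 0 \<le> y k"
  shows "(\<lambda>k. (y k)\<^sup>2) summable_on UNIV" "(\<Sum>\<^sub>\<infinity>k. (y k)\<^sup>2) \<le> (infsum y UNIV)\<^sup>2"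
proof -
  have le: "(y k)\<^sup>2 \<le> infsum y UNIV * y k" for k
    using finite_sum_le_infsum[OF y(1), of "{k}"] y(2) by (auto simp: power2_eq_square intro!: mult_right_mono)
  have s: "(\<lambda>k. infsum y UNIV * y k) summable_on UNIV" by (rule summable_on_cmult_right[OF y(1)])
  show 1: "(\<lambda>k. (y k)\<^sup>2) summable_on UNIV" by (rule summable_on_comparison_test[OF s le]) simp
  show "(\<Sum>\<^sub>\<infinity>k. (y k)\<^sup>2) \<le> (infsum y UNIV)\<^sup>2"
    using infsum_mono[OF 1 s le] by (simp only: infsum_cmult_right' power2_eq_square)
qed

text \<open>The Wiener class is an algebra because J is submultiplicative: J k is distributed over
  the two factors, and the resulting double sum is a product.\<close>

lemma conv_wiener:
  assumes x: "wiener x" and y: "wiener y"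
  shows "wiener (conv x y)"
    "wnorm (conv x y) \<le> wnorm x * wnorm y"
proof -
  define g where "g = (\<lambda>(a, b). (J a * cmod (x a)) * (J b * cmod (y b)))"
  define h where "h = (\<lambda>(k, a). (J a * cmod (x a)) * (J (k - a) * cmod (y (k - a))))"
  have g: "g summable_on UNIV" "infsum g UNIV = wnorm x * wnorm y"
    unfolding g_def using summable_on_prod[OF x _ y] by (simp_all add: J_pos less_imp_le)
  have bij: "bij_betw (\<lambda>p. case p of (k, a) \<Rightarrow> (a, k - a)) (UNIV :: (int \<times> int) set) UNIV"
    by (rule bij_betwI[where g = "\<lambda>(a, b). (a + b, a)"]) auto
  have hg: "h = (\<lambda>p. g (case p of (k, a) \<Rightarrow> (a, k - a)))" by (simp add: h_def g_def fun_eq_iff)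
  have h: "h summable_on UNIV" "infsum h UNIV = infsum g UNIV"
    using summable_on_reindex_bij_betw[OF bij, of g] infsum_reindex_bij_betw[OF bij, of g] g by (simp_all add: hg)
  have h1: "(\<lambda>k. \<Sum>\<^sub>\<infinity>a. h (k, a)) summable_on UNIV" "(\<Sum>\<^sub>\<infinity>k. \<Sum>\<^sub>\<infinity>a. h (k, a)) = infsum h UNIV"
    using summable_on_Sigma_banach[of "\<lambda>k a. h (k, a)" UNIV "\<lambda>_. UNIV"] infsum_Sigma_banach[of h UNIV "\<lambda>_. UNIV"] h by simp_all
  have le: "J k * cmod (conv x y k) \<le> (\<Sum>\<^sub>\<infinity>a. h (k, a))" for k
  proof -
    have hk: "(\<lambda>a. h (k, a)) summable_on UNIV"
      using summable_on_SigmaD1[of "\<lambda>k a. h (k, a)" UNIV "\<lambda>_. UNIV" k] h by simp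
    have "J k * cmod (conv x y k) = cmod (\<Sum>\<^sub>\<infinity>a. of_real (J k) * (x a * y (k - a)))"
      unfolding conv_def infsum_cmult_right' using J_pos[of k] by (simp add: norm_mult)
    also have "\<dots> \<le> (\<Sum>\<^sub>\<infinity>a. h (k, a))"
    proof (rule norm_infsum_le_infsum[OF hk])
      fix a
      have "J k \<le> J a * J (k - a)" using J_add_le_mult[of a "k - a"] by simp
      hence "J k * (cmod (x a) * cmod (y (k - a))) \<le> (J a * J (k - a)) * (cmod (x a) * cmod (y (k - a)))"
        by (rule mult_right_mono) simp
      thus "norm (of_real (J k) * (x a * y (k - a))) \<le> h (k, a)"
        using J_pos[of k] by (simp add: h_def norm_mult mult_ac)
    qed
    finally show ?thesis .
  qed
  show 1: "wiener (conv x y)"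
    by (rule summable_on_comparison_test[OF h1(1) le]) (simp add: J_pos less_imp_le)
  show "wnorm (conv x y) \<le> wnorm x * wnorm y"
    using infsum_mono[OF 1 h1(1) le] h1(2) h(2) g(2) by linarith
qed

lemma nonneg_summable_bound:
  fixes f :: "int \<Rightarrow> real"
  assumes "\<And>k. 0 \<le> f k" "\<And>K. finite K \<Longrightarrow> sum f K \<le> C"
  shows "f summable_on UNIV" "infsum f UNIV \<le> C"
proof -
  show 1: "f summable_on UNIV"
    by (rule nonneg_bdd_above_summable_on) (auto intro!: bdd_aboveI2[where M = C] assms)
  show "infsum f UNIV \<le> C" by (rule infsum_le_finite_sums[OF 1 assms(2)])
qed

text \<open>The initial difference vanishes and the forcing is of order r^2, so the energy is of
  order r^2 and the Wiener norm of order r; for r < \<open>r0\<close> the latter stays below 1, the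
  level under which the energy estimate is run. \<open>G\<close> and \<open>r0\<close> do not depend
  on \<open>c\<close> or on time, which is the source of uniformity. The last two conclusions will
  control the time derivatives through the equation. In the application p = 2 (1 + \<alpha>), hence
  the range from 4 to 6.\<close>

lemma fsol_stability:
  fixes d :: "real \<Rightarrow> int \<Rightarrow> complex"
  assumes d: "fsol \<beta>0 \<theta> T d" and T: "0 \<le> T" and p: "4 \<le> p" "p \<le> 6"
    and \<theta>: "\<And>k. \<bar>\<theta> k\<bar> \<le> J k powr (p / 2)"
    and decay: "\<And>q. \<exists>M. \<forall>t\<in>{0..T}. \<forall>k. cmod (d t k) * J k ^ q \<le> M"
  obtains G r0 where "0 < r0"
    "\<And>r \<beta> c t. \<lbrakk>0 < r; r < r0; \<bar>\<beta> - \<beta>0\<bar> \<le> r\<^sup>2; fsol \<beta> \<theta> T c; \<And>k. c 0 k = d 0 k; t \<in> {0..T}\<rbrakk> \<Longrightarrow>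
       (\<lambda>k. J k powr p * (cmod (c t k - d t k))\<^sup>2) summable_on UNIV \<and>
       (\<Sum>\<^sub>\<infinity>k. J k powr p * (cmod (c t k - d t k))\<^sup>2) \<le> G * r \<and>
       (\<lambda>k. (cmod (rhs \<beta> \<theta> (c t) k - rhs \<beta>0 \<theta> (d t) k))\<^sup>2) summable_on UNIV \<and>
       (\<Sum>\<^sub>\<infinity>k. (cmod (rhs \<beta> \<theta> (c t) k - rhs \<beta>0 \<theta> (d t) k))\<^sup>2) \<le> G * r"
proof -
  \<comment> \<open>Weights of degree P = 6 put 2 P + 1 = 13 powers of J on the reference, and two
    more make the sum converge.\<close>
  obtain M where M: "\<And>t k. t \<in> {0..T} \<Longrightarrow> cmod (d t k) * J k ^ 15 \<le> M" using decay by blast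
  have Mn: "0 \<le> M" using M[of 0 0] T by (meson J_pos atLeastAtMost_iff less_imp_le mult_nonneg_nonneg norm_ge_zero order_trans zero_le_power order_refl)
  have dJ: "cmod (d t k) * J k ^ q \<le> M" if "t \<in> {0..T}" "q \<le> 15" for t k q
  proof -
    have "cmod (d t k) * J k ^ q \<le> cmod (d t k) * J k ^ 15"
      by (intro mult_left_mono power_increasing that J_ge_1) simp
    thus ?thesis using M[OF that(1), of k] by linarith
  qed
  have Jp: "J k powr p \<le> J k ^ 6" for k
    using powr_mono[OF p(2) J_ge_1[of k]] powr_realpow[OF J_pos, of k 6] by simp
  have \<theta>2: "(\<theta> k)\<^sup>2 \<le> J k powr p" for k
  proof -
    have "\<bar>\<theta> k\<bar>\<^sup>2 \<le> (J k powr (p / 2))\<^sup>2" by (intro power_mono \<theta>) simp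
    also have "\<dots> = J k powr p" by (simp add: power2_eq_square powr_add[symmetric])
    finally show ?thesis by simp
  qed
  define A where "A = M * Z2"
  define D where "D = M\<^sup>2 * Z2"
  have An: "0 \<le> A" and Dn: "0 \<le> D" using Mn Z2_nonneg by (simp_all add: A_def D_def)
  have dA: "(\<lambda>k. J k ^ 13 * cmod (d t k)) summable_on UNIV" "(\<Sum>\<^sub>\<infinity>k. J k ^ 13 * cmod (d t k)) \<le> A" if t: "t \<in> {0..T}" for t
  proof -
    have "J k ^ 13 * cmod (d t k) * (J k)\<^sup>2 \<le> M" for k
    proof -
      have "J k ^ 13 * cmod (d t k) * (J k)\<^sup>2 = cmod (d t k) * J k ^ (13 + 2)" unfolding power_add by simp
      also have "\<dots> \<le> M" using dJ[OF t, of 15 k] by simp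
      finally show ?thesis .
    qed
    from summable_J_decay[OF _ this] show "(\<lambda>k. J k ^ 13 * cmod (d t k)) summable_on UNIV" "(\<Sum>\<^sub>\<infinity>k. J k ^ 13 * cmod (d t k)) \<le> A"
      by (simp_all add: J_pos less_imp_le A_def)
  qed
  have dA1: "wnorm (d t) \<le> A" if t: "t \<in> {0..T}" for t
  proof -
    have "J k * cmod (d t k) \<le> J k ^ 13 * cmod (d t k)" for k
      using power_increasing[of 1 13 "J k"] J_ge_1[of k] by (intro mult_right_mono) auto
    from infsum_mono[OF fsolD(2)[OF d t] dA(1)[OF t] this] dA(2)[OF t] show ?thesis by linarith
  qed
  have dD: "(\<lambda>k. \<omega> k * (\<theta> k * cmod (d t k))\<^sup>2) summable_on UNIV" "(\<Sum>\<^sub>\<infinity>k. \<omega> k * (\<theta> k * cmod (d t k))\<^sup>2) \<le> D"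
    if t: "t \<in> {0..T}" and \<omega>: "\<And>k. 0 \<le> \<omega> k" "\<And>k. \<omega> k \<le> J k powr p" for t \<omega>
  proof -
    have "\<omega> k * (\<theta> k * cmod (d t k))\<^sup>2 * (J k)\<^sup>2 \<le> M\<^sup>2" for k
    proof -
      have "\<omega> k * (\<theta> k * cmod (d t k))\<^sup>2 * (J k)\<^sup>2 = \<omega> k * (\<theta> k)\<^sup>2 * ((cmod (d t k))\<^sup>2 * (J k)\<^sup>2)"
        by (simp add: power_mult_distrib)
      also have "\<dots> \<le> J k ^ 6 * J k ^ 6 * ((cmod (d t k))\<^sup>2 * (J k)\<^sup>2)"
        using order_trans[OF \<omega>(2) Jp] order_trans[OF \<theta>2 Jp] J_pos[of k] by (intro mult_right_mono mult_mono) (auto simp: less_imp_le)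
      also have "\<dots> = (cmod (d t k) * J k ^ 7)\<^sup>2"
        unfolding power_mult_distrib power_mult[symmetric] by (simp add: power_add[symmetric])
      also have "\<dots> \<le> M\<^sup>2" by (intro power_mono dJ t) (simp_all add: J_pos less_imp_le)
      finally show ?thesis .
    qed
    from summable_J_decay[OF _ this] show "(\<lambda>k. \<omega> k * (\<theta> k * cmod (d t k))\<^sup>2) summable_on UNIV"
      "(\<Sum>\<^sub>\<infinity>k. \<omega> k * (\<theta> k * cmod (d t k))\<^sup>2) \<le> D" by (simp_all add: \<omega> D_def)
  qed
  \<comment> \<open>Growth rate for a Wiener norm of \<open>w\<close> up to 1 and |\<eta>| up to 1.
    \<open>R\<close> then bounds the energy divided by r^2, and \<open>Cb\<close> bounds the Wiener
    norm divided by r.\<close>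
  define L1 where "L1 = 6 * ((1 + real 6) * 4 ^ 6 + 1) * 1 + 12 * (1 + real 6) * A + 1"
  define R where "R = exp (L1 * T) * (T * D)"
  define Cb where "Cb = (Z2 + R) / 2"
  define Y where "Y = 3 * Cb\<^sup>2 + 6 * A * Cb"
  \<comment> \<open>Chosen so that \<open>Cb * r < 1\<close> for r < \<open>r0\<close>, which closes
    the continuity argument; it also gives r \<le> 1 and hence r^2 \<le> r.\<close>
  define r0 where "r0 = 1 / (Cb + 1)"
  define G where "G = R + 3 * (Y\<^sup>2 + (\<bar>\<beta>0\<bar> + 1)\<^sup>2 * R + D)"
  have Rn: "0 \<le> R" using T Dn by (simp add: R_def)
  have Cbn: "0 \<le> Cb" using Rn Z2_nonneg by (simp add: Cb_def)
  have Yn: "0 \<le> Y" using Cbn An by (simp add: Y_def)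
  have r0: "0 < r0" "r0 \<le> 1" using Cbn by (auto simp: r0_def)
  show ?thesis
  proof (rule that[OF r0(1), of G])
    fix r \<beta> c t0
    assume r: "0 < r" "r < r0" and \<beta>: "\<bar>\<beta> - \<beta>0\<bar> \<le> r\<^sup>2" and c: "fsol \<beta> \<theta> T c"
      and init: "\<And>k. c 0 k = d 0 k" and t0: "t0 \<in> {0..T}"
    have r1: "r < 1" using r r0 by linarith
    have r2: "r\<^sup>2 \<le> r" using r r1 by (simp add: power2_eq_square)
    have Cbr: "Cb * r < 1"
    proof -
      have "Cb * r \<le> (Cb + 1) * r" using r by (simp add: algebra_simps)
      also have "\<dots> < (Cb + 1) * r0" using r Cbn by (intro mult_strict_left_mono) auto
      finally show ?thesis using Cbn by (simp add: r0_def)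
    qed
    define \<eta> where "\<eta> = \<beta> - \<beta>0"
    have \<eta>: "\<bar>\<eta>\<bar> \<le> r\<^sup>2" "\<bar>\<eta>\<bar> \<le> 1" using \<beta> r2 r1 by (auto simp: \<eta>_def)
    define w where "w = (\<lambda>t k. c t k - d t k)"
    define b where "b = (\<lambda>t. wnorm (w t))"
    have ws: "wiener (w t)" if "t \<in> {0..T}" for t
      unfolding w_def by (rule summable_J_diff(1)[OF fsolD(2)[OF c that] fsolD(2)[OF d that]])
    have wcont: "((\<lambda>s. wdist (w s) (w t)) \<longlongrightarrow> 0) (at t within {0..T})" if t: "t \<in> {0..T}" for t
    proof (rule Lim_null_comparison)
      show "((\<lambda>s. wdist (c s) (c t) + wdist (d s) (d t)) \<longlongrightarrow> 0) (at t within {0..T})"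
        using tendsto_add[OF fsolD(3)[OF c t] fsolD(3)[OF d t]] by simp
      have "norm (wdist (w s) (w t)) \<le> wdist (c s) (c t) + wdist (d s) (d t)" if s: "s \<in> {0..T}" for s
      proof -
        have "0 \<le> wdist (w s) (w t)" by (intro infsum_nonneg) (simp add: J_pos less_imp_le)
        hence "norm (wdist (w s) (w t)) = wnorm (\<lambda>k. (c s k - c t k) - (d s k - d t k))"
          by (simp add: w_def algebra_simps)
        thus ?thesis
          using summable_J_diff(2)[OF summable_J_diff(1)[OF fsolD(2)[OF c s] fsolD(2)[OF c t]] summable_J_diff(1)[OF fsolD(2)[OF d s] fsolD(2)[OF d t]]]
          by simp
      qed
      thus "\<forall>\<^sub>F s in at t within {0..T}. norm (wdist (w s) (w t)) \<le> wdist (c s) (c t) + wdist (d s) (d t)"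
        unfolding eventually_at_filter by (intro always_eventually) auto
    qed
    \<comment> \<open>The difference of the dispersive terms is split as \<beta> \<theta> w + \<eta>
      \<theta> d: the first part is skew, and the unbounded symbol in the second acts on the
      decaying reference.\<close>
    have rdiff: "rhs \<beta> \<theta> (c t) k - rhs \<beta>0 \<theta> (d t) k = - 3 * \<i> * of_int k * (conv (w t) (w t) k + 2 * conv (d t) (w t) k)
          + \<i> * of_real (\<beta> * \<theta> k) * w t k + \<i> * of_real (\<eta> * \<theta> k) * d t k" if t: "t \<in> {0..T}" for t k
    proof -
      have "rhs \<beta> \<theta> (c t) k - rhs \<beta>0 \<theta> (d t) k = - 3 * \<i> * of_int k * (conv (c t) (c t) k - conv (d t) (d t) k)
          + \<i> * of_real (\<beta> * \<theta> k) * w t k + \<i> * of_real (\<eta> * \<theta> k) * d t k"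
        by (simp add: rhs_def w_def \<eta>_def algebra_simps)
      thus ?thesis unfolding conv_square_diff[OF fsolD(2)[OF c t] fsolD(2)[OF d t]] w_def .
    qed
    have ode: "((\<lambda>s. w s k) has_vector_derivative (- 3 * \<i> * of_int k * (conv (w t) (w t) k + 2 * conv (d t) (w t) k)
          + \<i> * of_real (\<beta> * \<theta> k) * w t k + \<i> * of_real (\<eta> * \<theta> k) * d t k)) (at t within {0..T})" if t: "t \<in> {0..T}" for t k
      using has_vector_derivative_diff[OF fsolD(4)[OF c t, of k] fsolD(4)[OF d t, of k]] unfolding rdiff[OF t] by (simp only: w_def)
    \<comment> \<open>Conditional on the Wiener norm of \<open>w\<close> staying at most 1 up to
      \<tau>; the condition is removed below.\<close>
    have energy: "(\<Sum>k\<in>K. J k powr p * (cmod (w t k))\<^sup>2) \<le> R * r\<^sup>2"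
      if \<tau>: "\<tau> \<in> {0..T}" and b1: "\<And>s. s \<in> {0..\<tau>} \<Longrightarrow> b s \<le> 1" and t: "t \<in> {0..\<tau>}" and K: "finite K" for \<tau> t K
    proof -
      have sub: "s \<in> {0..T}" if "s \<in> {0..\<tau>}" for s using that \<tau> by auto
      have sub': "{0..\<tau>} \<subseteq> {0..T}" using sub by blast
      \<comment> \<open>High enough that the truncated weight equals the full power on all of
        \<open>K\<close>.\<close>
      define N where "N = 1 + (\<Sum>k\<in>K. J k)"
      have N: "1 \<le> N" unfolding N_def by (simp add: sum_nonneg J_pos less_imp_le)
      have NK: "J k \<le> N" if "k \<in> K" for k
        using member_le_sum[OF that, of J] K by (auto simp: N_def J_pos less_imp_le)
      have "(\<Sum>k\<in>K. cutoff N p k * (cmod (w t k))\<^sup>2)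
        \<le> exp ((6 * ((1 + real 6) * 4 ^ 6 + 1) * 1 + 12 * (1 + real 6) * A + \<bar>\<eta>\<bar>) * \<tau>)
          * ((\<Sum>\<^sub>\<infinity>k. cutoff N p k * (cmod (w 0 k))\<^sup>2) + \<tau> * (\<bar>\<eta>\<bar> * D))"
      proof (rule weighted_energy_estimate[where W = "N powr p" and d = d and \<theta> = \<theta> and \<beta> = \<beta>])
        show "weight 6 (cutoff N p)" by (rule weight_cutoff) (use N p in auto)
        show "cutoff N p k \<le> N powr p" for k using cutoff_le[OF N] p by simp
        show "w s (- k) = cnj (w s k)" if "s \<in> {0..\<tau>}" for s k
          using fsolD(1)[OF c sub[OF that]] fsolD(1)[OF d sub[OF that]] by (simp add: w_def)
        show "wiener (w s)" if "s \<in> {0..\<tau>}" for s by (rule ws[OF sub[OF that]])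
        show "wnorm (w s) \<le> 1" if "s \<in> {0..\<tau>}" for s using b1[OF that] by (simp add: b_def)
        show "((\<lambda>s'. wdist (w s') (w s)) \<longlongrightarrow> 0) (at s within {0..\<tau>})" if "s \<in> {0..\<tau>}" for s
          by (rule tendsto_within_subset[OF wcont[OF sub[OF that]] sub'])
        show "(\<lambda>k. J k ^ (2 * 6 + 1) * cmod (d s k)) summable_on UNIV" if "s \<in> {0..\<tau>}" for s using dA(1)[OF sub[OF that]] by simp
        show "(\<Sum>\<^sub>\<infinity>k. J k ^ (2 * 6 + 1) * cmod (d s k)) \<le> A" if "s \<in> {0..\<tau>}" for s using dA(2)[OF sub[OF that]] by simp
        have cp: "cutoff N p k \<le> J k powr p" for k using cutoff_le_J[OF N] p by simp
        show "(\<lambda>k. cutoff N p k * (\<theta> k * cmod (d s k))\<^sup>2) summable_on UNIV" if "s \<in> {0..\<tau>}" for s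
          by (rule dD(1)[OF sub[OF that] cutoff_nonneg cp])
        show "(\<Sum>\<^sub>\<infinity>k. cutoff N p k * (\<theta> k * cmod (d s k))\<^sup>2) \<le> D" if "s \<in> {0..\<tau>}" for s
          by (rule dD(2)[OF sub[OF that] cutoff_nonneg cp])
        show "((\<lambda>s. w s k) has_vector_derivative (- 3 * \<i> * of_int k * (conv (w s) (w s) k + 2 * conv (d s) (w s) k)
          + \<i> * of_real (\<beta> * \<theta> k) * w s k + \<i> * of_real (\<eta> * \<theta> k) * d s k)) (at s within {0..\<tau>})" if "s \<in> {0..\<tau>}" for s k
          by (rule has_vector_derivative_within_subset[OF ode[OF sub[OF that]] sub'])
      qed (use t K in auto)
      also have "\<dots> = exp ((6 * ((1 + real 6) * 4 ^ 6 + 1) * 1 + 12 * (1 + real 6) * A + \<bar>\<eta>\<bar>) * \<tau>) * (\<tau> * (\<bar>\<eta>\<bar> * D))"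
        by (simp add: w_def init)
      also have "\<dots> \<le> exp (L1 * T) * (T * (r\<^sup>2 * D))"
        using \<tau> \<eta> Dn T An unfolding L1_def by (intro mult_mono exp_le_cancel_iff[THEN iffD2] add_mono) auto
      also have "\<dots> = R * r\<^sup>2" by (simp add: R_def)
      finally have "(\<Sum>k\<in>K. cutoff N p k * (cmod (w t k))\<^sup>2) \<le> R * r\<^sup>2" .
      thus ?thesis using NK by (simp add: cutoff_eq cong: sum.cong)
    qed
    have bsmall: "b t \<le> Cb * r"
      if t: "t \<in> {0..T}" and e: "\<And>K. finite K \<Longrightarrow> (\<Sum>k\<in>K. J k powr p * (cmod (w t k))\<^sup>2) \<le> R * r\<^sup>2" for t
      unfolding b_def
    proof (rule infsum_le_finite_sums[OF ws[OF t]])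
      fix K :: "int set" assume K: "finite K"
      \<comment> \<open>Write J |w| as the product of 1 / J and J^2 |w| and balance the two squares
        with the parameter r; p \<ge> 4 lets the energy absorb J^4 |w|^2. With energy at most R r^2
        both parts are of order r.\<close>
      have "J k * cmod (w t k) \<le> (r / 2) * (1 / (J k)\<^sup>2) + (1 / (2 * r)) * (J k powr p * (cmod (w t k))\<^sup>2)" for k
      proof -
        have J4: "J k ^ 4 \<le> J k powr p"
          using powr_mono[OF p(1) J_ge_1[of k]] powr_realpow[OF J_pos, of k 4] by simp
        have "2 * (r / J k) * ((J k)\<^sup>2 * cmod (w t k)) \<le> (r / J k)\<^sup>2 + ((J k)\<^sup>2 * cmod (w t k))\<^sup>2"
          by (rule sum_squares_bound)
        also have "((J k)\<^sup>2 * cmod (w t k))\<^sup>2 = J k ^ 4 * (cmod (w t k))\<^sup>2"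
          by (simp add: power_mult_distrib flip: power_mult)
        also have "\<dots> \<le> J k powr p * (cmod (w t k))\<^sup>2" by (intro mult_right_mono J4) simp
        finally have "2 * (r / J k) * ((J k)\<^sup>2 * cmod (w t k)) \<le> (r / J k)\<^sup>2 + J k powr p * (cmod (w t k))\<^sup>2" by simp
        hence "(1 / (2 * r)) * (2 * (r / J k) * ((J k)\<^sup>2 * cmod (w t k))) \<le> (1 / (2 * r)) * ((r / J k)\<^sup>2 + J k powr p * (cmod (w t k))\<^sup>2)"
          using r by (intro mult_left_mono) auto
        moreover have "(1 / (2 * r)) * (2 * (r / J k) * ((J k)\<^sup>2 * cmod (w t k))) = J k * cmod (w t k)"
          using r J_pos[of k] by (simp add: field_simps power2_eq_square)
        moreover have "(1 / (2 * r)) * (r / J k)\<^sup>2 = (r / 2) * (1 / (J k)\<^sup>2)"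
          using r J_pos[of k] by (simp add: field_simps power2_eq_square)
        ultimately show ?thesis by (simp only: distrib_left)
      qed
      hence "(\<Sum>k\<in>K. J k * cmod (w t k)) \<le> (\<Sum>k\<in>K. (r / 2) * (1 / (J k)\<^sup>2) + (1 / (2 * r)) * (J k powr p * (cmod (w t k))\<^sup>2))"
        by (rule sum_mono)
      also have "\<dots> = (r / 2) * (\<Sum>k\<in>K. 1 / (J k)\<^sup>2) + (1 / (2 * r)) * (\<Sum>k\<in>K. J k powr p * (cmod (w t k))\<^sup>2)"
        by (simp only: sum.distrib sum_distrib_left)
      also have "\<dots> \<le> (r / 2) * Z2 + (1 / (2 * r)) * (R * r\<^sup>2)"
        using finite_sum_le_infsum[OF summable_inverse_J_square K] r e[OF K]
        by (intro add_mono mult_left_mono) (auto simp: Z2_def)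
      also have "\<dots> = Cb * r" using r by (simp add: Cb_def field_simps power2_eq_square)
      finally show "(\<Sum>k\<in>K. J k * cmod (w t k)) \<le> Cb * r" .
    qed
    have bcont: "continuous_on {0..T} b" unfolding b_def by (rule continuous_on_wiener_norm[OF ws wcont])
    have b0: "b 0 = 0" by (simp add: b_def w_def init)
    have b1: "b t < 1" if t: "t \<in> {0..T}" for t
    proof (rule ccontr)
      assume "\<not> b t < 1"
      \<comment> \<open>Continuity argument: at the first time \<tau> in \<open>S\<close> the
        intermediate value theorem forces b \<tau> = 1, yet the energy estimate on the interval from
        0 to \<tau> gives b \<tau> \<le> Cb r < 1.\<close>
      define S where "S = {s \<in> {0..T}. 1 \<le> b s}"
      have "S = {0..T} \<inter> b -` {1..}" by (auto simp: S_def)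
      hence "closed S" using continuous_closed_preimage[OF bcont, of "{1..}"] by simp
      moreover have "bounded S" by (rule bounded_subset[OF bounded_closed_interval[of 0 T]]) (auto simp: S_def)
      ultimately have "compact S" by (simp add: compact_eq_bounded_closed)
      moreover have "S \<noteq> {}" using t \<open>\<not> b t < 1\<close> by (auto simp: S_def)
      ultimately have "\<exists>\<tau>\<in>S. \<forall>s\<in>S. \<tau> \<le> s" by (rule compact_attains_inf)
      then obtain \<tau> where \<tau>: "\<tau> \<in> S" "\<And>s. s \<in> S \<Longrightarrow> \<tau> \<le> s" by auto
      have \<tau>T: "\<tau> \<in> {0..T}" "1 \<le> b \<tau>" using \<tau>(1) by (auto simp: S_def)
      have "\<exists>x\<ge>0. x \<le> \<tau> \<and> b x = 1"
        by (rule IVT') (use \<tau>T b0 continuous_on_subset[OF bcont, of "{0..\<tau>}"] in auto)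
      then obtain x where x: "0 \<le> x" "x \<le> \<tau>" "b x = 1" by blast
      hence "x \<in> S" using \<tau>T by (auto simp: S_def)
      hence b\<tau>: "b \<tau> = 1" using \<tau>(2)[of x] x by force
      have "b s \<le> 1" if "s \<in> {0..\<tau>}" for s
      proof (rule ccontr)
        assume "\<not> b s \<le> 1"
        hence "s \<in> S" using that \<tau>T by (auto simp: S_def)
        hence "s = \<tau>" using \<tau>(2)[of s] that by auto
        thus False using b\<tau> \<open>\<not> b s \<le> 1\<close> by simp
      qed
      hence "b \<tau> \<le> Cb * r" by (intro bsmall energy[OF \<tau>T(1)]) (use \<tau>T in auto)
      thus False using b\<tau> Cbr by simp
    qed
    have en: "(\<Sum>k\<in>K. J k powr p * (cmod (w t0 k))\<^sup>2) \<le> R * r\<^sup>2" if "finite K" for K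
      by (rule energy[of T]) (use b1 t0 T that less_imp_le in auto)
    have Es: "(\<lambda>k. J k powr p * (cmod (w t0 k))\<^sup>2) summable_on UNIV" and El: "(\<Sum>\<^sub>\<infinity>k. J k powr p * (cmod (w t0 k))\<^sup>2) \<le> R * r\<^sup>2"
      using nonneg_summable_bound[OF _ en] by simp_all
    have Er: "R * r\<^sup>2 \<le> R * r" by (intro mult_left_mono r2 Rn)
    have bt: "b t0 \<le> Cb * r" by (rule bsmall[OF t0 en])
    have bn: "0 \<le> b t0" unfolding b_def by (intro infsum_nonneg) (simp add: J_pos less_imp_le)
    \<comment> \<open>Majorant of the nonlinear part of the difference of the right-hand sides. The
      algebra property makes it summable with sum at most Y r, hence square summable.\<close>
    define y where "y = (\<lambda>k. 3 * (J k * cmod (conv (w t0) (w t0) k)) + 6 * (J k * cmod (conv (d t0) (w t0) k)))"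
    note c1 = conv_wiener[OF ws[OF t0] ws[OF t0]] and c2 = conv_wiener[OF fsolD(2)[OF d t0] ws[OF t0]]
    have ys: "y summable_on UNIV" unfolding y_def by (intro summable_on_add summable_on_cmult_right c1 c2)
    have yn: "0 \<le> y k" for k by (simp add: y_def J_pos less_imp_le)
    have "infsum y UNIV = 3 * wnorm (conv (w t0) (w t0)) + 6 * wnorm (conv (d t0) (w t0))"
      unfolding y_def by (simp only: infsum_add summable_on_cmult_right c1 c2 infsum_cmult_right')
    also have "\<dots> \<le> 3 * (b t0 * b t0) + 6 * (A * b t0)"
      using c1(2) c2(2) mult_right_mono[OF dA1[OF t0] bn] unfolding b_def by (intro add_mono mult_left_mono) auto
    also have "\<dots> \<le> 3 * ((Cb * r) * (Cb * r)) + 6 * (A * (Cb * r))"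
      using bt bn An by (intro add_mono mult_left_mono mult_mono) auto
    also have "\<dots> = 3 * Cb\<^sup>2 * r\<^sup>2 + 6 * A * Cb * r" by (simp add: power2_eq_square)
    also have "\<dots> \<le> 3 * Cb\<^sup>2 * r + 6 * A * Cb * r" by (intro add_right_mono mult_left_mono r2) simp
    also have "\<dots> = Y * r" by (simp add: Y_def distrib_right)
    finally have "(infsum y UNIV)\<^sup>2 \<le> (Y * r)\<^sup>2" by (intro power_mono infsum_nonneg yn)
    also have "\<dots> \<le> Y\<^sup>2 * r" unfolding power_mult_distrib by (intro mult_left_mono r2) simp
    finally have y2: "(\<lambda>k. (y k)\<^sup>2) summable_on UNIV" "(\<Sum>\<^sub>\<infinity>k. (y k)\<^sup>2) \<le> Y\<^sup>2 * r"
      using summable_square[OF ys yn] by simp_all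
    note D1 = dD[OF t0, of "\<lambda>_. 1", simplified]
    have one: "1 \<le> J k powr p" for k using powr_mono[of 0 p "J k"] J_ge_1[of k] p J_pos[of k] by simp
    have z2: "(\<lambda>k. (\<theta> k * cmod (d t0 k))\<^sup>2) summable_on UNIV" "(\<Sum>\<^sub>\<infinity>k. (\<theta> k * cmod (d t0 k))\<^sup>2) \<le> D"
      using D1 one by auto
    \<comment> \<open>Bounds the square of every admissible \<beta>, since |\<beta> - \<beta>0|
      \<le> 1.\<close>
    define bb where "bb = (\<bar>\<beta>0\<bar> + 1)\<^sup>2"
    have le: "(cmod (rhs \<beta> \<theta> (c t0) k - rhs \<beta>0 \<theta> (d t0) k))\<^sup>2
        \<le> 3 * ((y k)\<^sup>2 + bb * (J k powr p * (cmod (w t0 k))\<^sup>2) + r * (\<theta> k * cmod (d t0 k))\<^sup>2)" for k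
    proof -
      define u1 u2 u3 where "u1 = cmod (- 3 * \<i> * of_int k * (conv (w t0) (w t0) k + 2 * conv (d t0) (w t0) k))"
        and "u2 = cmod (\<i> * of_real (\<beta> * \<theta> k) * w t0 k)" and "u3 = cmod (\<i> * of_real (\<eta> * \<theta> k) * d t0 k)"
      have "cmod (rhs \<beta> \<theta> (c t0) k - rhs \<beta>0 \<theta> (d t0) k) \<le> u1 + u2 + u3"
        unfolding rdiff[OF t0] u1_def u2_def u3_def by (intro order_trans[OF norm_triangle_ineq] add_mono norm_triangle_ineq order_refl)
      hence "(cmod (rhs \<beta> \<theta> (c t0) k - rhs \<beta>0 \<theta> (d t0) k))\<^sup>2 \<le> (u1 + u2 + u3)\<^sup>2" by (intro power_mono) auto
      also have "\<dots> \<le> 3 * (u1\<^sup>2 + u2\<^sup>2 + u3\<^sup>2)"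
        using sum_squares_bound[of u1 u2] sum_squares_bound[of u1 u3] sum_squares_bound[of u2 u3]
        by (simp add: power2_eq_square algebra_simps)
      also have "\<dots> \<le> 3 * ((y k)\<^sup>2 + bb * (J k powr p * (cmod (w t0 k))\<^sup>2) + r * (\<theta> k * cmod (d t0 k))\<^sup>2)"
      proof (intro mult_left_mono add_mono)
        have "u1 = 3 * \<bar>of_int k\<bar> * cmod (conv (w t0) (w t0) k + 2 * conv (d t0) (w t0) k)" by (simp add: u1_def norm_mult)
        also have "\<dots> \<le> 3 * J k * (cmod (conv (w t0) (w t0) k) + 2 * cmod (conv (d t0) (w t0) k))"
          by (intro mult_mono norm_add_double_le) (simp_all add: abs_le_J J_pos less_imp_le)
        also have "\<dots> = y k" by (simp add: y_def algebra_simps)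
        finally show "u1\<^sup>2 \<le> (y k)\<^sup>2" by (intro power_mono) (simp_all add: u1_def)
        have "u2\<^sup>2 = \<beta>\<^sup>2 * ((\<theta> k)\<^sup>2 * (cmod (w t0 k))\<^sup>2)" by (simp add: u2_def norm_mult power_mult_distrib)
        also have "\<dots> \<le> bb * (J k powr p * (cmod (w t0 k))\<^sup>2)"
        proof (intro mult_mono \<theta>2 order_refl)
          have "\<bar>\<beta>\<bar> \<le> \<bar>\<beta>0\<bar> + 1" using \<eta>(2) unfolding \<eta>_def by linarith
          hence "\<bar>\<beta>\<bar>\<^sup>2 \<le> bb" unfolding bb_def by (intro power_mono) auto
          thus "\<beta>\<^sup>2 \<le> bb" by simp
        qed (auto simp: bb_def)
        finally show "u2\<^sup>2 \<le> bb * (J k powr p * (cmod (w t0 k))\<^sup>2)" .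
        have "\<eta>\<^sup>2 \<le> r"
        proof -
          have "\<bar>\<eta>\<bar> * \<bar>\<eta>\<bar> \<le> r\<^sup>2 * 1" by (intro mult_mono \<eta>) auto
          thus ?thesis using r2 by (simp add: power2_eq_square)
        qed
        hence "\<eta>\<^sup>2 * (\<theta> k * cmod (d t0 k))\<^sup>2 \<le> r * (\<theta> k * cmod (d t0 k))\<^sup>2" by (rule mult_right_mono) simp
        moreover have "u3\<^sup>2 = \<eta>\<^sup>2 * (\<theta> k * cmod (d t0 k))\<^sup>2" by (simp add: u3_def norm_mult power_mult_distrib)
        ultimately show "u3\<^sup>2 \<le> r * (\<theta> k * cmod (d t0 k))\<^sup>2" by simp
      qed simp
      finally show ?thesis .
    qed
    have ms: "(\<lambda>k. 3 * ((y k)\<^sup>2 + bb * (J k powr p * (cmod (w t0 k))\<^sup>2) + r * (\<theta> k * cmod (d t0 k))\<^sup>2)) summable_on UNIV"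
      by (intro summable_on_cmult_right summable_on_add y2 Es z2)
    have rs: "(\<lambda>k. (cmod (rhs \<beta> \<theta> (c t0) k - rhs \<beta>0 \<theta> (d t0) k))\<^sup>2) summable_on UNIV"
      by (rule summable_on_comparison_test[OF ms le]) simp
    have "(\<Sum>\<^sub>\<infinity>k. (cmod (rhs \<beta> \<theta> (c t0) k - rhs \<beta>0 \<theta> (d t0) k))\<^sup>2)
        \<le> 3 * ((\<Sum>\<^sub>\<infinity>k. (y k)\<^sup>2) + bb * (\<Sum>\<^sub>\<infinity>k. J k powr p * (cmod (w t0 k))\<^sup>2) + r * (\<Sum>\<^sub>\<infinity>k. (\<theta> k * cmod (d t0 k))\<^sup>2))"
      using infsum_mono[OF rs ms le]
      by (simp only: infsum_cmult_right' infsum_add[OF summable_on_add[OF y2(1) summable_on_cmult_right[OF Es]] summable_on_cmult_right[OF z2(1)]] infsum_add[OF y2(1) summable_on_cmult_right[OF Es]])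
    also have "\<dots> \<le> 3 * (Y\<^sup>2 * r + bb * (R * r) + r * D)"
      using y2(2) order_trans[OF El Er] z2(2) r by (intro mult_left_mono add_mono) (auto simp: bb_def)
    finally have rl: "(\<Sum>\<^sub>\<infinity>k. (cmod (rhs \<beta> \<theta> (c t0) k - rhs \<beta>0 \<theta> (d t0) k))\<^sup>2) \<le> 3 * (Y\<^sup>2 * r + bb * (R * r) + r * D)" .
    have Gr: "G * r = R * r + 3 * (Y\<^sup>2 * r + bb * (R * r) + r * D)" by (simp add: G_def bb_def algebra_simps)
    have nn: "0 \<le> R * r" "0 \<le> 3 * (Y\<^sup>2 * r + bb * (R * r) + r * D)" using Rn r Dn by (auto simp: bb_def)
    show "(\<lambda>k. J k powr p * (cmod (c t0 k - d t0 k))\<^sup>2) summable_on UNIV \<and>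
       (\<Sum>\<^sub>\<infinity>k. J k powr p * (cmod (c t0 k - d t0 k))\<^sup>2) \<le> G * r \<and>
       (\<lambda>k. (cmod (rhs \<beta> \<theta> (c t0) k - rhs \<beta>0 \<theta> (d t0) k))\<^sup>2) summable_on UNIV \<and>
       (\<Sum>\<^sub>\<infinity>k. (cmod (rhs \<beta> \<theta> (c t0) k - rhs \<beta>0 \<theta> (d t0) k))\<^sup>2) \<le> G * r"
      using Es El Er rs rl Gr nn unfolding w_def by (intro conjI) linarith+
  qed
qed

section \<open>Fourier series on the circle\<close>

abbreviation circ :: "real measure" where "circ \<equiv> restrict_space lborel {-pi..pi}"

lemma space_circ [simp]: "space circ = {-pi..pi}" by (simp add: space_restrict_space)

lemma finite_measure_circ: "finite_measure circ"
  by (intro finite_measureI) (simp add: emeasure_restrict_space)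

lemma measurable_circ: "f \<in> borel_measurable borel \<Longrightarrow> f \<in> borel_measurable circ"
  by (rule measurable_restrict_space1) simp

lemma measurable_cis [measurable]: "cis \<in> borel_measurable borel"
  by (intro borel_measurable_continuous_onI continuous_intros)

lemma set_integrable_circ: "set_integrable lborel {-pi..pi} f \<longleftrightarrow> integrable circ f"
  for f :: "real \<Rightarrow> 'a :: {banach, second_countable_topology}"
  unfolding set_integrable_def by (rule integrable_restrict_space[symmetric]) simp

lemma set_integral_circ: "(LINT x:{-pi..pi}|lborel. f x) = (LINT x|circ. f x)"
  for f :: "real \<Rightarrow> 'a :: {banach, second_countable_topology}"
  unfolding set_lebesgue_integral_def by (rule integral_restrict_space[symmetric]) simp

lemma fourier_circ:
  "fourier f k = complex_of_real (1 / (2 * pi)) * (LINT x|circ. complex_of_real (f x) * cis (- (of_int k * x)))"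
  by (simp add: fourier_def set_integral_circ)

lemma integrable_mult_bounded:
  fixes f g :: "real \<Rightarrow> complex"
  assumes f: "integrable M f" and g: "g \<in> borel_measurable M" "\<And>x. x \<in> space M \<Longrightarrow> cmod (g x) \<le> C"
  shows "integrable M (\<lambda>x. f x * g x)"
proof (rule Bochner_Integration.integrable_bound)
  show "integrable M (\<lambda>x. C * norm (f x))" using f by (intro integrable_mult_right integrable_norm)
  show "(\<lambda>x. f x * g x) \<in> borel_measurable M" using f g by measurable
  show "AE x in M. norm (f x * g x) \<le> norm (C * norm (f x))"
  proof (rule AE_I2)
    fix x assume x: "x \<in> space M"
    have "cmod (f x) * cmod (g x) \<le> cmod (f x) * \<bar>C\<bar>" using g(2)[OF x] by (intro mult_left_mono) auto
    thus "norm (f x * g x) \<le> norm (C * norm (f x))" by (simp add: norm_mult abs_mult mult.commute)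
  qed
qed

section \<open>Uniqueness of Fourier coefficients of integrable functions\<close>

definition null_coeffs :: "(real \<Rightarrow> complex) \<Rightarrow> bool" where
  "null_coeffs f \<longleftrightarrow> integrable circ f \<and> (\<forall>k::int. (LINT x|circ. f x * cis (- (of_int k * x))) = 0)"

lemma integrable_mult_cis:
  assumes "integrable circ f" shows "integrable circ (\<lambda>x. f x * cis (a * x))"
  by (rule integrable_mult_bounded[OF assms, of _ 1]) (auto intro!: measurable_circ)

lemma integrable_mult_cis_minus:
  assumes "integrable circ f" shows "integrable circ (\<lambda>x. f x * cis (- (a * x)))"
  using integrable_mult_cis[OF assms, of "- a"] by simp

lemma null_coeffs_shift:
  assumes "null_coeffs f" shows "null_coeffs (\<lambda>x. f x * cis (of_int m * x))"
  unfolding null_coeffs_def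
proof (intro conjI allI)
  show "integrable circ (\<lambda>x. f x * cis (of_int m * x))" using assms by (intro integrable_mult_cis) (simp add: null_coeffs_def)
  fix k
  have eq: "f x * cis (of_int m * x) * cis (- (of_int k * x)) = f x * cis (- (of_int (k - m) * x))" for x
    by (simp add: mult.assoc cis_mult left_diff_distrib)
  show "(LINT x|circ. f x * cis (of_int m * x) * cis (- (of_int k * x))) = 0"
    unfolding eq using assms unfolding null_coeffs_def by blast
qed

lemma null_coeffs_lincomb:
  assumes "null_coeffs f" "null_coeffs g" shows "null_coeffs (\<lambda>x. a * f x + b * g x)"
  unfolding null_coeffs_def
proof (intro conjI allI)
  have i: "integrable circ f" "integrable circ g" using assms by (auto simp: null_coeffs_def)
  thus "integrable circ (\<lambda>x. a * f x + b * g x)" by simp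
  fix k
  have "(LINT x|circ. (a * f x + b * g x) * cis (- (of_int k * x)))
      = (LINT x|circ. a * (f x * cis (- (of_int k * x))) + b * (g x * cis (- (of_int k * x))))"
    by (simp add: algebra_simps)
  also have "\<dots> = a * (LINT x|circ. f x * cis (- (of_int k * x))) + b * (LINT x|circ. g x * cis (- (of_int k * x)))"
    using i by (subst Bochner_Integration.integral_add) (auto intro!: integrable_mult_cis_minus)
  also have "\<dots> = 0" using assms by (simp add: null_coeffs_def)
  finally show "(LINT x|circ. (a * f x + b * g x) * cis (- (of_int k * x))) = 0" .
qed

text \<open>On the unit circle a real-linear function of z = cis x is a combination of cis x and cis
  (- x), and multiplication by either shifts the coefficients; products follow by letting
  \<open>f\<close> vary in the induction.\<close>

lemma null_coeffs_poly:
  assumes "real_polynomial_function G" "null_coeffs f"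
  shows "null_coeffs (\<lambda>x. f x * of_real (G (cis x)))"
  using assms
proof (induction arbitrary: f rule: real_polynomial_function.induct)
  case (linear h)
  interpret h: bounded_linear h by fact
  have "f x * of_real (h (cis x)) =
      (of_real (h 1) / 2 - \<i> * of_real (h \<i>) / 2) * (f x * cis (of_int 1 * x))
      + (of_real (h 1) / 2 + \<i> * of_real (h \<i>) / 2) * (f x * cis (of_int (- 1) * x))" for x
  proof -
    have "cis x = cos x *\<^sub>R 1 + sin x *\<^sub>R \<i>" by (simp add: complex_eq_iff)
    hence "h (cis x) = cos x * h 1 + sin x * h \<i>" by (simp add: h.add h.scaleR)
    thus ?thesis by (simp add: complex_eq_iff algebra_simps add_divide_distrib diff_divide_distrib)
  qed
  thus ?case using null_coeffs_lincomb[OF null_coeffs_shift[OF linear(2), of 1] null_coeffs_shift[OF linear(2), of "- 1"]]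
    by simp
next
  case (const c)
  show ?case using null_coeffs_lincomb[OF const const, of "of_real c" 0] by (simp add: mult.commute)
next
  case (add g h)
  show ?case using null_coeffs_lincomb[OF add(3)[OF add(5)] add(4)[OF add(5)], of 1 1] by (simp add: algebra_simps)
next
  case (mult g h)
  show ?case using mult(4)[OF mult(3)[OF mult(5)]] by (simp add: mult.assoc)
qed

lemma null_coeffs_integral: "null_coeffs f \<Longrightarrow> (LINT x|circ. f x) = 0"
  unfolding null_coeffs_def by (drule conjunct2, drule spec[of _ 0]) simp

text \<open>By Stone-Weierstrass G is uniformly close on the circle to a polynomial, against which
  the integral of \<open>f\<close> vanishes; the error is at most e times the L1 norm of
  \<open>f\<close>.\<close>

lemma null_coeffs_continuous:
  assumes f: "null_coeffs f" and G: "continuous_on UNIV (G :: complex \<Rightarrow> real)" "\<And>z. \<bar>G z\<bar> \<le> C"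
  shows "(LINT x|circ. f x * of_real (G (cis x))) = 0"
proof -
  have fi: "integrable circ f" using f by (simp add: null_coeffs_def)
  have meas: "(\<lambda>x. complex_of_real (G (cis x))) \<in> borel_measurable circ"
    using measurable_compose[OF measurable_cis borel_measurable_continuous_onI[OF G(1)]]
    by (intro measurable_circ measurable_compose[OF _ borel_measurable_of_real])
  have int: "integrable circ (\<lambda>x. f x * of_real (G (cis x)))"
    by (rule integrable_mult_bounded[OF fi meas, of C]) (simp add: G(2))
  have "cmod (LINT x|circ. f x * of_real (G (cis x))) \<le> e * (LINT x|circ. cmod (f x))" if e: "0 < e" for e
  proof -
    obtain p where p: "real_polynomial_function p" "\<And>z. z \<in> sphere 0 1 \<Longrightarrow> \<bar>G z - p z\<bar> < e"
      using Stone_Weierstrass_real_polynomial_function[OF compact_sphere continuous_on_subset[OF G(1)] e, of "0::complex" 1] by auto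
    have n: "null_coeffs (\<lambda>x. f x * of_real (p (cis x)))" by (rule null_coeffs_poly[OF p(1) f])
    have int2: "integrable circ (\<lambda>x. f x * of_real (p (cis x)))" using n by (simp add: null_coeffs_def)
    have "(LINT x|circ. f x * of_real (G (cis x))) = (LINT x|circ. f x * of_real (G (cis x)) - f x * of_real (p (cis x)))"
      using null_coeffs_integral[OF n] int int2 by simp
    also have "cmod \<dots> \<le> (LINT x|circ. cmod (f x * of_real (G (cis x)) - f x * of_real (p (cis x))))"
      by (rule integral_norm_bound)
    also have "\<dots> \<le> (LINT x|circ. e * cmod (f x))"
    proof (rule integral_mono)
      fix x
      have "\<bar>G (cis x) - p (cis x)\<bar> < e" by (rule p(2)) simp
      hence "cmod (f x) * \<bar>G (cis x) - p (cis x)\<bar> \<le> cmod (f x) * e" by (intro mult_left_mono) auto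
      moreover have "cmod (f x * of_real (G (cis x)) - f x * of_real (p (cis x))) = cmod (f x) * \<bar>G (cis x) - p (cis x)\<bar>"
        unfolding right_diff_distrib[symmetric] of_real_diff[symmetric] norm_mult norm_of_real ..
      ultimately show "cmod (f x * of_real (G (cis x)) - f x * of_real (p (cis x))) \<le> e * cmod (f x)"
        by (simp add: mult.commute)
    qed (use fi int int2 in auto)
    finally show ?thesis by simp
  qed
  hence le: "cmod (LINT x|circ. f x * of_real (G (cis x))) \<le> e * (LINT x|circ. cmod (f x))" if "0 < e" for e using that by blast
  have "((\<lambda>e. e * (LINT x|circ. cmod (f x))) \<longlongrightarrow> 0 * (LINT x|circ. cmod (f x))) (at_right 0)"
    by (intro tendsto_intros)
  hence "cmod (LINT x|circ. f x * of_real (G (cis x))) \<le> 0 * (LINT x|circ. cmod (f x))"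
    by (rule tendsto_lowerbound) (auto intro!: eventually_at_rightI[of 0 1] le)
  thus ?thesis by simp
qed

text \<open>Inside the period the half-line corresponds to an open arc of the circle, whose
  indicator is a pointwise limit of continuous functions bounded by 1; dominated convergence
  transfers the vanishing.\<close>

lemma null_coeffs_interval:
  assumes f: "null_coeffs f"
  shows "(LINT x|circ. f x * of_real (indicator {a<..} x)) = 0"
proof -
  have fi: "integrable circ f" using f by (simp add: null_coeffs_def)
  \<comment> \<open>The closed negative real axis is removed because Arg jumps there; this makes
    \<open>V\<close> open.\<close>
  define V where "V = {z. z \<in> - \<real>\<^sub>\<le>\<^sub>0 \<and> a < Arg z}"
  have "V = (- \<real>\<^sub>\<le>\<^sub>0) \<inter> Arg -` {a<..}" by (auto simp: V_def)
  hence opV: "open V"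
    using continuous_open_preimage[OF continuous_on_Arg _ open_greaterThan[of a]] by (simp add: open_Compl closed_nonpos_Reals_complex)
  have "0 \<in> - V" by (simp add: V_def)
  hence ne: "- V \<noteq> {}" by blast
  \<comment> \<open>Continuous functions increasing to the indicator of the open set
    \<open>V\<close>: distance to the complement, scaled by n and capped at 1.\<close>
  define G where "G = (\<lambda>n z. min 1 (real n * infdist z (- V)))"
  have Gc: "continuous_on UNIV (G n)" for n unfolding G_def by (intro continuous_intros)
  have Gb: "\<bar>G n z\<bar> \<le> 1" for n z unfolding G_def using infdist_nonneg[of z "- V"] by (simp add: abs_le_iff min_def)
  have Gm: "(\<lambda>x. complex_of_real (G n (cis x))) \<in> borel_measurable circ" for n
    using measurable_compose[OF measurable_cis borel_measurable_continuous_onI[OF Gc[of n]]]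
    by (intro measurable_circ measurable_compose[OF _ borel_measurable_of_real])
  have lim: "(\<lambda>n. G n z) \<longlonglongrightarrow> indicator V z" for z
  proof (cases "z \<in> V")
    case True
    hence pos: "0 < infdist z (- V)" using infdist_pos_not_in_closed[OF _ ne, of z] opV by (simp add: closed_Compl)
    obtain N :: nat where N: "1 / infdist z (- V) < real N" using reals_Archimedean2 by blast
    have "\<forall>\<^sub>F n in sequentially. G n z = indicator V z"
    proof (rule eventually_sequentiallyI[of N])
      fix n assume "N \<le> n"
      hence "1 / infdist z (- V) \<le> real n" using N by linarith
      hence "1 \<le> real n * infdist z (- V)" using pos by (simp add: field_simps)
      thus "G n z = indicator V z" using True by (simp add: G_def)
    qed
    thus ?thesis by (rule tendsto_eventually)
  next
    case False
    thus ?thesis by (simp add: G_def)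
  qed
  have "(\<lambda>n. LINT x|circ. f x * of_real (G n (cis x))) \<longlonglongrightarrow> (LINT x|circ. f x * of_real (indicator V (cis x)))"
  proof (rule integral_dominated_convergence[where w = "\<lambda>x. cmod (f x)"])
    have "(indicator V :: complex \<Rightarrow> real) \<in> borel_measurable borel" using opV by (intro borel_measurable_indicator) auto
    from measurable_compose[OF measurable_cis this]
    have "(\<lambda>x. complex_of_real (indicator V (cis x))) \<in> borel_measurable circ"
      by (intro measurable_circ measurable_compose[OF _ borel_measurable_of_real])
    thus "(\<lambda>x. f x * of_real (indicator V (cis x))) \<in> borel_measurable circ" using fi by measurable
    show "(\<lambda>x. f x * of_real (G n (cis x))) \<in> borel_measurable circ" for n using fi Gm[of n] by measurable
    show "AE x in circ. (\<lambda>n. f x * of_real (G n (cis x))) \<longlonglongrightarrow> f x * of_real (indicator V (cis x))"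
      by (intro AE_I2 tendsto_intros lim)
    show "AE x in circ. norm (f x * of_real (G n (cis x))) \<le> cmod (f x)" for n
      using mult_left_mono[OF Gb, of "cmod (f _)"] by (intro AE_I2) (simp add: norm_mult)
  qed (use fi in auto)
  moreover have "(LINT x|circ. f x * of_real (G n (cis x))) = 0" for n
    by (rule null_coeffs_continuous[OF f Gc Gb])
  ultimately have "(LINT x|circ. f x * of_real (indicator V (cis x))) = 0"
    using LIMSEQ_unique[OF _ tendsto_const[of 0]] by simp
  moreover have "(LINT x|circ. f x * of_real (indicator {a<..} x)) = (LINT x|circ. f x * of_real (indicator V (cis x)))"
  proof (rule integral_cong_AE)
    have "(indicator V :: complex \<Rightarrow> real) \<in> borel_measurable borel" using opV by (intro borel_measurable_indicator) auto
    from measurable_compose[OF measurable_cis this]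
    have "(\<lambda>x. complex_of_real (indicator V (cis x))) \<in> borel_measurable circ"
      by (intro measurable_circ measurable_compose[OF _ borel_measurable_of_real])
    thus "(\<lambda>x. f x * of_real (indicator V (cis x))) \<in> borel_measurable circ" using fi by measurable
    have "(\<lambda>x. complex_of_real (indicator {a<..} x)) \<in> borel_measurable circ" by (intro measurable_circ) measurable
    thus "(\<lambda>x. f x * of_real (indicator {a<..} x)) \<in> borel_measurable circ" using fi by measurable
    \<comment> \<open>At the endpoints cis x lies on the removed ray; they form a null set.\<close>
    have "AE x in lborel. x \<noteq> pi \<and> x \<noteq> - pi"
      using AE_lborel_singleton[of pi] AE_lborel_singleton[of "- pi"] by eventually_elim auto
    hence "AE x in circ. x \<noteq> pi \<and> x \<noteq> - pi" by (subst AE_restrict_space_iff) auto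
    moreover have "AE x in circ. x \<in> {-pi..pi}" using AE_space[of circ] by simp
    ultimately show "AE x in circ. f x * of_real (indicator {a<..} x) = f x * of_real (indicator V (cis x))"
    proof eventually_elim
      case (elim x)
      hence x: "- pi < x" "x < pi" by auto
      hence A: "Arg (cis x) = x" by (intro Arg_cis) auto
      have "cis x \<notin> \<real>\<^sub>\<le>\<^sub>0"
      proof
        assume "cis x \<in> \<real>\<^sub>\<le>\<^sub>0"
        hence "Arg (cis x) = pi \<or> cis x = 0" by (auto simp: nonpos_Reals_def Arg_eq_pi complex_is_Real_iff complex_eq_iff)
        thus False using A x by auto
      qed
      thus ?case using A by (simp add: V_def indicator_def)
    qed
  qed
  ultimately show ?thesis by simp
qed

text \<open>The positive and the negative part of \<open>g\<close> are densities of two measures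
  that are finite and equal on all these half-lines, so the measures coincide, and then so do the
  densities almost everywhere. As \<open>ennreal\<close> cuts off negative values, equal parts must
  both be 0.\<close>

lemma integral_intervals_zero_imp_AE_zero:
  fixes g :: "real \<Rightarrow> real"
  assumes g: "integrable lborel g" and z: "\<And>a. (LINT x|lborel. g x * indicator {a<..} x) = 0"
  shows "AE x in lborel. g x = 0"
proof -
  have [measurable]: "g \<in> borel_measurable borel" using g by auto
  define F1 where "F1 = density lborel (\<lambda>x. ennreal (g x))"
  define F2 where "F2 = density lborel (\<lambda>x. ennreal (- g x))"
  have gi: "integrable lborel (\<lambda>x. g x * indicator {a<..} x)" for a
    by (rule Bochner_Integration.integrable_bound[OF g]) (auto simp: indicator_def)
  have em: "emeasure F1 {a<..} = (\<integral>\<^sup>+x. ennreal (g x * indicator {a<..} x) \<partial>lborel)"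
    "emeasure F2 {a<..} = (\<integral>\<^sup>+x. ennreal (- (g x * indicator {a<..} x)) \<partial>lborel)" for a
    unfolding F1_def F2_def by (auto simp: emeasure_density indicator_def intro!: nn_integral_cong)
  have fin: "(\<integral>\<^sup>+x. ennreal (g x * indicator {a<..} x) \<partial>lborel) \<noteq> \<infinity>"
    "(\<integral>\<^sup>+x. ennreal (- (g x * indicator {a<..} x)) \<partial>lborel) \<noteq> \<infinity>" for a
    using real_integrable_def[THEN iffD1, OF gi[of a]] by auto
  have "F1 = F2"
  proof (rule measure_eqI_lessThan)
    show "emeasure F1 {a<..} < \<infinity>" for a using fin(1)[of a] em(1)[of a] by (simp add: less_top)
    show "emeasure F1 {a<..} = emeasure F2 {a<..}" for a
    proof -
      have "0 = enn2real (emeasure F1 {a<..}) - enn2real (emeasure F2 {a<..})"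
        using real_lebesgue_integral_def[OF gi[of a]] z[of a] by (simp add: em)
      hence "ennreal (enn2real (emeasure F1 {a<..})) = ennreal (enn2real (emeasure F2 {a<..}))" by simp
      moreover have "emeasure F1 {a<..} < top" "emeasure F2 {a<..} < top"
        using fin[of a] em[of a] by (simp_all add: less_top)
      ultimately show ?thesis by (simp only: ennreal_enn2real)
    qed
  qed (auto simp: F1_def F2_def)
  hence "AE x in lborel. ennreal (g x) = ennreal (- g x)"
    unfolding F1_def F2_def by (intro sigma_finite_measure.density_unique[OF sigma_finite_lborel]) auto
  thus ?thesis
  proof eventually_elim
    case (elim x)
    show ?case
    proof (cases "0 \<le> g x")
      case True
      hence "ennreal (g x) = 0" using elim by (simp add: ennreal_neg)
      thus ?thesis using True by simp
    next
      case False
      hence "ennreal (- g x) = 0" using elim by (simp add: ennreal_neg)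
      thus ?thesis using False by simp
    qed
  qed
qed

lemma null_coeffs_AE_zero:
  assumes f: "null_coeffs f" shows "AE x in circ. f x = 0"
proof -
  have fi: "integrable circ f" using f by (simp add: null_coeffs_def)
  have *: "AE x in circ. h (f x) = 0" if h: "bounded_linear h" for h :: "complex \<Rightarrow> real"
  proof -
    interpret h: bounded_linear h by fact
    define g where "g = (\<lambda>x. indicator {-pi..pi} x * h (f x))"
    have hi: "integrable circ (\<lambda>x. h (f x))" by (rule integrable_bounded_linear[OF h fi])
    hence gi: "integrable lborel g"
      unfolding g_def by (subst (asm) integrable_restrict_space) auto
    have "AE x in lborel. g x = 0"
    proof (rule integral_intervals_zero_imp_AE_zero[OF gi])
      fix a
      have m: "(\<lambda>x. complex_of_real (indicator {a<..} x)) \<in> borel_measurable circ" by (intro measurable_circ) measurable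
      have ii: "integrable circ (\<lambda>x. f x * of_real (indicator {a<..} x))"
        by (rule integrable_mult_bounded[OF fi m, of 1]) (simp add: indicator_def)
      have "(LINT x|lborel. g x * indicator {a<..} x) = (LINT x|lborel. indicator {-pi..pi} x *\<^sub>R (h (f x) * indicator {a<..} x))"
        by (simp add: g_def mult.assoc)
      also have "\<dots> = (LINT x|circ. h (f x) * indicator {a<..} x)"
        by (rule integral_restrict_space[symmetric]) auto
      also have "\<dots> = (LINT x|circ. h (f x * of_real (indicator {a<..} x)))"
        by (rule Bochner_Integration.integral_cong) (auto simp: indicator_def h.zero)
      also have "\<dots> = h (LINT x|circ. f x * of_real (indicator {a<..} x))"
        by (rule integral_bounded_linear[OF h ii])
      finally show "(LINT x|lborel. g x * indicator {a<..} x) = 0" by (simp add: null_coeffs_interval[OF f] h.zero)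
    qed
    thus ?thesis by (subst AE_restrict_space_iff) (auto simp: g_def elim!: eventually_mono)
  qed
  show ?thesis using *[OF bounded_linear_Re] *[OF bounded_linear_Im] by eventually_elim (simp add: complex_eq_iff)
qed

lemma filterlim_symmetric_intervals:
  "filterlim (\<lambda>n. {- int n..int n}) (finite_subsets_at_top UNIV) sequentially"
  unfolding filterlim_iff eventually_finite_subsets_at_top
proof safe
  fix P :: "int set \<Rightarrow> bool" and X assume X: "finite X" and P: "\<forall>Y. finite Y \<and> X \<subseteq> Y \<and> Y \<subseteq> UNIV \<longrightarrow> P Y"
  obtain N where N: "\<And>x. x \<in> X \<Longrightarrow> nat \<bar>x\<bar> \<le> N"
    using finite_nat_set_iff_bounded_le[of "(\<lambda>x. nat \<bar>x\<bar>) ` X"] X by auto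
  show "\<forall>\<^sub>F n in sequentially. P {- int n..int n}"
  proof (rule eventually_sequentiallyI[of N])
    fix n assume n: "N \<le> n"
    have "X \<subseteq> {- int n..int n}"
    proof
      fix x assume "x \<in> X"
      hence "nat \<bar>x\<bar> \<le> n" using N n by (meson order_trans)
      thus "x \<in> {- int n..int n}" by auto
    qed
    thus "P {- int n..int n}" using P by simp
  qed
qed

section \<open>Absolutely convergent Fourier series\<close>

definition synth :: "(int \<Rightarrow> complex) \<Rightarrow> real \<Rightarrow> complex" where
  "synth c x = (\<Sum>\<^sub>\<infinity>a. c a * cis (of_int a * x))"

context
  fixes c :: "int \<Rightarrow> complex" assumes c: "(\<lambda>k. cmod (c k)) summable_on UNIV"
begin

lemma synth_summable: "(\<lambda>a. c a * cis (of_int a * x)) summable_on UNIV"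
  by (rule abs_summable_summable) (use c in \<open>simp add: norm_mult\<close>)

lemma synth_measurable: "synth c \<in> borel_measurable borel"
proof (rule borel_measurable_LIMSEQ_metric)
  show "(\<lambda>x. \<Sum>a\<in>{- int n..int n}. c a * cis (of_int a * x)) \<in> borel_measurable borel" for n by measurable
  show "(\<lambda>n. \<Sum>a\<in>{- int n..int n}. c a * cis (of_int a * x)) \<longlonglongrightarrow> synth c x" for x
    unfolding synth_def by (rule filterlim_compose[OF infsum_tendsto[OF synth_summable] filterlim_symmetric_intervals])
qed

lemma synth_tail: "finite K \<Longrightarrow> cmod (synth c x - (\<Sum>a\<in>K. c a * cis (of_int a * x))) \<le> (\<Sum>\<^sub>\<infinity>a\<in>- K. cmod (c a))"
proof -
  assume K: "finite K"
  have "synth c x - (\<Sum>a\<in>K. c a * cis (of_int a * x)) = (\<Sum>\<^sub>\<infinity>a\<in>- K. c a * cis (of_int a * x))"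
    unfolding synth_def using infsum_Compl_finite(1)[OF synth_summable K] by simp
  also have "cmod \<dots> \<le> (\<Sum>\<^sub>\<infinity>a\<in>- K. cmod (c a))"
    by (rule norm_infsum_le_infsum[OF infsum_Compl_finite(2)[OF c K]]) (simp add: norm_mult)
  finally show ?thesis .
qed

lemma synth_bounded: "cmod (synth c x) \<le> (\<Sum>\<^sub>\<infinity>a. cmod (c a))"
  using synth_tail[of "{}" x] by simp

text \<open>Partial sums converge uniformly in x, so integrating against \<open>g\<close> commutes
  with summation; the error is the tail of the coefficients times the L1 norm of
  \<open>g\<close>.\<close>

lemma synth_integral:
  assumes g: "integrable circ g"
  shows "((\<lambda>a. c a * (LINT x|circ. g x * cis (of_int a * x))) has_sum (LINT x|circ. g x * synth c x)) UNIV"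
  unfolding has_sum_def
proof (rule LIM_zero_cancel)
  have si: "integrable circ (\<lambda>x. g x * synth c x)"
    by (rule integrable_mult_bounded[OF g measurable_circ[OF synth_measurable] synth_bounded])
  have ci: "integrable circ (\<lambda>x. g x * cis (of_int a * x))" for a by (rule integrable_mult_cis[OF g])
  show "((\<lambda>K. (\<Sum>a\<in>K. c a * (LINT x|circ. g x * cis (of_int a * x))) - (LINT x|circ. g x * synth c x)) \<longlongrightarrow> 0) (finite_subsets_at_top UNIV)"
  proof (rule Lim_null_comparison)
    have "((\<lambda>K. (infsum (\<lambda>a. cmod (c a)) UNIV - (\<Sum>a\<in>K. cmod (c a))) * (LINT x|circ. cmod (g x)))
        \<longlongrightarrow> (infsum (\<lambda>a. cmod (c a)) UNIV - infsum (\<lambda>a. cmod (c a)) UNIV) * (LINT x|circ. cmod (g x))) (finite_subsets_at_top UNIV)"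
      by (intro tendsto_intros infsum_tendsto c)
    thus "((\<lambda>K. (infsum (\<lambda>a. cmod (c a)) UNIV - (\<Sum>a\<in>K. cmod (c a))) * (LINT x|circ. cmod (g x)))
        \<longlongrightarrow> 0) (finite_subsets_at_top UNIV)" by simp
    have "cmod ((\<Sum>a\<in>K. c a * (LINT x|circ. g x * cis (of_int a * x))) - (LINT x|circ. g x * synth c x))
        \<le> (infsum (\<lambda>a. cmod (c a)) UNIV - (\<Sum>a\<in>K. cmod (c a))) * (LINT x|circ. cmod (g x))" if K: "finite K" for K
    proof -
      define \<tau> where "\<tau> = (\<Sum>\<^sub>\<infinity>a\<in>- K. cmod (c a))"
      have \<tau>: "infsum (\<lambda>a. cmod (c a)) UNIV - (\<Sum>a\<in>K. cmod (c a)) = \<tau>"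
        using infsum_Compl_finite(1)[OF c K] by (simp add: \<tau>_def)
      have fi: "integrable circ (\<lambda>x. g x * (\<Sum>a\<in>K. c a * cis (of_int a * x)))"
      proof -
        have "integrable circ (\<lambda>x. \<Sum>a\<in>K. c a * (g x * cis (of_int a * x)))" using ci by simp
        thus ?thesis by (simp add: sum_distrib_left mult_ac)
      qed
      have "(\<Sum>a\<in>K. c a * (LINT x|circ. g x * cis (of_int a * x))) = (LINT x|circ. (\<Sum>a\<in>K. c a * (g x * cis (of_int a * x))))"
        using ci by (subst Bochner_Integration.integral_sum) auto
      also have "\<dots> = (LINT x|circ. g x * (\<Sum>a\<in>K. c a * cis (of_int a * x)))"
        by (simp add: sum_distrib_left mult_ac)
      finally have "(LINT x|circ. g x * synth c x) - (\<Sum>a\<in>K. c a * (LINT x|circ. g x * cis (of_int a * x)))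
          = (LINT x|circ. g x * synth c x - g x * (\<Sum>a\<in>K. c a * cis (of_int a * x)))"
        using si fi by simp
      hence "cmod ((\<Sum>a\<in>K. c a * (LINT x|circ. g x * cis (of_int a * x))) - (LINT x|circ. g x * synth c x))
          = cmod (LINT x|circ. g x * synth c x - g x * (\<Sum>a\<in>K. c a * cis (of_int a * x)))"
        by (subst norm_minus_commute) (rule arg_cong)
      also have "\<dots> \<le> (LINT x|circ. cmod (g x * synth c x - g x * (\<Sum>a\<in>K. c a * cis (of_int a * x))))"
        by (rule integral_norm_bound)
      also have "\<dots> \<le> (LINT x|circ. \<tau> * cmod (g x))"
      proof (rule integral_mono)
        fix x
        have "cmod (g x) * cmod (synth c x - (\<Sum>a\<in>K. c a * cis (of_int a * x))) \<le> cmod (g x) * \<tau>"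
          unfolding \<tau>_def by (intro mult_left_mono synth_tail K) simp
        thus "cmod (g x * synth c x - g x * (\<Sum>a\<in>K. c a * cis (of_int a * x))) \<le> \<tau> * cmod (g x)"
          unfolding right_diff_distrib[symmetric] norm_mult by (simp add: mult.commute)
      qed (use g si fi in auto)
      finally show ?thesis by (simp add: \<tau>)
    qed
    thus "\<forall>\<^sub>F K in finite_subsets_at_top UNIV. norm ((\<Sum>a\<in>K. c a * (LINT x|circ. g x * cis (of_int a * x))) - (LINT x|circ. g x * synth c x))
        \<le> (infsum (\<lambda>a. cmod (c a)) UNIV - (\<Sum>a\<in>K. cmod (c a))) * (LINT x|circ. cmod (g x))"
      by (intro eventually_finite_subsets_at_top_weakI) auto
  qed
qed

end

lemma integral_cis: "(LINT x|circ. cis (of_int a * x)) = (if a = 0 then 2 * pi else 0)"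
proof -
  have "(LINT x|circ. cis (of_int a * x)) = (LINT x:{-pi..pi}|lborel. cis (of_int a * x))" by (rule set_integral_circ[symmetric])
  also have "\<dots> = integral {-pi..pi} (\<lambda>x. cis (of_int a * x))"
    by (rule set_borel_integral_eq_integral, unfold set_integrable_circ)
       (rule integrable_mult_cis[of "\<lambda>_. 1", simplified], simp add: finite_measure.integrable_const[OF finite_measure_circ])
  also have "\<dots> = (if a = 0 then 2 * pi else 0)"
  proof (cases "a = 0")
    case False
    have "((\<lambda>x. cis (of_int a * x)) has_integral (cis (of_int a * pi) / (\<i> * of_int a) - cis (of_int a * (- pi)) / (\<i> * of_int a))) {-pi..pi}"
    proof (rule fundamental_theorem_of_calculus)
      fix x :: real
      have "((\<lambda>x. exp (\<i> * of_int a * of_real x) / (\<i> * of_int a)) has_vector_derivative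
          exp (\<i> * of_int a * of_real x)) (at x within {-pi..pi})"
        by (rule has_vector_derivative_real_field) (use False in \<open>auto intro!: derivative_eq_intros\<close>)
      thus "((\<lambda>x. cis (of_int a * x) / (\<i> * of_int a)) has_vector_derivative cis (of_int a * x)) (at x within {-pi..pi})"
        by (simp add: cis_conv_exp mult_ac)
    qed simp
    moreover have "cis (of_int a * pi) = cis (of_int a * (- pi))"
    proof -
      have "cis (of_int a * pi) = cis (of_int a * (- pi)) * cis (2 * pi * of_int a)"
        by (simp add: cis_mult algebra_simps)
      thus ?thesis by (simp add: cis_multiple_2pi)
    qed
    ultimately show ?thesis using False by (simp add: integral_unique)
  qed (simp add: scaleR_conv_of_real)
  finally show ?thesis .
qed

text \<open>Termwise integration and orthogonality show that the sum of the series has the same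
  coefficients as \<open>f\<close>, so their difference falls under the uniqueness result.\<close>

lemma fourier_inversion:
  assumes f: "integrable circ f" and s: "(\<lambda>k. cmod (fourier f k)) summable_on UNIV"
  shows "AE x in circ. complex_of_real (f x) = synth (fourier f) x"
proof -
  have 1: "integrable circ (\<lambda>_. 1::complex)" by (rule finite_measure.integrable_const[OF finite_measure_circ])
  have fi: "integrable circ (\<lambda>x. complex_of_real (f x))" using f by simp
  have si: "integrable circ (synth (fourier f))"
    using integrable_mult_bounded[OF 1 measurable_circ[OF synth_measurable[OF s]] synth_bounded[OF s]] by simp
  have "null_coeffs (\<lambda>x. complex_of_real (f x) - synth (fourier f) x)"
    unfolding null_coeffs_def
  proof (intro conjI allI)
    show "integrable circ (\<lambda>x. complex_of_real (f x) - synth (fourier f) x)" using fi si by simp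
    fix k
    have g: "integrable circ (\<lambda>x. cis (- (of_int k * x)))" using integrable_mult_cis_minus[OF 1, of "of_int k"] by simp
    have "((\<lambda>a. fourier f a * (LINT x|circ. cis (- (of_int k * x)) * cis (of_int a * x))) has_sum
        (LINT x|circ. cis (- (of_int k * x)) * synth (fourier f) x)) UNIV"
      by (rule synth_integral[OF s g])
    moreover have "(LINT x|circ. cis (- (of_int k * x)) * cis (of_int a * x)) = (if a = k then 2 * pi else 0)" for a
    proof -
      have "cis (- (of_int k * x)) * cis (of_int a * x) = cis (of_int (a - k) * x)" for x
        by (simp add: cis_mult algebra_simps)
      thus ?thesis using integral_cis[of "a - k"] by simp
    qed
    ultimately have "((\<lambda>a. fourier f a * (if a = k then 2 * pi else 0)) has_sum
        (LINT x|circ. cis (- (of_int k * x)) * synth (fourier f) x)) UNIV" by simp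
    moreover have "((\<lambda>a. fourier f a * (if a = k then 2 * pi else 0)) has_sum (fourier f k * (2 * pi))) UNIV"
    proof -
      have "((\<lambda>a. fourier f a * (if a = k then 2 * pi else 0)) has_sum (\<Sum>a\<in>{k}. fourier f a * (if a = k then 2 * pi else 0))) {k}"
        by (rule has_sum_finite) simp
      hence "((\<lambda>a. fourier f a * (if a = k then 2 * pi else 0)) has_sum (fourier f k * (2 * pi))) {k}" by simp
      thus ?thesis by (subst has_sum_cong_neutral[where T = "{k}" and g = "\<lambda>a. fourier f a * (if a = k then 2 * pi else 0)"]) auto
    qed
    ultimately have S: "(LINT x|circ. cis (- (of_int k * x)) * synth (fourier f) x) = fourier f k * (2 * pi)"
      by (rule has_sum_unique)
    have "(LINT x|circ. (complex_of_real (f x) - synth (fourier f) x) * cis (- (of_int k * x)))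
        = (LINT x|circ. complex_of_real (f x) * cis (- (of_int k * x)) - synth (fourier f) x * cis (- (of_int k * x)))"
      by (simp add: left_diff_distrib)
    also have "\<dots> = (LINT x|circ. complex_of_real (f x) * cis (- (of_int k * x))) - (LINT x|circ. synth (fourier f) x * cis (- (of_int k * x)))"
      by (rule Bochner_Integration.integral_diff[OF integrable_mult_cis_minus[OF fi] integrable_mult_cis_minus[OF si]])
    also have "\<dots> = 0" using S by (simp add: mult.commute fourier_circ)
    finally show "(LINT x|circ. (complex_of_real (f x) - synth (fourier f) x) * cis (- (of_int k * x))) = 0" .
  qed
  from null_coeffs_AE_zero[OF this] show ?thesis by eventually_elim simp
qed

text \<open>Replace \<open>f\<close> by its absolutely convergent series and integrate term by term.
  Integrability of \<open>g\<close> suffices, which matters because the other factor will be a weak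
  derivative known only to be square integrable.\<close>

lemma fourier_mult:
  assumes f: "integrable circ f" and s: "(\<lambda>k. cmod (fourier f k)) summable_on UNIV" and g: "integrable circ g"
  shows "fourier (\<lambda>x. f x * g x) k = conv (fourier f) (fourier g) k"
proof -
  have gi: "integrable circ (\<lambda>x. complex_of_real (g x) * cis (- (of_int k * x)))"
    by (rule integrable_mult_cis_minus) (use g in simp)
  have "(LINT x|circ. complex_of_real (f x * g x) * cis (- (of_int k * x)))
      = (LINT x|circ. (complex_of_real (g x) * cis (- (of_int k * x))) * synth (fourier f) x)"
  proof (rule integral_cong_AE)
    have m: "(\<lambda>x. cis (- (of_int k * x))) \<in> borel_measurable circ" by (intro measurable_circ) measurable
    have m1: "(\<lambda>x. complex_of_real (f x * g x)) \<in> borel_measurable circ" using f g by measurable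
    show "(\<lambda>x. complex_of_real (f x * g x) * cis (- (of_int k * x))) \<in> borel_measurable circ" by (rule borel_measurable_times[OF m1 m])
    show "(\<lambda>x. (complex_of_real (g x) * cis (- (of_int k * x))) * synth (fourier f) x) \<in> borel_measurable circ"
      using gi measurable_circ[OF synth_measurable[OF s]] by measurable
    show "AE x in circ. complex_of_real (f x * g x) * cis (- (of_int k * x)) = (complex_of_real (g x) * cis (- (of_int k * x))) * synth (fourier f) x"
      using fourier_inversion[OF f s] by eventually_elim simp
  qed
  also have "\<dots> = (\<Sum>\<^sub>\<infinity>a. fourier f a * (LINT x|circ. (complex_of_real (g x) * cis (- (of_int k * x))) * cis (of_int a * x)))"
    by (rule infsumI[OF synth_integral[OF s gi], symmetric])
  also have "\<dots> = (\<Sum>\<^sub>\<infinity>a. (2 * pi) * (fourier f a * fourier g (k - a)))"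
  proof (rule infsum_cong)
    fix a
    have eq: "(complex_of_real (g x) * cis (- (of_int k * x))) * cis (of_int a * x) = complex_of_real (g x) * cis (- (of_int (k - a) * x))" for x
      by (simp add: mult.assoc cis_mult algebra_simps)
    show "fourier f a * (LINT x|circ. (complex_of_real (g x) * cis (- (of_int k * x))) * cis (of_int a * x)) = (2 * pi) * (fourier f a * fourier g (k - a))"
      unfolding eq by (simp add: fourier_circ)
  qed
  also have "\<dots> = (2 * pi) * conv (fourier f) (fourier g) k" unfolding infsum_cmult_right' conv_def ..
  finally show ?thesis by (simp add: fourier_circ[of "\<lambda>x. f x * g x"])
qed

lemma fourier_minus: "fourier f (- k) = cnj (fourier f k)"
proof -
  have "cnj (LINT x|circ. complex_of_real (f x) * cis (- (of_int k * x))) = (LINT x|circ. cnj (complex_of_real (f x) * cis (- (of_int k * x))))"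
    by (rule Bochner_Integration.integral_cnj[symmetric])
  thus ?thesis by (simp add: fourier_circ cis_cnj)
qed

lemma fourier_lincomb:
  assumes "integrable circ f" "integrable circ g"
  shows "fourier (\<lambda>x. a * f x + b * g x) k = of_real a * fourier f k + of_real b * fourier g k"
proof -
  have i: "integrable circ (\<lambda>x. complex_of_real (f x) * cis (- (of_int k * x)))" "integrable circ (\<lambda>x. complex_of_real (g x) * cis (- (of_int k * x)))"
    by (rule integrable_mult_cis_minus, use assms in simp)+
  have "(LINT x|circ. complex_of_real (a * f x + b * g x) * cis (- (of_int k * x)))
      = (LINT x|circ. of_real a * (complex_of_real (f x) * cis (- (of_int k * x))) + of_real b * (complex_of_real (g x) * cis (- (of_int k * x))))"
    by (simp add: algebra_simps)
  also have "\<dots> = of_real a * (LINT x|circ. complex_of_real (f x) * cis (- (of_int k * x))) + of_real b * (LINT x|circ. complex_of_real (g x) * cis (- (of_int k * x)))"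
    using i by (subst Bochner_Integration.integral_add) auto
  finally show ?thesis by (simp add: fourier_circ algebra_simps)
qed

lemma fourier_diff:
  assumes "integrable circ f" "integrable circ g"
  shows "fourier (\<lambda>x. f x - g x) k = fourier f k - fourier g k"
  using fourier_lincomb[OF assms, of 1 "- 1" k] by simp

lemma fourier_cong_AE:
  assumes "AE x in circ. f x = g x" "integrable circ f" "integrable circ g"
  shows "fourier f k = fourier g k"
proof -
  have "(LINT x|circ. complex_of_real (f x) * cis (- (of_int k * x))) = (LINT x|circ. complex_of_real (g x) * cis (- (of_int k * x)))"
  proof (rule integral_cong_AE)
    show "(\<lambda>x. complex_of_real (f x) * cis (- (of_int k * x))) \<in> borel_measurable circ" "(\<lambda>x. complex_of_real (g x) * cis (- (of_int k * x))) \<in> borel_measurable circ"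
      by (rule borel_measurable_integrable, rule integrable_mult_cis_minus, use assms in simp)+
    show "AE x in circ. complex_of_real (f x) * cis (- (of_int k * x)) = complex_of_real (g x) * cis (- (of_int k * x))"
      using assms(1) by eventually_elim simp
  qed
  thus ?thesis by (simp add: fourier_circ)
qed

lemma square_integrable_mult:
  fixes f g :: "real \<Rightarrow> real"
  assumes "f \<in> borel_measurable circ" "g \<in> borel_measurable circ" "integrable circ (\<lambda>x. (f x)\<^sup>2)" "integrable circ (\<lambda>x. (g x)\<^sup>2)"
  shows "integrable circ (\<lambda>x. f x * g x)"
proof (rule Bochner_Integration.integrable_bound[where f = "\<lambda>x. (f x)\<^sup>2 + (g x)\<^sup>2"])
  show "integrable circ (\<lambda>x. (f x)\<^sup>2 + (g x)\<^sup>2)" using assms by simp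
  show "(\<lambda>x. f x * g x) \<in> borel_measurable circ" using assms by measurable
  show "AE x in circ. norm (f x * g x) \<le> norm ((f x)\<^sup>2 + (g x)\<^sup>2)"
  proof (rule AE_I2)
    fix x
    have "2 * \<bar>f x\<bar> * \<bar>g x\<bar> \<le> \<bar>f x\<bar>\<^sup>2 + \<bar>g x\<bar>\<^sup>2" by (rule sum_squares_bound)
    moreover have "0 \<le> \<bar>f x\<bar> * \<bar>g x\<bar>" by simp
    ultimately have "\<bar>f x\<bar> * \<bar>g x\<bar> \<le> (f x)\<^sup>2 + (g x)\<^sup>2" unfolding power2_abs by linarith
    thus "norm (f x * g x) \<le> norm ((f x)\<^sup>2 + (g x)\<^sup>2)" by (simp add: abs_mult)
  qed
qed

lemma in_H_integrable:
  assumes "in_H r f"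
  shows "f \<in> borel_measurable circ" "integrable circ (\<lambda>x. (f x)\<^sup>2)" "integrable circ f"
proof -
  show m: "f \<in> borel_measurable circ" using assms by (intro measurable_circ) (simp add: in_H_def)
  show s: "integrable circ (\<lambda>x. (f x)\<^sup>2)" using assms by (simp add: in_H_def set_integrable_circ)
  have "integrable circ (\<lambda>x. f x * 1)"
    by (rule square_integrable_mult[OF m _ s]) (simp_all add: finite_measure.integrable_const[OF finite_measure_circ])
  thus "integrable circ f" by simp
qed

lemma circ_continuous:
  fixes h :: "real \<Rightarrow> 'a :: euclidean_space"
  assumes "continuous_on {-pi..pi} h"
  shows "integrable circ h" "(LINT x|circ. h x) = integral {-pi..pi} h"
proof -
  have s: "set_integrable lborel {-pi..pi} h" by (rule borel_integrable_atLeastAtMost'[OF assms])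
  thus "integrable circ h" by (simp add: set_integrable_circ)
  show "(LINT x|circ. h x) = integral {-pi..pi} h"
    using set_borel_integral_eq_integral(2)[OF s] by (simp add: set_integral_circ)
qed

lemma fourier_bound:
  assumes f: "integrable circ f" and C: "\<And>x. x \<in> {-pi..pi} \<Longrightarrow> \<bar>f x\<bar> \<le> C"
  shows "cmod (fourier f k) \<le> C"
proof -
  have "cmod (LINT x|circ. complex_of_real (f x) * cis (- (of_int k * x))) \<le> (LINT x|circ. cmod (complex_of_real (f x) * cis (- (of_int k * x))))"
    by (rule integral_norm_bound)
  also have "\<dots> \<le> (LINT x|circ. C)"
    by (rule integral_mono) (use f C in \<open>auto simp: norm_mult finite_measure.integrable_const[OF finite_measure_circ]\<close>)
  also have "\<dots> = 2 * pi * C" by (simp add: measure_restrict_space)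
  finally show ?thesis unfolding fourier_circ norm_mult norm_of_real by (simp add: field_simps)
qed

section \<open>Derivatives of periodic functions and decay of their coefficients\<close>

lemma periodic_deriv:
  assumes p: "periodic2pi f" and d: "\<And>x. (f has_real_derivative f' x) (at x)"
  shows "periodic2pi f'"
  unfolding periodic2pi_def
proof
  fix x
  have "((\<lambda>x. f (x + 2 * pi)) has_real_derivative f' (x + 2 * pi)) (at x)"
    using DERIV_shift[THEN iffD1, OF d[of "x + 2 * pi"]] .
  moreover have "(\<lambda>x. f (x + 2 * pi)) = f" using p by (auto simp: periodic2pi_def)
  ultimately show "f' (x + 2 * pi) = f' x" using d[of x] DERIV_unique by metis
qed

lemma periodic_int:
  assumes "periodic2pi f" shows "f (x + 2 * pi * of_int n) = f x"
proof -
  have nat: "f (x + 2 * pi * of_nat n) = f x" for x n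
  proof (induction n)
    case (Suc n)
    have "f (x + 2 * pi * of_nat (Suc n)) = f ((x + 2 * pi * of_nat n) + 2 * pi)" by (simp add: algebra_simps)
    thus ?case using Suc assms by (simp add: periodic2pi_def)
  qed simp
  show ?thesis
  proof (cases n)
    case (nonneg m) thus ?thesis using nat by simp
  next
    case (neg m)
    have "f (x + 2 * pi * of_int n) = f (x + 2 * pi * of_int n + 2 * pi * of_nat (Suc m))" by (rule nat[symmetric])
    also have "x + 2 * pi * of_int n + 2 * pi * of_nat (Suc m) = x" by (simp add: neg algebra_simps)
    finally show ?thesis .
  qed
qed

lemma periodic_bounded:
  assumes "periodic2pi f" "continuous_on UNIV f"
  obtains C where "0 \<le> C" "\<And>x. \<bar>f x\<bar> \<le> C"
proof -
  have "compact (f ` {-pi..pi})" by (rule compact_continuous_image[OF continuous_on_subset[OF assms(2)]]) auto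
  hence "bounded (f ` {-pi..pi})" by (rule compact_imp_bounded)
  then obtain C where C: "\<forall>y\<in>f ` {-pi..pi}. norm y \<le> C" unfolding bounded_iff by blast
  have "\<bar>f x\<bar> \<le> C" for x
  proof -
    define n where "n = \<lfloor>(x + pi) / (2 * pi)\<rfloor>"
    have n: "of_int n \<le> (x + pi) / (2 * pi)" "(x + pi) / (2 * pi) < of_int n + 1" unfolding n_def by linarith+
    hence "of_int n * (2 * pi) \<le> x + pi" "x + pi < (of_int n + 1) * (2 * pi)"
      by (simp_all only: pos_le_divide_eq pos_divide_less_eq mult_pos_pos pi_gt_zero zero_less_numeral)
    hence "x - 2 * pi * of_int n \<in> {-pi..pi}" by (auto simp: algebra_simps)
    hence "\<bar>f (x - 2 * pi * of_int n)\<bar> \<le> C" using C by auto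
    thus ?thesis using periodic_int[OF assms(1), of x "- n"] by simp
  qed
  thus ?thesis using that[of C] by (meson abs_ge_zero order_trans)
qed

text \<open>Integration by parts: the function times the exponential has equal values at the two
  endpoints by periodicity, so the integral of its derivative vanishes.\<close>

lemma fourier_deriv:
  assumes p: "periodic2pi f" and d: "\<And>x. (f has_real_derivative f' x) (at x)" and c: "continuous_on UNIV f'"
  shows "fourier f' k = \<i> * of_int k * fourier f k"
proof -
  let ?e = "\<lambda>x. cis (- (of_int k * x))"
  have cf: "continuous_on S f" for S using d by (intro continuous_at_imp_continuous_on ballI DERIV_isCont) blast
  have cf': "continuous_on S f'" for S using c continuous_on_subset by blast
  have ce: "continuous_on S ?e" for S by (intro continuous_intros)
  have de: "(?e has_vector_derivative (- \<i> * of_int k * ?e x)) (at x within S)" for x S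
  proof -
    have "((\<lambda>x. exp (- \<i> * of_int k * of_real x)) has_vector_derivative - \<i> * of_int k * exp (- \<i> * of_int k * of_real x)) (at x within S)"
      by (rule has_vector_derivative_real_field) (auto intro!: derivative_eq_intros)
    thus ?thesis by (simp add: cis_conv_exp mult_ac)
  qed
  have df: "((\<lambda>x. complex_of_real (f x)) has_vector_derivative complex_of_real (f' x)) (at x within S)" for x S
    using d[of x] has_vector_derivative_of_real has_field_derivative_at_within by blast
  have "((\<lambda>x. complex_of_real (f x) * (- \<i> * of_int k * ?e x) + complex_of_real (f' x) * ?e x) has_integral
      (complex_of_real (f pi) * ?e pi - complex_of_real (f (- pi)) * ?e (- pi))) {-pi..pi}"
    by (rule fundamental_theorem_of_calculus, simp, rule has_vector_derivative_mult[OF df de])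
  moreover have "complex_of_real (f pi) * ?e pi = complex_of_real (f (- pi)) * ?e (- pi)"
  proof -
    have "f pi = f (- pi)" using p[unfolded periodic2pi_def, rule_format, of "- pi"] by simp
    moreover have "cis (of_int k * pi) = cis (- (of_int k * pi)) * cis (2 * pi * of_int k)" by (simp add: cis_mult algebra_simps)
    ultimately show ?thesis by (simp add: cis_multiple_2pi)
  qed
  ultimately have "integral {-pi..pi} (\<lambda>x. complex_of_real (f x) * (- \<i> * of_int k * ?e x) + complex_of_real (f' x) * ?e x) = 0"
    by (simp add: integral_unique)
  hence "(LINT x|circ. complex_of_real (f x) * (- \<i> * of_int k * ?e x) + complex_of_real (f' x) * ?e x) = 0"
    by (subst circ_continuous(2)) (auto intro!: continuous_intros cf cf')
  moreover have "(LINT x|circ. complex_of_real (f x) * (- \<i> * of_int k * ?e x) + complex_of_real (f' x) * ?e x)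
      = (LINT x|circ. (- \<i> * of_int k) * (complex_of_real (f x) * ?e x)) + (LINT x|circ. complex_of_real (f' x) * ?e x)"
  proof (subst Bochner_Integration.integral_add[symmetric])
    show "integrable circ (\<lambda>x. (- \<i> * of_int k) * (complex_of_real (f x) * ?e x))" "integrable circ (\<lambda>x. complex_of_real (f' x) * ?e x)"
      by (auto intro!: circ_continuous(1) continuous_intros cf cf')
  qed (simp add: mult_ac)
  ultimately show ?thesis by (simp add: fourier_circ algebra_simps)
qed

lemma decay_from_powers:
  assumes "\<And>k. cmod (x k) \<le> C0" "\<And>k. cmod (x k) * \<bar>real_of_int k\<bar> ^ q \<le> C1"
  shows "cmod (x k) * J k ^ q \<le> 2 ^ q * (C0 + C1)"
proof -
  have "J k ^ q \<le> 2 ^ q * (1 + \<bar>real_of_int k\<bar> ^ q)"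
  proof (cases "k = 0")
    case False
    hence "1 \<le> \<bar>real_of_int k\<bar>" by (cases "k > 0") auto
    hence "J k \<le> 2 * \<bar>real_of_int k\<bar>" by (simp add: J_def)
    hence "J k ^ q \<le> (2 * \<bar>real_of_int k\<bar>) ^ q" using J_pos[of k] by (intro power_mono) auto
    also have "\<dots> \<le> 2 ^ q * (1 + \<bar>real_of_int k\<bar> ^ q)" by (simp add: power_mult_distrib)
    finally show ?thesis .
  next
    case True
    have "(1::real) \<le> 2 ^ q" by simp
    also have "\<dots> \<le> 2 ^ q * (1 + \<bar>real_of_int k\<bar> ^ q)" by (simp add: algebra_simps)
    finally show ?thesis using True by (simp add: J_def)
  qed
  hence "cmod (x k) * J k ^ q \<le> cmod (x k) * (2 ^ q * (1 + \<bar>real_of_int k\<bar> ^ q))" by (intro mult_left_mono) auto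
  also have "\<dots> = 2 ^ q * (cmod (x k) + cmod (x k) * \<bar>real_of_int k\<bar> ^ q)" by (simp add: algebra_simps)
  also have "\<dots> \<le> 2 ^ q * (C0 + C1)" by (intro mult_left_mono add_mono assms) simp
  finally show ?thesis .
qed

lemma smooth_deriv:
  assumes "smooth f"
  shows "(((deriv ^^ n) f) has_real_derivative ((deriv ^^ Suc n) f) x) (at x)" "continuous_on S ((deriv ^^ n) f)"
proof -
  have d: "(((deriv ^^ n) f) has_real_derivative ((deriv ^^ Suc n) f) x) (at x)" for x
    using assms DERIV_deriv_iff_real_differentiable[of "(deriv ^^ n) f" x] by (simp add: smooth_def)
  thus "(((deriv ^^ n) f) has_real_derivative ((deriv ^^ Suc n) f) x) (at x)" .
  show "continuous_on S ((deriv ^^ n) f)" using d by (intro continuous_at_imp_continuous_on ballI DERIV_isCont) blast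
qed

lemma smooth_periodic: "smooth f \<Longrightarrow> periodic2pi f \<Longrightarrow> periodic2pi ((deriv ^^ n) f)"
  by (induction n) (auto intro: periodic_deriv smooth_deriv(1)[simplified])

lemma smooth_fourier_decay:
  assumes "smooth f" "periodic2pi f"
  shows "\<exists>M. \<forall>k. cmod (fourier f k) * J k ^ q \<le> M"
proof -
  have F: "fourier ((deriv ^^ n) f) k = (\<i> * of_int k) ^ n * fourier f k" for n k
  proof (induction n)
    case (Suc n)
    show ?case using fourier_deriv[OF smooth_periodic[OF assms, of n] smooth_deriv(1)[OF assms(1)] smooth_deriv(2)[OF assms(1)], of k] Suc
      by simp
  qed simp
  have B: "\<exists>C. \<forall>k. cmod (fourier f k) * \<bar>real_of_int k\<bar> ^ n \<le> C" for n
  proof -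
    obtain C where "\<And>x. \<bar>(deriv ^^ n) f x\<bar> \<le> C"
      using periodic_bounded[OF smooth_periodic[OF assms, of n] smooth_deriv(2)[OF assms(1)]] by blast
    hence "cmod (fourier ((deriv ^^ n) f) k) \<le> C" for k
      by (intro fourier_bound circ_continuous(1) smooth_deriv(2)[OF assms(1)])
    thus ?thesis by (auto simp: F norm_mult norm_power mult.commute)
  qed
  obtain C0 C1 where "\<And>k. cmod (fourier f k) \<le> C0" "\<And>k. cmod (fourier f k) * \<bar>real_of_int k\<bar> ^ q \<le> C1"
    using B[of 0] B[of q] by auto
  thus ?thesis using decay_from_powers by blast
qed

section \<open>Burgers equation by characteristics\<close>

text \<open>The straight line with speed 6 u0(y) is prescribed instead of solving for a
  characteristic. The deviation h of v from u0(y) along it satisfies h' = - 6 v_x h with h(0) = 0,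
  so Gronwall for h^2 gives h = 0.\<close>

lemma burgers_characteristic:
  assumes vt: "\<And>t x. t \<in> {0..T} \<Longrightarrow> ((\<lambda>s. v s x) has_real_derivative vt t x) (at t within {0..T})"
    and vx: "\<And>t x. t \<in> {0..T} \<Longrightarrow> (v t has_real_derivative vx t x) (at x)"
    and eq: "\<And>t x. t \<in> {0..T} \<Longrightarrow> vt t x + 6 * v t x * vx t x = 0"
    and cont: "continuous_on ({0..T} \<times> UNIV) (\<lambda>(t, x). vx t x)"
    and t: "t \<in> {0..T}"
  shows "v t (y + 6 * t * v 0 y) = v 0 y"
proof -
  define a where "a = v 0 y"
  define X where "X = (\<lambda>t. y + 6 * t * a)"
  define h where "h = (\<lambda>t. v t (X t) - a)"
  \<comment> \<open>The chain rule needs a total derivative; the two partial derivatives together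
    with joint continuity of \<open>vx\<close> provide it.\<close>
  have dv: "((\<lambda>(t, x). v t x) has_derivative (\<lambda>(s, x). vt t z * s + blinfun_scaleR_left (vx t z) x)) (at (t, z) within {0..T} \<times> UNIV)"
    if t: "t \<in> {0..T}" for t z
  proof (rule has_derivative_partialsI)
    show "((\<lambda>s. v s z) has_derivative (*) (vt t z)) (at t within {0..T})" using vt[OF t, of z] by (simp add: has_field_derivative_def)
    show "(v s has_derivative blinfun_apply (blinfun_scaleR_left (vx s x))) (at x)" if "s \<in> {0..T}" for s x
      using vx[OF that, of x] by (simp add: has_field_derivative_def mult_commute_abs)
    have "continuous (at (t, z) within {0..T} \<times> UNIV) (\<lambda>(t, x). vx t x)"
      using cont t by (simp add: continuous_on_eq_continuous_within)
    hence "continuous (at (t, z) within {0..T} \<times> UNIV) (\<lambda>p. blinfun_scaleR_left ((\<lambda>(t, x). vx t x) p))"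
      by (rule bounded_linear.continuous[OF bounded_linear_blinfun_scaleR_left])
    thus "continuous (at (t, z) within {0..T} \<times> UNIV) (\<lambda>(t, x). blinfun_scaleR_left (vx t x))" by (simp add: case_prod_unfold)
  qed auto
  have dh: "(h has_real_derivative (- 6 * vx t (X t) * h t)) (at t within {0..T})" if t: "t \<in> {0..T}" for t
  proof -
    have dX: "((\<lambda>t. (t, X t)) has_derivative (\<lambda>s. (s, 6 * a * s))) (at t within {0..T})"
      unfolding X_def by (auto intro!: derivative_eq_intros)
    have "(((\<lambda>(t, x). v t x) \<circ> (\<lambda>t. (t, X t))) has_derivative ((\<lambda>(s, x). vt t (X t) * s + blinfun_scaleR_left (vx t (X t)) x) \<circ> (\<lambda>s. (s, 6 * a * s)))) (at t within {0..T})"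
      by (rule diff_chain_within[OF dX has_derivative_subset[OF dv[OF t]]]) auto
    hence "((\<lambda>t. v t (X t)) has_derivative (\<lambda>s. (vt t (X t) + 6 * a * vx t (X t)) * s)) (at t within {0..T})"
      by (simp add: o_def algebra_simps)
    hence "((\<lambda>t. v t (X t)) has_real_derivative (vt t (X t) + 6 * a * vx t (X t))) (at t within {0..T})"
      by (simp add: has_field_derivative_def)
    hence "(h has_real_derivative (vt t (X t) + 6 * a * vx t (X t) - 0)) (at t within {0..T})"
      unfolding h_def by (intro DERIV_diff DERIV_const)
    moreover have "vt t (X t) + 6 * a * vx t (X t) - 0 = - 6 * vx t (X t) * h t"
      using eq[OF t, of "X t"] unfolding h_def by (simp add: algebra_simps)
    ultimately show ?thesis by simp
  qed
  have "continuous_on {0..T} (\<lambda>t. (\<lambda>(t, x). vx t x) (t, X t))"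
    by (rule continuous_on_compose2[OF cont]) (auto simp: X_def intro!: continuous_intros)
  hence "compact ((\<lambda>t. vx t (X t)) ` {0..T})" by (intro compact_continuous_image) auto
  hence "bounded ((\<lambda>t. vx t (X t)) ` {0..T})" by (rule compact_imp_bounded)
  then obtain C where "\<forall>z\<in>(\<lambda>t. vx t (X t)) ` {0..T}. norm z \<le> C" unfolding bounded_iff by blast
  hence C: "\<bar>vx t (X t)\<bar> \<le> C" if "t \<in> {0..T}" for t using that by auto
  have "(h t)\<^sup>2 \<le> exp (12 * C * T) * ((h 0)\<^sup>2 + T * 0)"
  proof (rule gronwall_linear[where f' = "\<lambda>t. 2 * h t * (- 6 * vx t (X t) * h t)"])
    show "((\<lambda>t. (h t)\<^sup>2) has_real_derivative 2 * h s * (- 6 * vx s (X s) * h s)) (at s within {0..T})" if "s \<in> {0..T}" for s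
      using DERIV_power[OF dh[OF that], of 2] by (simp add: algebra_simps)
    show "2 * h s * (- 6 * vx s (X s) * h s) \<le> 12 * C * (h s)\<^sup>2 + 0" if "s \<in> {0..T}" for s
    proof -
      have "- vx s (X s) \<le> C" using C[OF that] by linarith
      hence "(- vx s (X s)) * (12 * (h s)\<^sup>2) \<le> C * (12 * (h s)\<^sup>2)" by (intro mult_right_mono) auto
      thus ?thesis by (simp add: power2_eq_square algebra_simps)
    qed
    show "0 \<le> 12 * C" using C[OF t] by simp
  qed (use t in auto)
  moreover have "h 0 = 0" by (simp add: h_def X_def a_def)
  ultimately have "h t = 0" by simp
  thus ?thesis by (simp add: h_def X_def a_def)
qed

text \<open>Along the characteristics the derivatives of \<open>v t\<close> are explicit functions of the foot point
  \<open>Y x\<close>, the inverse of \<open>y \<mapsto> y + s * u0 y\<close>.\<close>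

lemma composition_deriv:
  fixes D :: "nat \<Rightarrow> real \<Rightarrow> real" and f :: "real \<Rightarrow> real"
  assumes D: "\<And>n y. (D n has_real_derivative D (Suc n) y) (at y)"
    and bdd: "\<And>y. \<bar>D 0 y\<bar> \<le> C" and s: "0 \<le> s"
    and \<delta>: "0 < \<delta>" "\<And>y. \<delta> \<le> 1 + s * D 1 y"
    and f: "\<And>y. f (y + s * D 0 y) = D 0 y"
  obtains Y where "continuous_on UNIV Y"
    "\<And>x. f x = D 0 (Y x)"
    "\<And>x. (f has_real_derivative D 1 (Y x) / (1 + s * D 1 (Y x))) (at x)"
    "\<And>x. ((\<lambda>x. D 1 (Y x) / (1 + s * D 1 (Y x))) has_real_derivative D 2 (Y x) / (1 + s * D 1 (Y x)) ^ 3) (at x)"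
    "\<And>x. ((\<lambda>x. D 2 (Y x) / (1 + s * D 1 (Y x)) ^ 3) has_real_derivative
        D 3 (Y x) / (1 + s * D 1 (Y x)) ^ 4 - 3 * s * (D 2 (Y x))\<^sup>2 / (1 + s * D 1 (Y x)) ^ 5) (at x)"
proof -
  define \<Phi> where "\<Phi> = (\<lambda>y. y + s * D 0 y)"
  define p where "p = (\<lambda>y. 1 + s * D 1 y)"
  have p: "\<delta> \<le> p y" "0 < p y" "p y \<noteq> 0" for y using \<delta>(2)[of y] \<delta>(1) by (auto simp: p_def)
  have d\<Phi>: "(\<Phi> has_real_derivative p y) (at y)" for y
    unfolding \<Phi>_def p_def using D[of 0 y] by (auto intro!: derivative_eq_intros)
  have mono: "\<delta> * (b - a) \<le> \<Phi> b - \<Phi> a" if "a \<le> b" for a b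
  proof (cases "a = b")
    case False
    hence "a < b" using that by simp
    then obtain z where "\<Phi> b - \<Phi> a = (b - a) * p z" using MVT2[of a b \<Phi> p] d\<Phi> by blast
    thus ?thesis using mult_right_mono[OF p(1)[of z], of "b - a"] that by (simp add: mult.commute)
  qed simp
  \<comment> \<open>The foot-point map expands distances by at least \<delta>, so its inverse is
    Lipschitz; this supplies the continuity required by the inverse function rule.\<close>
  have lip: "\<delta> * \<bar>b - a\<bar> \<le> \<bar>\<Phi> b - \<Phi> a\<bar>" for a b
    using mono[of a b] mono[of b a] by (cases "a \<le> b") (auto simp: abs_if algebra_simps)
  have surj: "\<exists>y. \<Phi> y = x" for x
  proof -
    \<comment> \<open>As \<Phi>(y) differs from y by at most s C, the intermediate value theorem
      applies between x - s C and x + s C.\<close>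
    have Cn: "0 \<le> C" using bdd[of 0] by linarith
    have b: "\<bar>s * D 0 y\<bar> \<le> s * C" for y using mult_left_mono[OF bdd[of y] s] s by (simp add: abs_mult)
    have "\<exists>y\<ge>x - s * C. y \<le> x + s * C \<and> \<Phi> y = x"
    proof (rule IVT')
      show "\<Phi> (x - s * C) \<le> x" using b[of "x - s * C"] unfolding \<Phi>_def by linarith
      show "x \<le> \<Phi> (x + s * C)" using b[of "x + s * C"] unfolding \<Phi>_def by linarith
      show "x - s * C \<le> x + s * C" using Cn s mult_nonneg_nonneg[of s C] by linarith
      show "continuous_on {x - s * C..x + s * C} \<Phi>"
        using d\<Phi> by (intro continuous_at_imp_continuous_on ballI DERIV_isCont) blast
    qed
    thus ?thesis by blast
  qed
  define Y where "Y = (\<lambda>x. SOME y. \<Phi> y = x)"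
  have Y: "\<Phi> (Y x) = x" for x unfolding Y_def by (rule someI_ex[OF surj])
  have Ylip: "\<bar>Y b - Y a\<bar> \<le> \<bar>b - a\<bar> / \<delta>" for a b
    using lip[of "Y b" "Y a"] \<delta>(1) by (simp add: Y field_simps)
  have contY: "isCont Y x" for x
    unfolding isCont_def
  proof (rule LIM_zero_cancel, rule Lim_null_comparison)
    show "((\<lambda>b. \<bar>b - x\<bar> / \<delta>) \<longlongrightarrow> 0) (at x)" using \<delta>(1) by (auto intro!: tendsto_eq_intros)
  qed (use Ylip in auto)
  have dY: "(Y has_real_derivative inverse (p (Y x))) (at x)" for x
    by (rule DERIV_inverse_function[where f = \<Phi> and a = "x - 1" and b = "x + 1"]) (use d\<Phi> p Y contY in auto)
  have dp: "(p has_real_derivative s * D 2 y) (at y)" for y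
    unfolding p_def using D[of 1 y] by (auto intro!: derivative_eq_intros simp: numeral_2_eq_2)
  have chain: "((\<lambda>x. g (Y x)) has_real_derivative g' (Y x) / p (Y x)) (at x)"
    if "\<And>y. (g has_real_derivative g' y) (at y)" for g g' x
    using DERIV_chain2[OF that[of "Y x"] dY[of x]] by (simp add: divide_inverse)
  have fY: "f x = D 0 (Y x)" for x using f[of "Y x"] Y[of x] by (simp add: \<Phi>_def)
  have D1: "(D 1 has_real_derivative D 2 y) (at y)" and D2: "(D 2 has_real_derivative D 3 y) (at y)" for y
    using D[of 1 y] D[of 2 y] by (simp_all add: numeral_2_eq_2 numeral_3_eq_3)
  \<comment> \<open>The two products of \<open>D 1\<close> with \<open>D 2\<close> cancel in the
    quotient rule, so the numerator collapses to \<open>D 2\<close>; composing with \<open>Y\<close>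
    contributes one more factor 1 / p.\<close>
  have g1: "((\<lambda>y. D 1 y / p y) has_real_derivative D 2 y / (p y)\<^sup>2) (at y)" for y
  proof -
    have "((\<lambda>y. D 1 y / p y) has_real_derivative (D 2 y * p y - D 1 y * (s * D 2 y)) / (p y * p y)) (at y)"
      by (rule DERIV_divide[OF D1 dp p(3)])
    moreover have "D 2 y * p y - D 1 y * (s * D 2 y) = D 2 y" by (simp add: p_def algebra_simps)
    ultimately show ?thesis by (simp add: power2_eq_square)
  qed
  have g2: "((\<lambda>y. D 2 y / p y ^ 3) has_real_derivative D 3 y / p y ^ 3 - 3 * s * (D 2 y)\<^sup>2 / p y ^ 4) (at y)" for y
  proof -
    have "((\<lambda>y. p y ^ 3) has_real_derivative 3 * (p y)\<^sup>2 * (s * D 2 y)) (at y)"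
      using DERIV_power[OF dp[of y], of 3] by (simp add: mult_ac)
    from DERIV_divide[OF D2[of y] this]
    have "((\<lambda>y. D 2 y / p y ^ 3) has_real_derivative (D 3 y * p y ^ 3 - D 2 y * (3 * (p y)\<^sup>2 * (s * D 2 y))) / (p y ^ 3 * p y ^ 3)) (at y)"
      using p(3)[of y] by simp
    moreover have "(D 3 y * p y ^ 3 - D 2 y * (3 * (p y)\<^sup>2 * (s * D 2 y))) / (p y ^ 3 * p y ^ 3) = D 3 y / p y ^ 3 - 3 * s * (D 2 y)\<^sup>2 / p y ^ 4"
      using p(3)[of y] by (simp add: field_simps power2_eq_square power3_eq_cube power4_eq_xxxx)
    ultimately show ?thesis by simp
  qed
  show ?thesis
  proof (rule that[of Y])
    show "continuous_on UNIV Y" using contY by (simp add: continuous_at_imp_continuous_on)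
    show "f x = D 0 (Y x)" for x by (rule fY)
    have "f = (\<lambda>x. D 0 (Y x))" using fY by auto
    thus "(f has_real_derivative D 1 (Y x) / (1 + s * D 1 (Y x))) (at x)" for x
      using chain[of "D 0" "D 1" x] D[of 0] by (simp add: p_def)
    show "((\<lambda>x. D 1 (Y x) / (1 + s * D 1 (Y x))) has_real_derivative D 2 (Y x) / (1 + s * D 1 (Y x)) ^ 3) (at x)" for x
      using chain[OF g1, of x] by (simp add: p_def power2_eq_square power3_eq_cube mult_ac)
    show "((\<lambda>x. D 2 (Y x) / (1 + s * D 1 (Y x)) ^ 3) has_real_derivative
        D 3 (Y x) / (1 + s * D 1 (Y x)) ^ 4 - 3 * s * (D 2 (Y x))\<^sup>2 / (1 + s * D 1 (Y x)) ^ 5) (at x)" for x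
    proof -
      have "(D 3 (Y x) / p (Y x) ^ 3 - 3 * s * (D 2 (Y x))\<^sup>2 / p (Y x) ^ 4) / p (Y x)
          = D 3 (Y x) / p (Y x) ^ 4 - 3 * s * (D 2 (Y x))\<^sup>2 / p (Y x) ^ 5"
        by (simp add: diff_divide_distrib power_Suc2[of _ 3, simplified] power_Suc2[of _ 4, simplified])
      thus ?thesis using chain[OF g2, of x] by (simp add: p_def)
    qed
  qed
qed

text \<open>The supremum is finite because u0' is continuous and periodic. If it is a positive M,
  then T M < 1 and \<delta> = 1 - T M; otherwise u0 is nondecreasing and \<delta> = 1.\<close>

lemma critical_time_margin:
  assumes u0: "smooth u0" "periodic2pi u0" and T: "0 < T" "ereal T < critical_time u0"
  obtains \<delta> where "0 < \<delta>" "\<And>t y. t \<in> {0..T} \<Longrightarrow> \<delta> \<le> 1 + 6 * t * deriv u0 y"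
proof -
  define M where "M = Sup (range (\<lambda>x. - 6 * deriv u0 x))"
  obtain C where C: "\<And>x. \<bar>deriv u0 x\<bar> \<le> C"
    using periodic_bounded[OF smooth_periodic[OF u0, of 1] smooth_deriv(2)[OF u0(1)]] by auto
  have "- 6 * deriv u0 x \<le> 6 * C" for x using C[of x] by linarith
  hence bdd: "bdd_above (range (\<lambda>x. - 6 * deriv u0 x))" by (rule bdd_aboveI2)
  have M: "- 6 * deriv u0 x \<le> M" for x unfolding M_def by (rule cSup_upper[OF _ bdd]) auto
  show ?thesis
  proof (cases "M > 0")
    case True
    moreover have "critical_time u0 = (if M > 0 then ereal (1 / M) else \<infinity>)"
      unfolding critical_time_def Let_def M_def ..
    ultimately have "T < 1 / M" using T(2) by simp
    hence TM: "T * M < 1" using True by (simp add: field_simps)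
    have "1 - T * M \<le> 1 + 6 * t * deriv u0 y" if t: "t \<in> {0..T}" for t y
    proof -
      have "t * (- 6 * deriv u0 y) \<le> t * M" using t M[of y] by (intro mult_left_mono) auto
      also have "\<dots> \<le> T * M" using t True by (intro mult_right_mono) auto
      finally show ?thesis by (simp add: algebra_simps)
    qed
    thus ?thesis using TM by (intro that[of "1 - T * M"]) auto
  next
    case False
    have "1 \<le> 1 + 6 * t * deriv u0 y" if t: "t \<in> {0..T}" for t y
    proof -
      have "0 \<le> deriv u0 y" using M[of y] False by linarith
      thus ?thesis using t by simp
    qed
    thus ?thesis by (intro that[of 1]) auto
  qed
qed

text \<open>The third derivative of v t is bounded uniformly in t, as the denominators stay above
  \<delta> up to time T. Power 3 is what membership in the Wiener class asks for: one factor J in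
  the norm and J^-2 for convergence.\<close>

lemma burgers_decay:
  assumes u0: "smooth u0" "periodic2pi u0" and T: "0 < T" "ereal T < critical_time u0"
    and per: "\<And>t. periodic2pi (v t)"
    and char: "\<And>t y. t \<in> {0..T} \<Longrightarrow> v t (y + 6 * t * u0 y) = u0 y"
  shows "\<exists>M. \<forall>t\<in>{0..T}. \<forall>k. cmod (fourier (v t) k) * J k ^ 3 \<le> M"
proof -
  define D where "D = (\<lambda>n. (deriv ^^ n) u0)"
  have D: "(D n has_real_derivative D (Suc n) y) (at y)" for n y unfolding D_def by (rule smooth_deriv(1)[OF u0(1)])
  have Dc: "continuous_on S (D n)" for S n unfolding D_def by (rule smooth_deriv(2)[OF u0(1)])
  have "\<exists>C. 0 \<le> C \<and> (\<forall>x. \<bar>D n x\<bar> \<le> C)" for n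
    unfolding D_def by (rule periodic_bounded[OF smooth_periodic[OF u0, of n] smooth_deriv(2)[OF u0(1)]]) blast
  hence "\<exists>C. \<forall>n. 0 \<le> C n \<and> (\<forall>x. \<bar>D n x\<bar> \<le> C n)" by (intro choice) blast
  then obtain C where C: "\<And>n. 0 \<le> C n" "\<And>n x. \<bar>D n x\<bar> \<le> C n" by blast
  obtain \<delta> where \<delta>: "0 < \<delta>" "\<And>t y. t \<in> {0..T} \<Longrightarrow> \<delta> \<le> 1 + 6 * t * deriv u0 y"
    using critical_time_margin[OF u0 T] by blast
  \<comment> \<open>Bound for the third derivative of \<open>composition_deriv\<close>; s = 6 t is
    at most 6 T, which turns 3 s into 18 T.\<close>
  define C3 where "C3 = C 3 / \<delta> ^ 4 + 18 * T * (C 2)\<^sup>2 / \<delta> ^ 5"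
  have "cmod (fourier (v t) k) * J k ^ 3 \<le> 2 ^ 3 * (C 0 + C3)" if t: "t \<in> {0..T}" for t k
  proof -
    define s where "s = 6 * t"
    have s: "0 \<le> s" "s \<le> 6 * T" using t by (auto simp: s_def)
    have \<delta>s: "\<delta> \<le> 1 + s * D 1 y" for y using \<delta>(2)[OF t, of y] by (simp add: s_def D_def)
    have vf: "v t (y + s * D 0 y) = D 0 y" for y using char[OF t, of y] by (simp add: s_def D_def)
    obtain Y where Yc: "continuous_on UNIV Y" and Y0: "\<And>x. v t x = D 0 (Y x)"
      and d1: "\<And>x. (v t has_real_derivative D 1 (Y x) / (1 + s * D 1 (Y x))) (at x)"
      and d2: "\<And>x. ((\<lambda>x. D 1 (Y x) / (1 + s * D 1 (Y x))) has_real_derivative D 2 (Y x) / (1 + s * D 1 (Y x)) ^ 3) (at x)"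
      and d3: "\<And>x. ((\<lambda>x. D 2 (Y x) / (1 + s * D 1 (Y x)) ^ 3) has_real_derivative
        D 3 (Y x) / (1 + s * D 1 (Y x)) ^ 4 - 3 * s * (D 2 (Y x))\<^sup>2 / (1 + s * D 1 (Y x)) ^ 5) (at x)"
      by (rule composition_deriv[OF D C(2)[of 0] s(1) \<delta>(1) \<delta>s vf]) blast
    have p0: "1 + s * D 1 y \<noteq> 0" for y using \<delta>s[of y] \<delta>(1) by linarith
    have DY: "continuous_on UNIV (\<lambda>x. D n (Y x))" for n by (rule continuous_on_compose2[OF Dc Yc]) auto
    have c1: "continuous_on UNIV (\<lambda>x. D 1 (Y x) / (1 + s * D 1 (Y x)))"
      and c2: "continuous_on UNIV (\<lambda>x. D 2 (Y x) / (1 + s * D 1 (Y x)) ^ 3)"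
      and c3: "continuous_on UNIV (\<lambda>x. D 3 (Y x) / (1 + s * D 1 (Y x)) ^ 4 - 3 * s * (D 2 (Y x))\<^sup>2 / (1 + s * D 1 (Y x)) ^ 5)"
      using p0 by (auto intro!: continuous_intros DY)
    note q1 = periodic_deriv[OF per d1]
    note q2 = periodic_deriv[OF q1 d2]
    have F: "fourier (\<lambda>x. D 3 (Y x) / (1 + s * D 1 (Y x)) ^ 4 - 3 * s * (D 2 (Y x))\<^sup>2 / (1 + s * D 1 (Y x)) ^ 5) k
        = (\<i> * of_int k) ^ 3 * fourier (v t) k" for k
      unfolding fourier_deriv[OF q2 d3 c3] fourier_deriv[OF q1 d2 c2] fourier_deriv[OF per d1 c1]
      by (simp add: power3_eq_cube)
    have b: "\<bar>D 3 y / (1 + s * D 1 y) ^ 4 - 3 * s * (D 2 y)\<^sup>2 / (1 + s * D 1 y) ^ 5\<bar> \<le> C3" for y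
    proof -
      let ?p = "1 + s * D 1 y"
      have "\<bar>D 3 y / ?p ^ 4 - 3 * s * (D 2 y)\<^sup>2 / ?p ^ 5\<bar> \<le> \<bar>D 3 y / ?p ^ 4\<bar> + \<bar>3 * s * (D 2 y)\<^sup>2 / ?p ^ 5\<bar>" by (rule abs_triangle_ineq4)
      also have "\<bar>D 3 y / ?p ^ 4\<bar> \<le> C 3 / \<delta> ^ 4"
        unfolding abs_divide power_abs using \<delta>s[of y] \<delta>(1) C by (intro frac_le power_mono) (auto intro!: zero_less_power)
      also have "\<bar>3 * s * (D 2 y)\<^sup>2 / ?p ^ 5\<bar> \<le> 18 * T * (C 2)\<^sup>2 / \<delta> ^ 5"
        unfolding abs_divide power_abs
      proof (intro frac_le power_mono)
        have "(D 2 y)\<^sup>2 \<le> (C 2)\<^sup>2" using power_mono[OF C(2)[of 2 y], of 2] by simp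
        hence "(3 * s) * (D 2 y)\<^sup>2 \<le> (18 * T) * (C 2)\<^sup>2" using mult_mono[of "3 * s" "18 * T" "(D 2 y)\<^sup>2" "(C 2)\<^sup>2"] s T by auto
        thus "\<bar>3 * s * (D 2 y)\<^sup>2\<bar> \<le> 18 * T * (C 2)\<^sup>2" using s by (simp add: abs_mult)
      qed (use \<delta>s[of y] \<delta>(1) T in auto)
      finally show ?thesis by (simp add: C3_def)
    qed
    have c0: "continuous_on UNIV (v t)" using d1 by (intro continuous_at_imp_continuous_on ballI DERIV_isCont) blast
    have "cmod (fourier (v t) k) \<le> C 0" for k
      using C(2)[of 0] Y0 by (intro fourier_bound circ_continuous(1) continuous_on_subset[OF c0]) auto
    moreover have "cmod (fourier (v t) k) * \<bar>real_of_int k\<bar> ^ 3 \<le> C3" for k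
    proof -
      have "cmod ((\<i> * of_int k) ^ 3 * fourier (v t) k) \<le> C3"
        unfolding F[symmetric] by (intro fourier_bound circ_continuous(1) continuous_on_subset[OF c3] b) auto
      thus ?thesis by (simp add: norm_mult norm_power mult.commute)
    qed
    ultimately show ?thesis by (rule decay_from_powers)
  qed
  thus ?thesis by blast
qed

text \<open>Fourier form of u u_x = (u^2)_x / 2: adding the convolution with its factors exchanged
  makes the multipliers a and k - a sum to k.\<close>

lemma conv_derivative:
  assumes x: "wiener x"
  shows "conv x (\<lambda>k. \<i> * of_int k * x k) k = \<i> * of_int k / 2 * conv x x k"
proof -
  define y where "y = (\<lambda>k. \<i> * of_int k * x k)"
  define B where "B = wnorm x"
  have yJ: "cmod (y k) \<le> J k * cmod (x k)" for k
    unfolding y_def by (auto simp: norm_mult intro!: mult_right_mono abs_le_J)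
  have yB: "cmod (y k) \<le> B" for k
    using yJ[of k] finite_sum_le_infsum[OF x, of "{k}"] J_pos by (simp add: less_imp_le B_def)
  have yx: "(\<lambda>a. y a * x (k - a)) summable_on UNIV"
  proof (rule abs_summable_summable, rule Infinite_Sum.abs_summable_on_comparison_test'[OF summable_on_cmult_left[OF x]])
    show "norm (y a * x (k - a)) \<le> J a * cmod (x a) * B" for a
      unfolding norm_mult B_def using yJ[of a] summable_of_J(2)[OF x, of "k - a"] J_pos[of a]
      by (intro mult_mono) auto
  qed
  have xy: "(\<lambda>a. x a * y (k - a)) summable_on UNIV"
  proof (rule abs_summable_summable, rule Infinite_Sum.abs_summable_on_comparison_test'[OF summable_on_cmult_left[OF summable_of_J(1)[OF x]]])
    show "norm (x a * y (k - a)) \<le> cmod (x a) * B" for a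
      unfolding norm_mult by (intro mult_left_mono yB) auto
  qed
  have "conv x y k + conv y x k = (\<Sum>\<^sub>\<infinity>a. x a * y (k - a) + y a * x (k - a))"
    unfolding conv_def by (rule infsum_add[OF xy yx, symmetric])
  also have "\<dots> = (\<Sum>\<^sub>\<infinity>a. \<i> * of_int k * (x a * x (k - a)))"
    by (rule infsum_cong) (simp add: y_def algebra_simps)
  also have "\<dots> = \<i> * of_int k * conv x x k" unfolding infsum_cmult_right' conv_def ..
  finally show ?thesis using conv_commute[of y x k] by (simp add: y_def field_simps)
qed

text \<open>Dominated convergence for series: a finite sum tends to 0, and the tail of
  \<open>g\<close> takes care of the rest.\<close>

lemma infsum_tendsto_zero:
  fixes f :: "real \<Rightarrow> int \<Rightarrow> real"
  assumes f: "\<And>s k. s \<in> S \<Longrightarrow> 0 \<le> f s k" "\<And>s k. s \<in> S \<Longrightarrow> f s k \<le> g k" and g: "g summable_on UNIV"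
    and lim: "\<And>k. ((\<lambda>s. f s k) \<longlongrightarrow> 0) (at t within S)"
  shows "((\<lambda>s. \<Sum>\<^sub>\<infinity>k. f s k) \<longlongrightarrow> 0) (at t within S)"
proof (rule tendstoI)
  fix e :: real assume e: "0 < e"
  obtain K where K: "finite K" "infsum g (- K) < e / 2" using small_tail[OF g, of "e / 2"] e by auto
  have "((\<lambda>s. \<Sum>k\<in>K. f s k) \<longlongrightarrow> (\<Sum>k\<in>K. 0)) (at t within S)" by (intro tendsto_sum lim)
  hence "\<forall>\<^sub>F s in at t within S. (\<Sum>k\<in>K. f s k) < e / 2" using e by (intro order_tendstoD(2)) auto
  moreover have "\<forall>\<^sub>F s in at t within S. s \<in> S" by (simp add: eventually_at_filter)
  ultimately show "\<forall>\<^sub>F s in at t within S. dist (\<Sum>\<^sub>\<infinity>k. f s k) 0 < e"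
  proof eventually_elim
    case (elim s)
    have fs: "f s summable_on UNIV" by (rule summable_on_comparison_test[OF g]) (use f elim in auto)
    have "infsum (f s) UNIV = (\<Sum>k\<in>K. f s k) + infsum (f s) (- K)" by (rule infsum_Compl_finite(1)[OF fs K(1)])
    also have "infsum (f s) (- K) \<le> infsum g (- K)"
      by (rule infsum_mono[OF infsum_Compl_finite(2)[OF fs K(1)] infsum_Compl_finite(2)[OF g K(1)]]) (use f elim in auto)
    finally have "infsum (f s) UNIV < e" using elim K(2) by linarith
    moreover have "0 \<le> infsum (f s) UNIV" by (intro infsum_nonneg) (use f elim in auto)
    ultimately show ?case by simp
  qed
qed

text \<open>A classical solution becomes a solution in the sense of \<open>fsol\<close> with \<beta>
  = 0. The symbol \<theta> stays free so that the Burgers solution can serve as reference for the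
  dispersive family with its own symbol.\<close>

lemma burgers_fsol:
  assumes u0: "smooth u0" "periodic2pi u0" and T: "0 < T" "ereal T < critical_time u0"
    and v: "burgers_sol T u0 v"
  shows "fsol 0 \<theta> T (\<lambda>t. fourier (v t))"
    and "\<And>t. t \<in> {0..T} \<Longrightarrow> integrable circ (v t)"
    and "\<And>k. fourier (v 0) k = fourier u0 k"
proof -
  obtain vt vx where per: "\<And>t. periodic2pi (v t)"
    and vt: "\<And>t x. t \<in> {0..T} \<Longrightarrow> ((\<lambda>s. v s x) has_real_derivative vt t x) (at t within {0..T})"
    and vx: "\<And>t x. t \<in> {0..T} \<Longrightarrow> (v t has_real_derivative vx t x) (at x)"
    and eq: "\<And>t x. t \<in> {0..T} \<Longrightarrow> vt t x + 6 * v t x * vx t x = 0"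
    and ct: "continuous_on ({0..T} \<times> UNIV) (\<lambda>(t, x). vt t x)"
    and cx: "continuous_on ({0..T} \<times> UNIV) (\<lambda>(t, x). vx t x)"
    and v0: "\<And>x. v 0 x = u0 x"
    using v unfolding burgers_sol_def by blast
  show "fourier (v 0) k = fourier u0 k" for k
  proof -
    have "v 0 = u0" using v0 by auto
    thus ?thesis by simp
  qed
  have char: "v t (y + 6 * t * u0 y) = u0 y" if "t \<in> {0..T}" for t y
    using burgers_characteristic[OF vt vx eq cx that, of y] v0 by simp
  obtain M where M: "\<And>t k. t \<in> {0..T} \<Longrightarrow> cmod (fourier (v t) k) * J k ^ 3 \<le> M"
    using burgers_decay[OF u0 T per char] by blast
  have vc: "continuous_on S (v t)" if "t \<in> {0..T}" for t S
    using vx[OF that] by (intro continuous_at_imp_continuous_on ballI DERIV_isCont) blast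
  have vxc: "continuous_on S (vx t)" if "t \<in> {0..T}" for t S
  proof -
    have "continuous_on S (\<lambda>x. (\<lambda>(t, x). vx t x) (t, x))"
      by (rule continuous_on_compose2[OF cx]) (use that in \<open>auto intro!: continuous_intros\<close>)
    thus ?thesis by simp
  qed
  show vi: "integrable circ (v t)" if "t \<in> {0..T}" for t by (rule circ_continuous(1)[OF vc[OF that]])
  have vxi: "integrable circ (vx t)" if "t \<in> {0..T}" for t by (rule circ_continuous(1)[OF vxc[OF that]])
  have Jb: "J k * cmod (fourier (v t) k) * (J k)\<^sup>2 \<le> M" if "t \<in> {0..T}" for t k
    using M[OF that, of k] by (simp add: power2_eq_square power3_eq_cube mult_ac)
  have summ: "wiener (fourier (v t))" if "t \<in> {0..T}" for t
    by (rule summable_J_decay(1)[OF _ Jb[OF that]]) (simp add: J_pos less_imp_le)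
  \<comment> \<open>Differentiation under the integral sign, allowed by joint continuity of
    \<open>vt\<close>, followed by the product formula and \<open>conv_derivative\<close>.\<close>
  have ode: "((\<lambda>s. fourier (v s) k) has_vector_derivative rhs 0 \<theta> (fourier (v t)) k) (at t within {0..T})" if t: "t \<in> {0..T}" for t k
  proof -
    let ?e = "\<lambda>x. cis (- (of_int k * x))"
    have F: "fourier (v s) k = of_real (1 / (2 * pi)) * integral (cbox (-pi) pi) (\<lambda>x. complex_of_real (v s x) * ?e x)"
      if "s \<in> {0..T}" for s
      unfolding fourier_circ by (subst circ_continuous(2)) (auto intro!: continuous_intros vc[OF that])
    have "((\<lambda>s. integral (cbox (-pi) pi) (\<lambda>x. complex_of_real (v s x) * ?e x)) has_vector_derivative
        integral (cbox (-pi) pi) (\<lambda>x. complex_of_real (vt t x) * ?e x)) (at t within {0..T})"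
    proof (rule leibniz_rule_vector_derivative)
      show "((\<lambda>s. complex_of_real (v s x) * ?e x) has_vector_derivative complex_of_real (vt s x) * ?e x) (at s within {0..T})" if "s \<in> {0..T}" for s x
        by (intro has_vector_derivative_mult_left has_vector_derivative_of_real vt that)
      show "(\<lambda>x. complex_of_real (v s x) * ?e x) integrable_on cbox (-pi) pi" if "s \<in> {0..T}" for s
        by (intro integrable_continuous continuous_intros vc[OF that])
      have "continuous_on ({0..T} \<times> cbox (-pi) pi) (\<lambda>p. complex_of_real ((\<lambda>(t, x). vt t x) p) * ?e (snd p))"
        by (intro continuous_intros continuous_on_subset[OF ct]) auto
      thus "continuous_on ({0..T} \<times> cbox (-pi) pi) (\<lambda>(s, x). complex_of_real (vt s x) * ?e x)" by (simp add: case_prod_unfold)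
    qed (use t in auto)
    hence "((\<lambda>s. of_real (1 / (2 * pi)) * integral (cbox (-pi) pi) (\<lambda>x. complex_of_real (v s x) * ?e x)) has_vector_derivative
        of_real (1 / (2 * pi)) * integral (cbox (-pi) pi) (\<lambda>x. complex_of_real (vt t x) * ?e x)) (at t within {0..T})"
      by (rule has_vector_derivative_mult_right)
    hence "((\<lambda>s. fourier (v s) k) has_vector_derivative
        of_real (1 / (2 * pi)) * integral (cbox (-pi) pi) (\<lambda>x. complex_of_real (vt t x) * ?e x)) (at t within {0..T})"
      by (rule has_vector_derivative_transform[OF t, rotated]) (rule F)
    moreover have "of_real (1 / (2 * pi)) * integral (cbox (-pi) pi) (\<lambda>x. complex_of_real (vt t x) * ?e x) = rhs 0 \<theta> (fourier (v t)) k"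
    proof -
      \<comment> \<open>The term with factor 0 brings the equation into the shape of
        \<open>fourier_lincomb\<close>.\<close>
      have vtq: "vt t = (\<lambda>x. (- 6) * (v t x * vx t x) + 0 * v t x)"
      proof
        fix x show "vt t x = (- 6) * (v t x * vx t x) + 0 * v t x" using eq[OF t, of x] by simp
      qed
      have vvi: "integrable circ (\<lambda>x. v t x * vx t x)" by (intro circ_continuous(1) continuous_intros vc[OF t] vxc[OF t])
      have "of_real (1 / (2 * pi)) * integral (cbox (-pi) pi) (\<lambda>x. complex_of_real (vt t x) * ?e x) = fourier (vt t) k"
        unfolding fourier_circ vtq by (subst circ_continuous(2)) (auto intro!: continuous_intros vc[OF t] vxc[OF t])
      also have "\<dots> = - 6 * fourier (\<lambda>x. v t x * vx t x) k"
        unfolding vtq fourier_lincomb[OF vvi vi[OF t]] by simp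
      also have "fourier (\<lambda>x. v t x * vx t x) k = conv (fourier (v t)) (fourier (vx t)) k"
        by (rule fourier_mult[OF vi[OF t] summable_of_J(1)[OF summ[OF t]] vxi[OF t]])
      also have "fourier (vx t) = (\<lambda>k. \<i> * of_int k * fourier (v t) k)"
        using fourier_deriv[OF per vx[OF t] vxc[OF t]] by auto
      finally show ?thesis unfolding conv_derivative[OF summ[OF t]] by (simp add: rhs_def)
    qed
    ultimately show ?thesis by simp
  qed
  show "fsol 0 \<theta> T (\<lambda>t. fourier (v t))"
    unfolding fsol_def
  proof (intro ballI conjI allI)
    fix t assume t: "t \<in> {0..T}"
    show "fourier (v t) (- k) = cnj (fourier (v t) k)" for k by (rule fourier_minus)
    show "wiener (fourier (v t))" by (rule summ[OF t])
    show "((\<lambda>s. fourier (v s) k) has_vector_derivative rhs 0 \<theta> (fourier (v t)) k) (at t within {0..T})" for k by (rule ode[OF t])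
    show "((\<lambda>s. wdist (fourier (v s)) (fourier (v t))) \<longlongrightarrow> 0) (at t within {0..T})"
    \<comment> \<open>Each coefficient is continuous in time because it is differentiable, and the
      third-order decay gives the summable majorant 2 M / J^2.\<close>
    proof (rule infsum_tendsto_zero)
      show "0 \<le> J k * cmod (fourier (v s) k - fourier (v t) k)" for s k by (simp add: J_pos less_imp_le)
      show "(\<lambda>k. (2 * M) * (1 / (J k)\<^sup>2)) summable_on UNIV"
        by (rule summable_on_cmult_right[OF summable_inverse_J_square])
      show "J k * cmod (fourier (v s) k - fourier (v t) k) \<le> (2 * M) * (1 / (J k)\<^sup>2)" if s: "s \<in> {0..T}" for s k
      proof -
        have "J k * cmod (fourier (v s) k - fourier (v t) k) \<le> J k * (cmod (fourier (v s) k) + cmod (fourier (v t) k))"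
          using J_pos[of k] by (intro mult_left_mono norm_triangle_ineq4) simp
        hence "J k * cmod (fourier (v s) k - fourier (v t) k) * (J k)\<^sup>2 \<le> J k * (cmod (fourier (v s) k) + cmod (fourier (v t) k)) * (J k)\<^sup>2"
          by (rule mult_right_mono) simp
        also have "\<dots> \<le> 2 * M" using Jb[OF s, of k] Jb[OF t, of k] by (simp add: distrib_left distrib_right)
        finally show ?thesis using J_pos[of k] by (simp add: pos_le_divide_eq)
      qed
      fix k
      have "continuous (at t within {0..T}) (\<lambda>s. fourier (v s) k)" by (rule has_vector_derivative_continuous[OF ode[OF t]])
      hence "((\<lambda>s. fourier (v s) k) \<longlongrightarrow> fourier (v t) k) (at t within {0..T})" by (simp add: continuous_within)
      hence "((\<lambda>s. J k * cmod (fourier (v s) k - fourier (v t) k)) \<longlongrightarrow> J k * cmod (fourier (v t) k - fourier (v t) k)) (at t within {0..T})"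
        by (intro tendsto_intros)
      thus "((\<lambda>s. J k * cmod (fourier (v s) k - fourier (v t) k)) \<longlongrightarrow> 0) (at t within {0..T})" by simp
    qed
  qed
qed

section \<open>Sobolev norms and the fractional KdV equation\<close>

lemma bracket_le_J: "1 + (of_int k)\<^sup>2 \<le> (J k)\<^sup>2"
  by (simp add: J_def power2_sum)

lemma J_square_le: "(J k)\<^sup>2 \<le> 2 * (1 + (of_int k)\<^sup>2)"
  using sum_squares_bound[of 1 "\<bar>real_of_int k\<bar>"] by (simp add: J_def power2_sum)

lemma bracket_powr_le: "0 \<le> r \<Longrightarrow> (1 + (of_int k)\<^sup>2) powr r \<le> J k powr (2 * r)"
proof -
  assume r: "0 \<le> r"
  have "(1 + (of_int k)\<^sup>2) powr r \<le> ((J k)\<^sup>2) powr r" by (intro powr_mono2 r bracket_le_J) simp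
  also have "\<dots> = J k powr (2 * r)"
    using J_pos[of k] powr_powr[of "J k" 2 r] powr_realpow[OF J_pos, of k 2] by simp
  finally show ?thesis .
qed

lemma bracket_powr_ge_1: "0 \<le> r \<Longrightarrow> 1 \<le> (1 + (real_of_int k)\<^sup>2) powr r"
  by (rule ge_one_powr_ge_zero) auto

section \<open>Sobolev norms against the Wiener norm\<close>

lemma weighted_square_lincomb:
  fixes x y :: "int \<Rightarrow> complex" and \<rho> :: "int \<Rightarrow> real"
  assumes "(\<lambda>k. \<rho> k * (cmod (x k))\<^sup>2) summable_on UNIV" "(\<lambda>k. \<rho> k * (cmod (y k))\<^sup>2) summable_on UNIV" "\<And>k. 0 \<le> \<rho> k"
  shows "(\<lambda>k. \<rho> k * (cmod (a * x k + b * y k))\<^sup>2) summable_on UNIV"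
proof (rule summable_on_comparison_test)
  show "(\<lambda>k. 2 * (cmod a)\<^sup>2 * (\<rho> k * (cmod (x k))\<^sup>2) + 2 * (cmod b)\<^sup>2 * (\<rho> k * (cmod (y k))\<^sup>2)) summable_on UNIV"
    by (intro summable_on_add summable_on_cmult_right assms)
  fix k
  have "(cmod (a * x k + b * y k))\<^sup>2 \<le> (cmod (a * x k) + cmod (b * y k))\<^sup>2"
    by (intro power_mono norm_triangle_ineq) simp
  also have "\<dots> \<le> 2 * (cmod (a * x k))\<^sup>2 + 2 * (cmod (b * y k))\<^sup>2"
    using sum_squares_bound[of "cmod (a * x k)" "cmod (b * y k)"] by (simp add: power2_sum)
  finally have "\<rho> k * (cmod (a * x k + b * y k))\<^sup>2 \<le> \<rho> k * (2 * (cmod (a * x k))\<^sup>2 + 2 * (cmod (b * y k))\<^sup>2)"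
    by (intro mult_left_mono assms(3))
  thus "\<rho> k * (cmod (a * x k + b * y k))\<^sup>2 \<le> 2 * (cmod a)\<^sup>2 * (\<rho> k * (cmod (x k))\<^sup>2) + 2 * (cmod b)\<^sup>2 * (\<rho> k * (cmod (y k))\<^sup>2)"
    by (simp add: norm_mult power_mult_distrib algebra_simps)
qed (use assms(3) in simp)

text \<open>Sobolev embedding into the Wiener class: write J |x| as the product of 1 / J and J^2
  |x|, with J^4 \<le> 4 (1 + k^2)^2 and r \<ge> 2. Balancing with a parameter h of the size of the
  norm makes the bound linear in the norm.\<close>

lemma sobolev_wiener:
  fixes x :: "int \<Rightarrow> complex"
  assumes r: "2 \<le> r" and x: "(\<lambda>k. (1 + (of_int k)\<^sup>2) powr r * (cmod (x k))\<^sup>2) summable_on UNIV"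
  shows "wiener x"
    and "wnorm x \<le> (Z2 / 2 + 2) * sqrt (\<Sum>\<^sub>\<infinity>k. (1 + (of_int k)\<^sup>2) powr r * (cmod (x k))\<^sup>2)"
proof -
  define S where "S = (\<Sum>\<^sub>\<infinity>k. (1 + (of_int k)\<^sup>2) powr r * (cmod (x k))\<^sup>2)"
  have S: "0 \<le> S" unfolding S_def by (intro infsum_nonneg) simp
  have fin: "(\<Sum>k\<in>K. J k * cmod (x k)) \<le> (Z2 / 2 + 2) * h" if h: "0 < h" "S \<le> h\<^sup>2" and K: "finite K" for h K
  proof -
    have "J k * cmod (x k) \<le> (h / 2) * (1 / (J k)\<^sup>2) + (2 / h) * ((1 + (of_int k)\<^sup>2) powr r * (cmod (x k))\<^sup>2)" for k
    proof -
      have "((J k)\<^sup>2)\<^sup>2 \<le> (2 * (1 + (of_int k)\<^sup>2))\<^sup>2" by (intro power_mono J_square_le) simp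
      also have "\<dots> = 4 * (1 + (of_int k)\<^sup>2) powr 2"
      proof -
        have "(1 + (real_of_int k)\<^sup>2) powr 2 = (1 + (real_of_int k)\<^sup>2)\<^sup>2" by (rule powr_numeral) (simp add: add_pos_nonneg)
        thus ?thesis unfolding power_mult_distrib by simp
      qed
      also have "\<dots> \<le> 4 * (1 + (of_int k)\<^sup>2) powr r" using r by (intro mult_left_mono powr_mono) auto
      finally have J4: "((J k)\<^sup>2)\<^sup>2 \<le> 4 * (1 + (of_int k)\<^sup>2) powr r" .
      have "2 * (h / J k) * ((J k)\<^sup>2 * cmod (x k)) \<le> (h / J k)\<^sup>2 + ((J k)\<^sup>2 * cmod (x k))\<^sup>2"
        by (rule sum_squares_bound)
      also have "((J k)\<^sup>2 * cmod (x k))\<^sup>2 \<le> 4 * (1 + (of_int k)\<^sup>2) powr r * (cmod (x k))\<^sup>2"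
        unfolding power_mult_distrib[of "(J k)\<^sup>2"] by (intro mult_right_mono J4) simp
      finally have "2 * (h / J k) * ((J k)\<^sup>2 * cmod (x k)) \<le> (h / J k)\<^sup>2 + 4 * (1 + (of_int k)\<^sup>2) powr r * (cmod (x k))\<^sup>2" by simp
      hence "(1 / (2 * h)) * (2 * (h / J k) * ((J k)\<^sup>2 * cmod (x k))) \<le> (1 / (2 * h)) * ((h / J k)\<^sup>2 + 4 * (1 + (of_int k)\<^sup>2) powr r * (cmod (x k))\<^sup>2)"
        using h by (intro mult_left_mono) auto
      moreover have "(1 / (2 * h)) * (2 * (h / J k) * ((J k)\<^sup>2 * cmod (x k))) = J k * cmod (x k)"
        using h J_pos[of k] by (simp add: field_simps power2_eq_square)
      moreover have "(1 / (2 * h)) * (h / J k)\<^sup>2 = (h / 2) * (1 / (J k)\<^sup>2)"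
        using h J_pos[of k] by (simp add: field_simps power2_eq_square)
      ultimately show ?thesis by (simp add: distrib_left mult.commute)
    qed
    hence "(\<Sum>k\<in>K. J k * cmod (x k)) \<le> (\<Sum>k\<in>K. (h / 2) * (1 / (J k)\<^sup>2) + (2 / h) * ((1 + (of_int k)\<^sup>2) powr r * (cmod (x k))\<^sup>2))"
      by (rule sum_mono)
    also have "\<dots> = (h / 2) * (\<Sum>k\<in>K. 1 / (J k)\<^sup>2) + (2 / h) * (\<Sum>k\<in>K. (1 + (of_int k)\<^sup>2) powr r * (cmod (x k))\<^sup>2)"
      by (simp only: sum.distrib sum_distrib_left)
    also have "\<dots> \<le> (h / 2) * Z2 + (2 / h) * h\<^sup>2"
      using finite_sum_le_infsum[OF summable_inverse_J_square K] finite_sum_le_infsum[OF x K] h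
      by (intro add_mono mult_left_mono) (auto simp: Z2_def S_def)
    also have "\<dots> = (Z2 / 2 + 2) * h" using h by (simp add: field_simps power2_eq_square)
    finally show ?thesis .
  qed
  have nn: "0 \<le> J k * cmod (x k)" for k by (simp add: J_pos less_imp_le)
  \<comment> \<open>The parameter must be positive even when the norm is 0; the surplus e tends to 0
    at the end.\<close>
  have h1: "0 < sqrt S + e" "S \<le> (sqrt S + e)\<^sup>2" if "0 < e" for e
  proof -
    show "0 < sqrt S + e" using that S by (simp add: add_nonneg_pos)
    have "(sqrt S)\<^sup>2 \<le> (sqrt S + e)\<^sup>2" using that S by (intro power_mono) auto
    thus "S \<le> (sqrt S + e)\<^sup>2" using S by simp
  qed
  show s: "wiener x"
    by (rule nonneg_summable_bound(1)[OF nn fin[OF h1[of 1]]]) auto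
  have "wnorm x \<le> (Z2 / 2 + 2) * (sqrt S + e)" if "0 < e" for e
    by (rule nonneg_summable_bound(2)[OF nn fin[OF h1[OF that]]])
  note le = this
  have "((\<lambda>e. (Z2 / 2 + 2) * (sqrt S + e)) \<longlongrightarrow> (Z2 / 2 + 2) * (sqrt S + 0)) (at_right 0)" by (intro tendsto_intros)
  hence "wnorm x \<le> (Z2 / 2 + 2) * (sqrt S + 0)"
    by (rule tendsto_lowerbound) (auto intro!: eventually_at_rightI[of 0 1] le)
  thus "wnorm x \<le> (Z2 / 2 + 2) * sqrt (\<Sum>\<^sub>\<infinity>k. (1 + (of_int k)\<^sup>2) powr r * (cmod (x k))\<^sup>2)"
    by (simp add: S_def)
qed

lemma H_norm_0: "H_norm 0 f = sqrt (\<Sum>\<^sub>\<infinity>k. (cmod (fourier f k))\<^sup>2)"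
proof -
  have "(1 + (real_of_int k)\<^sup>2) powr 0 = 1" for k
  proof -
    have "1 + (real_of_int k)\<^sup>2 \<noteq> 0" using zero_le_power2[of "real_of_int k"] by linarith
    thus ?thesis by simp
  qed
  thus ?thesis by (simp add: H_norm_def)
qed

lemma in_H_coeffs:
  "in_H r f \<Longrightarrow> (\<lambda>k. (1 + (of_int k)\<^sup>2) powr r * (cmod (fourier f k))\<^sup>2) summable_on UNIV"
  by (simp add: in_H_def)

lemma in_H_l2:
  assumes "in_H r f" "0 \<le> r" shows "(\<lambda>k. (cmod (fourier f k))\<^sup>2) summable_on UNIV"
proof (rule summable_on_comparison_test[OF in_H_coeffs[OF assms(1)]])
  fix k show "(cmod (fourier f k))\<^sup>2 \<le> (1 + (of_int k)\<^sup>2) powr r * (cmod (fourier f k))\<^sup>2"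
    using mult_right_mono[OF bracket_powr_ge_1[OF assms(2)], of "(cmod (fourier f k))\<^sup>2" k] by simp
qed simp

lemma has_vector_derivative_quotientI:
  fixes f :: "real \<Rightarrow> 'a :: real_normed_vector"
  assumes "((\<lambda>s. (f s - f t) /\<^sub>R (s - t) - D) \<longlongrightarrow> 0) (at t within S)"
  shows "(f has_vector_derivative D) (at t within S)"
  unfolding has_vector_derivative_def has_derivative_iff_norm
proof (intro conjI bounded_linear_scaleR_left)
  have "((\<lambda>s. norm ((f s - f t) /\<^sub>R (s - t) - D)) \<longlongrightarrow> 0) (at t within S)" by (rule tendsto_norm_zero[OF assms])
  moreover have "\<forall>\<^sub>F s in at t within S. norm ((f s - f t) /\<^sub>R (s - t) - D) = norm (f s - f t - (s - t) *\<^sub>R D) / norm (s - t)"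
    unfolding eventually_at_filter
  proof (intro always_eventually allI impI)
    fix s assume s: "s \<noteq> t"
    have "(f s - f t) /\<^sub>R (s - t) - D = (f s - f t - (s - t) *\<^sub>R D) /\<^sub>R (s - t)"
      using s by (simp add: scaleR_diff_right)
    thus "norm ((f s - f t) /\<^sub>R (s - t) - D) = norm (f s - f t - (s - t) *\<^sub>R D) / norm (s - t)"
      by (simp add: divide_inverse mult.commute)
  qed
  ultimately show "((\<lambda>s. norm (f s - f t - (s - t) *\<^sub>R D) / norm (s - t)) \<longlongrightarrow> 0) (at t within S)"
    by (rule Lim_transform_eventually)
qed

text \<open>The operator taking u to D^\<alpha> u_x multiplies the k-th coefficient by i times this
  real odd number; being real, it makes the dispersive term skew.\<close>

definition fkdv_symbol :: "real \<Rightarrow> int \<Rightarrow> real" where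
  "fkdv_symbol \<alpha> k = of_int k * \<bar>of_int k\<bar> powr \<alpha>"

lemma fkdv_symbol_le: "0 \<le> \<alpha> \<Longrightarrow> \<bar>fkdv_symbol \<alpha> k\<bar> \<le> J k powr (1 + \<alpha>)"
proof -
  assume \<alpha>: "0 \<le> \<alpha>"
  have "\<bar>fkdv_symbol \<alpha> k\<bar> = \<bar>of_int k\<bar> * \<bar>of_int k\<bar> powr \<alpha>" by (simp add: fkdv_symbol_def abs_mult)
  also have "\<dots> \<le> J k * J k powr \<alpha>" using J_pos[of k] by (intro mult_mono powr_mono2 \<alpha> abs_le_J) auto
  also have "\<dots> = J k powr (1 + \<alpha>)" using J_pos[of k] by (simp add: powr_add)
  finally show ?thesis .
qed

text \<open>Passage from the Sobolev formulation to coefficients. The fourth conclusion expresses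
  \<open>du\<close> through \<open>rhs\<close>, so that convergence of time derivatives can be read
  off on the Fourier side.\<close>

lemma fkdv_fsol:
  assumes \<alpha>: "1 \<le> \<alpha>" and sol: "fkdv_sol \<alpha> \<epsilon> T u0 u du" and u0: "in_H (1 + \<alpha>) u0" and T: "0 < T"
  shows "fsol (\<epsilon>\<^sup>2) (fkdv_symbol \<alpha>) T (\<lambda>t. fourier (u t))"
    and "\<And>t. t \<in> {0..T} \<Longrightarrow> integrable circ (u t)"
    and "\<And>t. t \<in> {0..T} \<Longrightarrow> integrable circ (du t)"
    and "\<And>t k. t \<in> {0..T} \<Longrightarrow> fourier (du t) k = rhs (\<epsilon>\<^sup>2) (fkdv_symbol \<alpha>) (fourier (u t)) k"
    and "\<And>k. fourier (u 0) k = fourier u0 k"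
proof -
  have uH: "in_H (1 + \<alpha>) (u t)" and duH: "in_H 0 (du t)"
    and ucont: "((\<lambda>s. H_norm (1 + \<alpha>) (\<lambda>x. u s x - u t x)) \<longlongrightarrow> 0) (at t within {0..T})"
    and uderiv: "((\<lambda>s. H_norm 0 (\<lambda>x. (u s x - u t x) / (s - t) - du t x)) \<longlongrightarrow> 0) (at t within {0..T})"
    and upde: "\<exists>ux Dux. weak_deriv (u t) ux \<and> frac_D \<alpha> ux Dux \<and>
        (AE x in lborel. x \<in> {-pi..pi} \<longrightarrow> du t x + 6 * u t x * ux x - \<epsilon>\<^sup>2 * Dux x = 0)"
    if "t \<in> {0..T}" for t
    using sol that unfolding fkdv_sol_def by blast+
  have init: "AE x in lborel. x \<in> {-pi..pi} \<longrightarrow> u 0 x = u0 x" using sol unfolding fkdv_sol_def by blast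
  have r: "2 \<le> 1 + \<alpha>" "0 \<le> 1 + \<alpha>" using \<alpha> by auto
  show ui: "integrable circ (u t)" if "t \<in> {0..T}" for t by (rule in_H_integrable(3)[OF uH[OF that]])
  show dui: "integrable circ (du t)" if "t \<in> {0..T}" for t by (rule in_H_integrable(3)[OF duH[OF that]])
  show "fourier (u 0) k = fourier u0 k" for k
  proof (rule fourier_cong_AE)
    show "AE x in circ. u 0 x = u0 x" using init by (subst AE_restrict_space_iff) auto
    show "integrable circ (u 0)" by (rule ui) (use T in auto)
    show "integrable circ u0" by (rule in_H_integrable(3)[OF u0])
  qed
  have summ: "wiener (fourier (u t))" if "t \<in> {0..T}" for t
    by (rule sobolev_wiener(1)[OF r(1) in_H_coeffs[OF uH[OF that]]])
  have dH: "(\<lambda>k. (1 + (of_int k)\<^sup>2) powr (1 + \<alpha>) * (cmod (fourier (u s) k - fourier (u t) k))\<^sup>2) summable_on UNIV"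
    if "s \<in> {0..T}" "t \<in> {0..T}" for s t
    using weighted_square_lincomb[OF in_H_coeffs[OF uH[OF that(1)]] in_H_coeffs[OF uH[OF that(2)]], of 1 "- 1"] by simp
  have fd: "fourier (\<lambda>x. u s x - u t x) k = fourier (u s) k - fourier (u t) k" if "s \<in> {0..T}" "t \<in> {0..T}" for s t k
    by (rule fourier_diff[OF ui[OF that(1)] ui[OF that(2)]])
  show pde: "fourier (du t) k = rhs (\<epsilon>\<^sup>2) (fkdv_symbol \<alpha>) (fourier (u t)) k" if t: "t \<in> {0..T}" for t k
  proof -
    obtain ux Dux where ux: "weak_deriv (u t) ux" and Dux: "frac_D \<alpha> ux Dux"
      and ae: "AE x in lborel. x \<in> {-pi..pi} \<longrightarrow> du t x + 6 * u t x * ux x - \<epsilon>\<^sup>2 * Dux x = 0"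
      using upde[OF t] by blast
    have uxH: "in_H 0 ux" and uxf: "fourier ux = (\<lambda>k. \<i> * of_int k * fourier (u t) k)"
      using ux by (auto simp: weak_deriv_def)
    have DuxH: "in_H 0 Dux" and Duxf: "fourier Dux k = of_real (\<bar>of_int k\<bar> powr \<alpha>) * fourier ux k"
      using Dux by (auto simp: frac_D_def)
    have uui: "integrable circ (\<lambda>x. u t x * ux x)"
      by (rule square_integrable_mult[OF in_H_integrable(1)[OF uH[OF t]] in_H_integrable(1)[OF uxH] in_H_integrable(2)[OF uH[OF t]] in_H_integrable(2)[OF uxH]])
    have Di: "integrable circ Dux" by (rule in_H_integrable(3)[OF DuxH])
    have "fourier (du t) k = fourier (\<lambda>x. (- 6) * (u t x * ux x) + \<epsilon>\<^sup>2 * Dux x) k"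
    proof (rule fourier_cong_AE)
      show "AE x in circ. du t x = (- 6) * (u t x * ux x) + \<epsilon>\<^sup>2 * Dux x"
        using ae by (subst AE_restrict_space_iff) (auto elim!: eventually_mono simp: algebra_simps)
      show "integrable circ (\<lambda>x. (- 6) * (u t x * ux x) + \<epsilon>\<^sup>2 * Dux x)" using uui Di by simp
    qed (rule dui[OF t])
    also have "\<dots> = of_real (- 6) * fourier (\<lambda>x. u t x * ux x) k + of_real (\<epsilon>\<^sup>2) * fourier Dux k"
      by (rule fourier_lincomb[OF uui Di])
    also have "fourier (\<lambda>x. u t x * ux x) k = conv (fourier (u t)) (fourier ux) k"
      by (rule fourier_mult[OF ui[OF t] summable_of_J(1)[OF summ[OF t]] in_H_integrable(3)[OF uxH]])
    also have "\<dots> = \<i> * of_int k / 2 * conv (fourier (u t)) (fourier (u t)) k"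
      unfolding uxf by (rule conv_derivative[OF summ[OF t]])
    finally show ?thesis unfolding Duxf uxf by (simp add: rhs_def fkdv_symbol_def)
  qed
  \<comment> \<open>A single coefficient is at most the L2 norm, so convergence of the difference
    quotients in L2 gives the derivative of every coefficient.\<close>
  have deriv: "((\<lambda>s. fourier (u s) k) has_vector_derivative fourier (du t) k) (at t within {0..T})" if t: "t \<in> {0..T}" for t k
  proof -
    have "((\<lambda>s. (fourier (u s) k - fourier (u t) k) /\<^sub>R (s - t) - fourier (du t) k) \<longlongrightarrow> 0) (at t within {0..T})"
    proof (rule Lim_null_comparison[OF _ uderiv[OF t]])
      have "cmod ((fourier (u s) k - fourier (u t) k) /\<^sub>R (s - t) - fourier (du t) k) \<le> H_norm 0 (\<lambda>x. (u s x - u t x) / (s - t) - du t x)"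
        if s: "s \<in> {0..T}" for s
      proof -
        define c where "c = inverse (s - t)"
        define z where "z = (\<lambda>k. of_real c * (fourier (u s) k - fourier (u t) k) + (- 1) * fourier (du t) k)"
        have di: "integrable circ (\<lambda>x. u s x - u t x)" using ui[OF s] ui[OF t] by simp
        have "(\<lambda>x. (u s x - u t x) / (s - t) - du t x) = (\<lambda>x. c * (u s x - u t x) + (- 1) * du t x)"
          by (auto simp: c_def divide_inverse mult.commute)
        hence zf: "fourier (\<lambda>x. (u s x - u t x) / (s - t) - du t x) k = z k" for k
          using fourier_lincomb[OF di dui[OF t], of c "- 1" k] fd[OF s t, of k] by (simp add: z_def)
        have l2: "(\<lambda>k. 1 * (cmod (fourier (u s) k - fourier (u t) k))\<^sup>2) summable_on UNIV"
          using weighted_square_lincomb[of "\<lambda>_. 1" "fourier (u s)" "fourier (u t)" 1 "- 1"]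
            in_H_l2[OF uH[OF s] r(2)] in_H_l2[OF uH[OF t] r(2)] by simp
        have zs: "(\<lambda>k. (cmod (z k))\<^sup>2) summable_on UNIV"
          using weighted_square_lincomb[OF l2, of "fourier (du t)" "of_real c" "- 1"] in_H_l2[OF duH[OF t]] by (simp add: z_def)
        have "(cmod (z k))\<^sup>2 \<le> (\<Sum>\<^sub>\<infinity>k. (cmod (z k))\<^sup>2)" using finite_sum_le_infsum[OF zs, of "{k}"] by simp
        hence "cmod (z k) \<le> H_norm 0 (\<lambda>x. (u s x - u t x) / (s - t) - du t x)"
          unfolding H_norm_0 zf by (rule real_le_rsqrt)
        thus ?thesis by (simp add: z_def c_def scaleR_conv_of_real)
      qed
      thus "\<forall>\<^sub>F s in at t within {0..T}. norm ((fourier (u s) k - fourier (u t) k) /\<^sub>R (s - t) - fourier (du t) k) \<le> H_norm 0 (\<lambda>x. (u s x - u t x) / (s - t) - du t x)"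
        unfolding eventually_at_filter by (intro always_eventually) auto
    qed
    thus ?thesis by (rule has_vector_derivative_quotientI)
  qed
  show "fsol (\<epsilon>\<^sup>2) (fkdv_symbol \<alpha>) T (\<lambda>t. fourier (u t))"
    unfolding fsol_def
  proof (intro ballI conjI allI)
    fix t assume t: "t \<in> {0..T}"
    show "fourier (u t) (- k) = cnj (fourier (u t) k)" for k by (rule fourier_minus)
    show "wiener (fourier (u t))" by (rule summ[OF t])
    show "((\<lambda>s. fourier (u s) k) has_vector_derivative rhs (\<epsilon>\<^sup>2) (fkdv_symbol \<alpha>) (fourier (u t)) k) (at t within {0..T})" for k
      using deriv[OF t, of k] by (simp add: pde[OF t])
    show "((\<lambda>s. wdist (fourier (u s)) (fourier (u t))) \<longlongrightarrow> 0) (at t within {0..T})"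
    proof (rule Lim_null_comparison)
      \<comment> \<open>Continuity in the Sobolev norm implies continuity in the Wiener norm by the
        embedding, whose constant appears here.\<close>
      show "((\<lambda>s. (Z2 / 2 + 2) * H_norm (1 + \<alpha>) (\<lambda>x. u s x - u t x)) \<longlongrightarrow> 0) (at t within {0..T})"
        using tendsto_mult_left[OF ucont[OF t], of "Z2 / 2 + 2"] by simp
      have "norm (wdist (fourier (u s)) (fourier (u t))) \<le> (Z2 / 2 + 2) * H_norm (1 + \<alpha>) (\<lambda>x. u s x - u t x)" if s: "s \<in> {0..T}" for s
      proof -
        have "0 \<le> wdist (fourier (u s)) (fourier (u t))" by (intro infsum_nonneg) (simp add: J_pos less_imp_le)
        thus ?thesis using sobolev_wiener(2)[OF r(1) dH[OF s t]] by (simp add: H_norm_def fd[OF s t])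
      qed
      thus "\<forall>\<^sub>F s in at t within {0..T}. norm (wdist (fourier (u s)) (fourier (u t))) \<le> (Z2 / 2 + 2) * H_norm (1 + \<alpha>) (\<lambda>x. u s x - u t x)"
        unfolding eventually_at_filter by (intro always_eventually) auto
    qed
  qed
qed

text \<open>Combines persistence of regularity, which makes the reference decay on the whole
  interval, with stability, applied with p = 2 r. Here \<open>r\<close> is the Sobolev exponent, and
  the mismatch parameter is called \<rho>.\<close>

lemma fsol_limit:
  assumes d: "fsol \<beta>0 \<theta> T d" and T: "0 < T" and r: "2 \<le> r" "r \<le> 3"
    and \<theta>: "\<And>k. \<bar>\<theta> k\<bar> \<le> J k powr r"
    and d0: "\<And>q. \<exists>M. \<forall>k. cmod (d 0 k) * J k ^ q \<le> M"
    and c: "\<And>\<epsilon>. 0 < \<epsilon> \<Longrightarrow> fsol (\<epsilon>\<^sup>2) \<theta> T (c \<epsilon>)" "\<And>\<epsilon> k. 0 < \<epsilon> \<Longrightarrow> c \<epsilon> 0 k = d 0 k"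
    and F: "((\<lambda>\<epsilon>. \<epsilon>\<^sup>2) \<longlongrightarrow> \<beta>0) F" "\<forall>\<^sub>F \<epsilon> in F. 0 < \<epsilon>" and e: "0 < e"
  shows "\<forall>\<^sub>F \<epsilon> in F. 0 < \<epsilon> \<and> (\<forall>t\<in>{0..T}.
      sqrt (\<Sum>\<^sub>\<infinity>k. (1 + (of_int k)\<^sup>2) powr r * (cmod (c \<epsilon> t k - d t k))\<^sup>2) < e \<and>
      sqrt (\<Sum>\<^sub>\<infinity>k. (cmod (rhs (\<epsilon>\<^sup>2) \<theta> (c \<epsilon> t) k - rhs \<beta>0 \<theta> (d t) k))\<^sup>2) < e)"
proof -
  have decay: "\<exists>M. \<forall>t\<in>{0..T}. \<forall>k. cmod (d t k) * J k ^ q \<le> M" for q by (rule fsol_decay[OF d d0])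
  have \<theta>': "\<bar>\<theta> k\<bar> \<le> J k powr (2 * r / 2)" for k using \<theta>[of k] by simp
  obtain G r0 where r0: "0 < r0" and G: "\<And>\<rho> \<beta> c t. \<lbrakk>0 < \<rho>; \<rho> < r0; \<bar>\<beta> - \<beta>0\<bar> \<le> \<rho>\<^sup>2; fsol \<beta> \<theta> T c; \<And>k. c 0 k = d 0 k; t \<in> {0..T}\<rbrakk> \<Longrightarrow>
       (\<lambda>k. J k powr (2 * r) * (cmod (c t k - d t k))\<^sup>2) summable_on UNIV \<and>
       (\<Sum>\<^sub>\<infinity>k. J k powr (2 * r) * (cmod (c t k - d t k))\<^sup>2) \<le> G * \<rho> \<and>
       (\<lambda>k. (cmod (rhs \<beta> \<theta> (c t) k - rhs \<beta>0 \<theta> (d t) k))\<^sup>2) summable_on UNIV \<and>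
       (\<Sum>\<^sub>\<infinity>k. (cmod (rhs \<beta> \<theta> (c t) k - rhs \<beta>0 \<theta> (d t) k))\<^sup>2) \<le> G * \<rho>"
    by (rule fsol_stability[OF d _ _ _ \<theta>' decay]) (use T r in auto)
  \<comment> \<open>The first entry keeps \<rho> strictly below \<open>r0\<close>, the second makes
    G \<rho> at most e^2 / 2; using |G| + 1 keeps the denominator positive.\<close>
  define \<rho> where "\<rho> = min (r0 / 2) (e\<^sup>2 / (2 * (\<bar>G\<bar> + 1)))"
  have \<rho>: "0 < \<rho>" "\<rho> < r0" using r0 e by (auto simp: \<rho>_def min_less_iff_disj)
  have "G * \<rho> \<le> (\<bar>G\<bar> + 1) * \<rho>" using \<rho> by (intro mult_right_mono) auto
  also have "\<dots> \<le> (\<bar>G\<bar> + 1) * (e\<^sup>2 / (2 * (\<bar>G\<bar> + 1)))" by (intro mult_left_mono) (auto simp: \<rho>_def)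
  also have "\<dots> = e\<^sup>2 / 2" by (simp add: field_simps)
  also have "\<dots> < e\<^sup>2" using e by simp
  finally have Ge: "G * \<rho> < e\<^sup>2" .
  have "\<forall>\<^sub>F \<epsilon> in F. dist (\<epsilon>\<^sup>2) \<beta>0 < \<rho>\<^sup>2" using F(1) \<rho> by (intro tendstoD) auto
  with F(2) show ?thesis
  proof eventually_elim
    case (elim \<epsilon>)
    have near: "\<bar>\<epsilon>\<^sup>2 - \<beta>0\<bar> \<le> \<rho>\<^sup>2" using elim(2) by (simp add: dist_real_def)
    have "sqrt (\<Sum>\<^sub>\<infinity>k. (1 + (of_int k)\<^sup>2) powr r * (cmod (c \<epsilon> t k - d t k))\<^sup>2) < e \<and>
      sqrt (\<Sum>\<^sub>\<infinity>k. (cmod (rhs (\<epsilon>\<^sup>2) \<theta> (c \<epsilon> t) k - rhs \<beta>0 \<theta> (d t) k))\<^sup>2) < e" if t: "t \<in> {0..T}" for t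
    proof -
      note g = G[OF \<rho> near c(1)[OF elim(1)] c(2)[OF elim(1)] t]
      have le: "(1 + (of_int k)\<^sup>2) powr r * (cmod (c \<epsilon> t k - d t k))\<^sup>2 \<le> J k powr (2 * r) * (cmod (c \<epsilon> t k - d t k))\<^sup>2" for k
        using r by (intro mult_right_mono bracket_powr_le) auto
      have s: "(\<lambda>k. (1 + (of_int k)\<^sup>2) powr r * (cmod (c \<epsilon> t k - d t k))\<^sup>2) summable_on UNIV"
        by (rule summable_on_comparison_test[OF g[THEN conjunct1] le]) simp
      have "(\<Sum>\<^sub>\<infinity>k. (1 + (of_int k)\<^sup>2) powr r * (cmod (c \<epsilon> t k - d t k))\<^sup>2) < e\<^sup>2"
        using infsum_mono[OF s g[THEN conjunct1] le] g Ge by linarith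
      moreover have "(\<Sum>\<^sub>\<infinity>k. (cmod (rhs (\<epsilon>\<^sup>2) \<theta> (c \<epsilon> t) k - rhs \<beta>0 \<theta> (d t) k))\<^sup>2) < e\<^sup>2"
        using g Ge by linarith
      ultimately show ?thesis using e by (simp add: real_less_lsqrt)
    qed
    thus ?case using elim(1) by blast
  qed
qed

text \<open>Both limits are instances of \<open>fsol_limit\<close>: the reference is the solution
  with parameter \<epsilon>0 in the first case and the Burgers solution, with dispersion coefficient
  0, in the second. All solutions share the coefficients of u0 at time 0.\<close>

theorem theorem4p1:
  fixes \<alpha> Tc :: real and u0 :: "real \<Rightarrow> real"
    and u du :: "real \<Rightarrow> real \<Rightarrow> real \<Rightarrow> real"
    and v :: "real \<Rightarrow> real \<Rightarrow> real"
  assumes "1 \<le> \<alpha>" and "\<alpha> \<le> 2"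
    and "in_H (1 + \<alpha>) u0" and "smooth u0"
    and "0 < Tc" and "ereal Tc < critical_time u0"
    and "\<forall>\<epsilon>>0. fkdv_sol \<alpha> \<epsilon> Tc u0 (u \<epsilon>) (du \<epsilon>)"
    and "burgers_sol Tc u0 v"
  shows "(\<forall>\<epsilon>0>0.
            uniform_limit {0..Tc} (\<lambda>\<epsilon> t. H_norm (1 + \<alpha>) (\<lambda>x. u \<epsilon> t x - u \<epsilon>0 t x))
              (\<lambda>t. 0) (at \<epsilon>0 within {0<..}) \<and>
            uniform_limit {0..Tc} (\<lambda>\<epsilon> t. H_norm 0 (\<lambda>x. du \<epsilon> t x - du \<epsilon>0 t x))
              (\<lambda>t. 0) (at \<epsilon>0 within {0<..})) \<and>
         uniform_limit {0..Tc} (\<lambda>\<epsilon> t. H_norm (1 + \<alpha>) (\<lambda>x. u \<epsilon> t x - v t x))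
           (\<lambda>t. 0) (at_right 0)"
proof -
  have per: "periodic2pi u0" using assms(3) by (simp add: in_H_def)
  have r: "2 \<le> 1 + \<alpha>" "1 + \<alpha> \<le> 3" using assms(1,2) by auto
  have sym: "\<bar>fkdv_symbol \<alpha> k\<bar> \<le> J k powr (1 + \<alpha>)" for k using fkdv_symbol_le assms(1) by simp
  have sol: "fkdv_sol \<alpha> \<epsilon> Tc u0 (u \<epsilon>) (du \<epsilon>)" if "0 < \<epsilon>" for \<epsilon> using assms(7) that by blast
  note fk = fkdv_fsol[OF assms(1) sol assms(3,5)]
  note bu = burgers_fsol[OF assms(4) per assms(5,6,8)]
  have nn: "0 \<le> H_norm s f" for s f unfolding H_norm_def by (intro real_sqrt_ge_zero infsum_nonneg) simp
  have decay0: "\<exists>M. \<forall>k. cmod (fourier u0 k) * J k ^ q \<le> M" for q by (rule smooth_fourier_decay[OF assms(4) per])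
  have "uniform_limit {0..Tc} (\<lambda>\<epsilon> t. H_norm (1 + \<alpha>) (\<lambda>x. u \<epsilon> t x - u \<epsilon>0 t x)) (\<lambda>t. 0) (at \<epsilon>0 within {0<..}) \<and>
      uniform_limit {0..Tc} (\<lambda>\<epsilon> t. H_norm 0 (\<lambda>x. du \<epsilon> t x - du \<epsilon>0 t x)) (\<lambda>t. 0) (at \<epsilon>0 within {0<..})"
    if e0: "0 < \<epsilon>0" for \<epsilon>0
  proof -
    have lim: "((\<lambda>\<epsilon>. \<epsilon>\<^sup>2) \<longlongrightarrow> \<epsilon>0\<^sup>2) (at \<epsilon>0 within {0<..})" by (intro tendsto_intros)
    have pos: "\<forall>\<^sub>F \<epsilon> in at \<epsilon>0 within {0<..}. 0 < \<epsilon>" by (simp add: eventually_at_filter)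
    have key: "\<forall>\<^sub>F \<epsilon> in at \<epsilon>0 within {0<..}. \<forall>t\<in>{0..Tc}. H_norm (1 + \<alpha>) (\<lambda>x. u \<epsilon> t x - u \<epsilon>0 t x) < e \<and> H_norm 0 (\<lambda>x. du \<epsilon> t x - du \<epsilon>0 t x) < e"
      if e: "0 < e" for e
    proof -
      \<comment> \<open>Smoothness of u0 enters as rapid decay of the initial coefficients of the
        reference.\<close>
      have d0: "\<exists>M. \<forall>k. cmod (fourier (u \<epsilon>0 0) k) * J k ^ q \<le> M" for q using decay0 by (simp add: fk(5)[OF e0])
      have i: "fourier (u \<epsilon> 0) k = fourier (u \<epsilon>0 0) k" if "0 < \<epsilon>" for \<epsilon> k by (simp add: fk(5) that e0)
      have "\<forall>\<^sub>F \<epsilon> in at \<epsilon>0 within {0<..}. 0 < \<epsilon> \<and> (\<forall>t\<in>{0..Tc}.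
          sqrt (\<Sum>\<^sub>\<infinity>k. (1 + (of_int k)\<^sup>2) powr (1 + \<alpha>) * (cmod (fourier (u \<epsilon> t) k - fourier (u \<epsilon>0 t) k))\<^sup>2) < e \<and>
          sqrt (\<Sum>\<^sub>\<infinity>k. (cmod (rhs (\<epsilon>\<^sup>2) (fkdv_symbol \<alpha>) (fourier (u \<epsilon> t)) k - rhs (\<epsilon>0\<^sup>2) (fkdv_symbol \<alpha>) (fourier (u \<epsilon>0 t)) k))\<^sup>2) < e)"
        by (rule fsol_limit[where c = "\<lambda>\<epsilon> t. fourier (u \<epsilon> t)", OF fk(1)[OF e0] assms(5) r sym d0 fk(1) i lim pos e])
      thus ?thesis
      proof eventually_elim
        case (elim \<epsilon>)
        have "H_norm (1 + \<alpha>) (\<lambda>x. u \<epsilon> t x - u \<epsilon>0 t x) < e \<and> H_norm 0 (\<lambda>x. du \<epsilon> t x - du \<epsilon>0 t x) < e" if t: "t \<in> {0..Tc}" for t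
        proof -
          have pe: "0 < \<epsilon>" using elim by blast
          have "H_norm (1 + \<alpha>) (\<lambda>x. u \<epsilon> t x - u \<epsilon>0 t x) < e"
            unfolding H_norm_def fourier_diff[OF fk(2)[OF pe t] fk(2)[OF e0 t]] using elim t by blast
          moreover have "H_norm 0 (\<lambda>x. du \<epsilon> t x - du \<epsilon>0 t x) < e"
            unfolding H_norm_0 fourier_diff[OF fk(3)[OF pe t] fk(3)[OF e0 t]] fk(4)[OF pe t] fk(4)[OF e0 t] using elim t by blast
          ultimately show ?thesis by blast
        qed
        thus ?case by blast
      qed
    qed
    show ?thesis unfolding uniform_limit_iff
    proof (intro conjI allI impI)
      fix e :: real assume e: "0 < e"
      show "\<forall>\<^sub>F \<epsilon> in at \<epsilon>0 within {0<..}. \<forall>t\<in>{0..Tc}. dist (H_norm (1 + \<alpha>) (\<lambda>x. u \<epsilon> t x - u \<epsilon>0 t x)) 0 < e"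
        using key[OF e] by eventually_elim (simp add: nn)
      show "\<forall>\<^sub>F \<epsilon> in at \<epsilon>0 within {0<..}. \<forall>t\<in>{0..Tc}. dist (H_norm 0 (\<lambda>x. du \<epsilon> t x - du \<epsilon>0 t x)) 0 < e"
        using key[OF e] by eventually_elim (simp add: nn)
    qed
  qed
  moreover have "uniform_limit {0..Tc} (\<lambda>\<epsilon> t. H_norm (1 + \<alpha>) (\<lambda>x. u \<epsilon> t x - v t x)) (\<lambda>t. 0) (at_right 0)"
    unfolding uniform_limit_iff
  proof (intro allI impI)
    fix e :: real assume e: "0 < e"
    have lim: "((\<lambda>\<epsilon>::real. \<epsilon>\<^sup>2) \<longlongrightarrow> 0) (at_right 0)" by (auto intro!: tendsto_eq_intros)
    have pos: "\<forall>\<^sub>F \<epsilon> in at_right (0::real). 0 < \<epsilon>" by (simp add: eventually_at_filter)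
    \<comment> \<open>Decay is supplied at time 0 alone; \<open>fsol_limit\<close> carries it up to
      \<open>Tc\<close>, which is possible because \<open>bu(1)\<close> already places the Burgers
      solution in the Wiener class on that interval.\<close>
    have d0: "\<exists>M. \<forall>k. cmod (fourier (v 0) k) * J k ^ q \<le> M" for q using decay0 by (simp add: bu(3))
    have i: "fourier (u \<epsilon> 0) k = fourier (v 0) k" if "0 < \<epsilon>" for \<epsilon> k by (simp add: fk(5) that bu(3))
    have "\<forall>\<^sub>F \<epsilon> in at_right 0. 0 < \<epsilon> \<and> (\<forall>t\<in>{0..Tc}.
        sqrt (\<Sum>\<^sub>\<infinity>k. (1 + (of_int k)\<^sup>2) powr (1 + \<alpha>) * (cmod (fourier (u \<epsilon> t) k - fourier (v t) k))\<^sup>2) < e \<and>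
        sqrt (\<Sum>\<^sub>\<infinity>k. (cmod (rhs (\<epsilon>\<^sup>2) (fkdv_symbol \<alpha>) (fourier (u \<epsilon> t)) k - rhs 0 (fkdv_symbol \<alpha>) (fourier (v t)) k))\<^sup>2) < e)"
      by (rule fsol_limit[where c = "\<lambda>\<epsilon> t. fourier (u \<epsilon> t)", OF bu(1) assms(5) r sym d0 fk(1) i lim pos e])
    thus "\<forall>\<^sub>F \<epsilon> in at_right 0. \<forall>t\<in>{0..Tc}. dist (H_norm (1 + \<alpha>) (\<lambda>x. u \<epsilon> t x - v t x)) 0 < e"
    proof eventually_elim
      case (elim \<epsilon>)
      have "dist (H_norm (1 + \<alpha>) (\<lambda>x. u \<epsilon> t x - v t x)) 0 < e" if t: "t \<in> {0..Tc}" for t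
      proof -
        have pe: "0 < \<epsilon>" using elim by blast
        have "H_norm (1 + \<alpha>) (\<lambda>x. u \<epsilon> t x - v t x) < e"
          unfolding H_norm_def fourier_diff[OF fk(2)[OF pe t] bu(2)[OF t]] using elim t by blast
        thus ?thesis by (simp add: nn)
      qed
      thus ?case by blast
    qed
  qed
  ultimately show ?thesis by blast
qed

end
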